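(* For each decorated dimension vector $(\mathbf d,\mathbf v)\in\mathbb Z_{\ge0}^n\times\mathbb Z_{\ge0}^n$ and each vertex $k$ of $Q$, the function $\mathrm{decRep}(\Lambda,\mathbf d,\mathbf v)\to\mathbb Z$ that assigns to each decorated representation $\mathcal M=(M,\mathbf v)$ the $k$-th entry of its extended $\mathbf g$-vector $\widetilde{\mathbf g}_{\mathcal M}^{\widetilde\Lambda}$ is upper semicontinuous.
   Context: Let $n\ge 1$, $m\ge 0$ be integers and $[\ell]=\{1,\dots,\ell\}$. Let $\widetilde Q$ be a finite quiver with vertex set $[n+m]$ and arrows $a\colon s(a)\to t(a)$; $Q$ is the quiver with the same vertex set $[n+m]$ whose arrows are the arrows of $\widetilde Q$ with both endpoints in $[n]$. $\mathbb C\langle\langle \widetilde Q\rangle\rangle$ and $\mathbb C\langle\langle Q\rangle\rangle$ are the complete path algebras, with arrow ideals $\widetilde{\mathfrak m}$, $\mathfrak m$ and the corresponding adic topologies. $\widehat\rho\colon \mathbb C\langle\langle \widetilde Q\rangle\rangle\to\mathbb C\langle\langle Q\rangle\rangle$ is the continuous $\mathbb C$-algebra homomorphism that is the identity on vertex idempotents and on arrows of $Q$ and sends all other arrows to $0$. $\widetilde{\mathcal J}\subseteq\widetilde{\mathfrak m}^2$ is a closed two-sided ideal, $\mathcal J:=\widehat\rho(\widetilde{\mathcal J})$, $\widetilde\Lambda:=\mathbb C\langle\langle \widetilde Q\rangle\rangle/\widetilde{\mathcal J}$, $\Lambda:=\mathbb C\langle\langle Q\rangle\rangle/\mathcal J$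 (not assumed finite-dimensional). Via $\widehat\rho$, every left $\Lambda$-module is a left $\widetilde\Lambda$-module. $\mathrm{Rep}(\Lambda,\mathbf d)$ is the affine variety of (nilpotent) $M\in\prod_{a\in Q_1}\mathrm{Hom}_{\mathbb C}(\mathbb C^{d_{s(a)}},\mathbb C^{d_{t(a)}})$ annihilated by every element of $\mathcal J$, and $\mathrm{decRep}(\Lambda,\mathbf d,\mathbf v)=\mathrm{Rep}(\Lambda,\mathbf d)\times\{\mathbf v\}$, with the Zariski topology; its points are decorated representations supported in $[n]$. The extended $\mathbf g$-vector $\widetilde{\mathbf g}_{\mathcal M}^{\widetilde\Lambda}=(\widetilde g_i)_{i=1}^{n+m}$ is $\widetilde g_i=-\dim_{\mathbb C}\mathrm{Hom}_{\widetilde\Lambda}(S(i),M)+\dim_{\mathbb C}\mathrm{Ext}^1_{\widetilde\Lambda}(S(i),M)+v_i$, with $S(i)$ the simple at $i$ and $v_i=0$ for $i>n$. *)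

theory Defs
  imports
    "Graph_Theory.Arc_Walk"
    "Jordan_Normal_Form.VS_Connect"
    "HOL-Algebra.QuotRing"
    "HOL-Algebra.Ideal_Product"
    "HOL-Analysis.Abstract_Topology"
begin

section \<open>Complete path algebras\<close>

text \<open>
  A quiver is a directed multigraph. A path is a pair of its start vertex and its list of arrows,
  first arrow first; the empty list gives the trivial path at the start vertex.
\<close>

definition qpaths :: "('v, 'a) pre_digraph \<Rightarrow> ('v \<times> 'a list) set" where
  "qpaths G = {(u, w). \<exists>v. pre_digraph.awalk G u w v}"

definition path_end :: "('v, 'a) pre_digraph \<Rightarrow> 'v \<Rightarrow> 'a list \<Rightarrow> 'v" where
  "path_end G u w = (if w = [] then u else head G (last w))"

text \<open>
  An element is the family of coefficients of a formal, possibly infinite, linear combination of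
  paths. Paths compose from right to left like maps: in a product \<open>f \<cdot> g\<close> the path from \<open>g\<close>
  is traversed first. Hence representations, in which an arrow \<open>a\<close> acts as a map from the space
  at \<open>tail a\<close> to the space at \<open>head a\<close>, are left modules.
\<close>

definition cpa :: "('v, 'a) pre_digraph \<Rightarrow> ('v \<times> 'a list \<Rightarrow> complex) ring" where
  "cpa G =
    \<lparr>carrier = {f. \<forall>p. p \<notin> qpaths G \<longrightarrow> f p = 0},
     mult = (\<lambda>f g (u, w). \<Sum>k\<le>length w. f (path_end G u (take k w), drop k w) * g (u, take k w)),
     one = (\<lambda>(u, w). if u \<in> verts G \<and> w = [] then 1 else 0),
     zero = (\<lambda>_. 0),
     add = (\<lambda>f g p. f p + g p)\<rparr>"

definition cpa_scalar :: "('v, 'a) pre_digraph \<Rightarrow> complex \<Rightarrow> 'v \<times> 'a list \<Rightarrow> complex" where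
  "cpa_scalar G c = (\<lambda>p. c * \<one>\<^bsub>cpa G\<^esub> p)"

definition arrow_ideal :: "('v, 'a) pre_digraph \<Rightarrow> ('v \<times> 'a list \<Rightarrow> complex) set" where
  "arrow_ideal G = {f \<in> carrier (cpa G). \<forall>u \<in> verts G. f (u, []) = 0}"

primrec ideal_pow :: "('r, 'x) ring_scheme \<Rightarrow> 'r set \<Rightarrow> nat \<Rightarrow> 'r set" where
  "ideal_pow R I 0 = carrier R"
| "ideal_pow R I (Suc N) = ideal_prod R I (ideal_pow R I N)"

definition adic_topology :: "('r, 'x) ring_scheme \<Rightarrow> 'r set \<Rightarrow> 'r topology" where
  "adic_topology R I =
    topology (\<lambda>U. U \<subseteq> carrier R \<and> (\<forall>x\<in>U. \<exists>N. ideal_pow R I N +>\<^bsub>R\<^esub> x \<subseteq> U))"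

text \<open>The quiver with the same vertices and only those arrows that start and end in \<open>V\<close>.\<close>

definition restrict_quiver :: "('v, 'a) pre_digraph \<Rightarrow> 'v set \<Rightarrow> ('v, 'a) pre_digraph" where
  "restrict_quiver G V = G\<lparr>arcs := {a \<in> arcs G. tail G a \<in> V \<and> head G a \<in> V}\<rparr>"

text \<open>
  For a subquiver \<open>Q\<close> with the same vertices, this is the continuous algebra homomorphism that
  fixes the vertex idempotents and the arrows of \<open>Q\<close> and kills the remaining arrows: it kills
  exactly the paths that use a removed arrow.
\<close>

definition cpa_proj ::
    "('v, 'a) pre_digraph \<Rightarrow> ('v \<times> 'a list \<Rightarrow> complex) \<Rightarrow> ('v \<times> 'a list \<Rightarrow> complex)" where
  "cpa_proj Q f = (\<lambda>p. if p \<in> qpaths Q then f p else 0)"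


lemma qpaths_Nil [simp]: "(u, []) \<in> qpaths G \<longleftrightarrow> u \<in> verts G"
  by (auto simp: qpaths_def pre_digraph.awalk_def pre_digraph.cas.simps)

lemma (in wf_digraph) qpaths_Cons:
  "(u, a # w) \<in> qpaths G \<longleftrightarrow> a \<in> arcs G \<and> tail G a = u \<and> (head G a, w) \<in> qpaths G"
  by (auto simp: qpaths_def awalk_def)

lemma path_end_Nil [simp]: "path_end G u [] = u"
  and path_end_Cons [simp]: "path_end G u (a # w) = path_end G (head G a) w"
  by (auto simp: path_end_def)

lemma path_end_append [simp]: "path_end G u (w @ w') = path_end G (path_end G u w) w'"
  by (induction w arbitrary: u) auto

lemma (in wf_digraph) qpaths_append:
  "(u, w @ w') \<in> qpaths G \<longleftrightarrow> (u, w) \<in> qpaths G \<and> (path_end G u w, w') \<in> qpaths G"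
proof (induction w arbitrary: u)
  case Nil
  have "(u, w') \<in> qpaths G \<Longrightarrow> u \<in> verts G" by (auto simp: qpaths_def awalk_def)
  then show ?case by auto
next
  case (Cons a w)
  then show ?case by (auto simp: qpaths_Cons)
qed

lemma (in wf_digraph) qpaths_split:
  "(u, w) \<in> qpaths G \<longleftrightarrow>
    (u, take k w) \<in> qpaths G \<and> (path_end G u (take k w), drop k w) \<in> qpaths G"
  by (metis append_take_drop_id qpaths_append)

lemma (in wf_digraph) path_end_in_verts:
  "(u, w) \<in> qpaths G \<Longrightarrow> path_end G u w \<in> verts G"
  using qpaths_append[of u w "[]"] by simp

lemma cpa_simps [simp]:
  "carrier (cpa G) = {f. \<forall>p. p \<notin> qpaths G \<longrightarrow> f p = 0}"
  "\<zero>\<^bsub>cpa G\<^esub> = (\<lambda>_. 0)"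
  "f \<oplus>\<^bsub>cpa G\<^esub> g = (\<lambda>p. f p + g p)"
  by (auto simp: cpa_def)

lemma cpa_mult:
  "(f \<otimes>\<^bsub>cpa G\<^esub> g) (u, w) =
    (\<Sum>k\<le>length w. f (path_end G u (take k w), drop k w) * g (u, take k w))"
  by (simp add: cpa_def)

lemma cpa_one: "\<one>\<^bsub>cpa G\<^esub> (u, w) = (if u \<in> verts G \<and> w = [] then 1 else 0)"
  by (simp add: cpa_def)

lemma (in wf_digraph) cpa_mult_closed:
  assumes "f \<in> carrier (cpa G)" "g \<in> carrier (cpa G)"
  shows "f \<otimes>\<^bsub>cpa G\<^esub> g \<in> carrier (cpa G)"
proof -
  have "(f \<otimes>\<^bsub>cpa G\<^esub> g) (u, w) = 0" if "(u, w) \<notin> qpaths G" for u w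
    unfolding cpa_mult
  proof (rule sum.neutral, intro ballI)
    fix k
    show "f (path_end G u (take k w), drop k w) * g (u, take k w) = 0"
      using that assms qpaths_split[of u w k] by auto
  qed
  then show ?thesis by auto
qed

lemma cpa_mult_assoc: "f \<otimes>\<^bsub>cpa G\<^esub> g \<otimes>\<^bsub>cpa G\<^esub> h = f \<otimes>\<^bsub>cpa G\<^esub> (g \<otimes>\<^bsub>cpa G\<^esub> h)"
proof (rule ext, clarify)
  fix u w
  let ?e = "\<lambda>k. path_end G u (take k w)"
  let ?T = "\<lambda>k l. f (?e l, drop l w) * g (?e k, drop k (take l w)) * h (u, take k w)"
  have end_eq: "path_end G (?e k) (take l (drop k w)) = ?e (k + l)" for k l
    by (simp add: take_add)
  have "(f \<otimes>\<^bsub>cpa G\<^esub> g \<otimes>\<^bsub>cpa G\<^esub> h) (u, w) =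
      (\<Sum>k\<le>length w. \<Sum>l\<le>length w - k. ?T k (k + l))"
    unfolding cpa_mult sum_distrib_right
    by (simp add: end_eq drop_take add.commute)
  also have "\<dots> = (\<Sum>k\<le>length w. \<Sum>l\<in>{k..length w}. ?T k l)"
  proof (rule sum.cong[OF refl])
    fix k assume "k \<in> {..length w}"
    then show "(\<Sum>l\<le>length w - k. ?T k (k + l)) = (\<Sum>l\<in>{k..length w}. ?T k l)"
      by (intro sum.reindex_bij_witness[of _ "\<lambda>l. l - k" "\<lambda>l. k + l"]) auto
  qed
  also have "\<dots> = (\<Sum>(k, l)\<in>(SIGMA k:{..length w}. {k..length w}). ?T k l)"
    by (rule sum.Sigma) auto
  also have "\<dots> = (\<Sum>(l, k)\<in>(SIGMA l:{..length w}. {..l}). ?T k l)"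
    by (rule sum.reindex_bij_witness[of _ prod.swap prod.swap]) auto
  also have "\<dots> = (\<Sum>l\<le>length w. \<Sum>k\<le>l. ?T k l)"
    by (rule sum.Sigma[symmetric]) auto
  also have "\<dots> = (f \<otimes>\<^bsub>cpa G\<^esub> (g \<otimes>\<^bsub>cpa G\<^esub> h)) (u, w)"
    unfolding cpa_mult sum_distrib_left
  proof (rule sum.cong[OF refl])
    fix l assume "l \<in> {..length w}"
    then have "length (take l w) = l" by simp
    then show "(\<Sum>k\<le>l. ?T k l) = (\<Sum>k\<le>length (take l w). f (?e l, drop l w) *
        (g (path_end G u (take k (take l w)), drop k (take l w)) * h (u, take k (take l w))))"
      by (auto simp: mult.assoc min_absorb1 intro!: sum.cong)
  qed
  finally show "(f \<otimes>\<^bsub>cpa G\<^esub> g \<otimes>\<^bsub>cpa G\<^esub> h) (u, w) = (f \<otimes>\<^bsub>cpa G\<^esub> (g \<otimes>\<^bsub>cpa G\<^esub> h)) (u, w)" .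
qed

lemma (in wf_digraph) ring_cpa: "ring (cpa G)"
proof (rule ringI)
  show "abelian_group (cpa G)"
  proof (rule abelian_groupI)
    fix f assume "f \<in> carrier (cpa G)"
    then show "\<exists>g\<in>carrier (cpa G). g \<oplus>\<^bsub>cpa G\<^esub> f = \<zero>\<^bsub>cpa G\<^esub>"
      by (intro bexI[of _ "\<lambda>p. - f p"]) auto
  qed (auto simp: add_ac)
  show "monoid (cpa G)"
  proof
    show "\<one>\<^bsub>cpa G\<^esub> \<in> carrier (cpa G)" by (auto simp: cpa_one)
    fix f assume f: "f \<in> carrier (cpa G)"
    show "f \<otimes>\<^bsub>cpa G\<^esub> \<one>\<^bsub>cpa G\<^esub> = f"
    proof (rule ext, clarify)
      fix u w
      have "(f \<otimes>\<^bsub>cpa G\<^esub> \<one>\<^bsub>cpa G\<^esub>) (u, w) = (\<Sum>k\<in>{0}. f (path_end G u (take k w), drop k w) * \<one>\<^bsub>cpa G\<^esub> (u, take k w))"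
        unfolding cpa_mult by (rule sum.mono_neutral_right) (auto simp: cpa_one)
      also have "\<dots> = f (u, w)" using f qpaths_split[of u w 0] by (auto simp: cpa_one)
      finally show "(f \<otimes>\<^bsub>cpa G\<^esub> \<one>\<^bsub>cpa G\<^esub>) (u, w) = f (u, w)" .
    qed
    show "\<one>\<^bsub>cpa G\<^esub> \<otimes>\<^bsub>cpa G\<^esub> f = f"
    proof (rule ext, clarify)
      fix u w
      have "(\<one>\<^bsub>cpa G\<^esub> \<otimes>\<^bsub>cpa G\<^esub> f) (u, w) = (\<Sum>k\<in>{length w}. \<one>\<^bsub>cpa G\<^esub> (path_end G u (take k w), drop k w) * f (u, take k w))"
        unfolding cpa_mult by (rule sum.mono_neutral_right) (auto simp: cpa_one)
      also have "\<dots> = f (u, w)" using f path_end_in_verts[of u w] by (auto simp: cpa_one)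
      finally show "(\<one>\<^bsub>cpa G\<^esub> \<otimes>\<^bsub>cpa G\<^esub> f) (u, w) = f (u, w)" .
    qed
  qed (use cpa_mult_closed cpa_mult_assoc in blast)+
  fix f g h
  show "(f \<oplus>\<^bsub>cpa G\<^esub> g) \<otimes>\<^bsub>cpa G\<^esub> h = f \<otimes>\<^bsub>cpa G\<^esub> h \<oplus>\<^bsub>cpa G\<^esub> g \<otimes>\<^bsub>cpa G\<^esub> h"
    by (rule ext, clarify) (simp add: cpa_mult sum.distrib distrib_right)
  show "h \<otimes>\<^bsub>cpa G\<^esub> (f \<oplus>\<^bsub>cpa G\<^esub> g) = h \<otimes>\<^bsub>cpa G\<^esub> f \<oplus>\<^bsub>cpa G\<^esub> h \<otimes>\<^bsub>cpa G\<^esub> g"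
    by (rule ext, clarify) (simp add: cpa_mult sum.distrib distrib_left)
qed

lemma (in wf_digraph) ideal_arrow_ideal: "ideal (arrow_ideal G) (cpa G)"
proof -
  interpret R: ring "cpa G" by (rule ring_cpa)
  show ?thesis
  proof (rule idealI[OF ring_cpa])
    show "subgroup (arrow_ideal G) (add_monoid (cpa G))"
    proof (rule R.add.subgroupI)
      fix f assume f: "f \<in> arrow_ideal G"
      have "\<ominus>\<^bsub>cpa G\<^esub> f = (\<lambda>p. - f p)"
        using f by (intro R.minus_equality) (auto simp: arrow_ideal_def)
      then show "\<ominus>\<^bsub>cpa G\<^esub> f \<in> arrow_ideal G"
        using f by (auto simp: arrow_ideal_def)
    next
      have "\<zero>\<^bsub>cpa G\<^esub> \<in> arrow_ideal G" by (simp add: arrow_ideal_def)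
      then show "arrow_ideal G \<noteq> {}" by blast
    qed (auto simp: arrow_ideal_def)
  next
    fix f g assume f: "f \<in> arrow_ideal G" and g: "g \<in> carrier (cpa G)"
    then have "g \<otimes>\<^bsub>cpa G\<^esub> f \<in> carrier (cpa G)" "f \<otimes>\<^bsub>cpa G\<^esub> g \<in> carrier (cpa G)"
      using R.m_closed unfolding arrow_ideal_def by blast+
    then show "g \<otimes>\<^bsub>cpa G\<^esub> f \<in> arrow_ideal G" "f \<otimes>\<^bsub>cpa G\<^esub> g \<in> arrow_ideal G"
      using f by (simp_all add: arrow_ideal_def cpa_mult)
  qed
qed

lemma ideal_ideal_pow: "ideal I R \<Longrightarrow> ideal (ideal_pow R I N) R"
  by (induction N) (auto simp: ring.ideal_prod_is_ideal ideal.axioms(2) ring.oneideal)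

lemma ideal_pow_antimono:
  assumes "ideal I R" "N \<le> N'"
  shows "ideal_pow R I N' \<subseteq> ideal_pow R I N"
  using assms(2)
proof (induction rule: dec_induct)
  case (step k)
  have "ideal_pow R I (Suc k) \<subseteq> ideal_pow R I k"
    using ring.ideal_prod_inter[of R I "ideal_pow R I k"] assms(1) ideal_ideal_pow[OF assms(1)]
    by (auto dest: ideal.axioms(2))
  then show ?case using step.IH by blast
qed simp

lemma openin_adic_topology:
  assumes "ideal I R"
  shows "openin (adic_topology R I) U \<longleftrightarrow>
    U \<subseteq> carrier R \<and> (\<forall>x\<in>U. \<exists>N. ideal_pow R I N +>\<^bsub>R\<^esub> x \<subseteq> U)"
proof -
  have "istopology (\<lambda>U. U \<subseteq> carrier R \<and> (\<forall>x\<in>U. \<exists>N. ideal_pow R I N +>\<^bsub>R\<^esub> x \<subseteq> U))"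
    unfolding istopology_def
  proof (intro conjI allI impI ballI)
    fix S T x
    assume S: "S \<subseteq> carrier R \<and> (\<forall>x\<in>S. \<exists>N. ideal_pow R I N +>\<^bsub>R\<^esub> x \<subseteq> S)"
      and T: "T \<subseteq> carrier R \<and> (\<forall>x\<in>T. \<exists>N. ideal_pow R I N +>\<^bsub>R\<^esub> x \<subseteq> T)"
      and x: "x \<in> S \<inter> T"
    obtain N1 N2 where "ideal_pow R I N1 +>\<^bsub>R\<^esub> x \<subseteq> S" "ideal_pow R I N2 +>\<^bsub>R\<^esub> x \<subseteq> T"
      using S T x by blast
    moreover have "ideal_pow R I (max N1 N2) \<subseteq> ideal_pow R I N1"
      "ideal_pow R I (max N1 N2) \<subseteq> ideal_pow R I N2"
      by (simp_all add: ideal_pow_antimono[OF assms])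
    ultimately have "ideal_pow R I (max N1 N2) +>\<^bsub>R\<^esub> x \<subseteq> S \<inter> T"
      unfolding a_r_coset_def r_coset_def by blast
    then show "\<exists>N. ideal_pow R I N +>\<^bsub>R\<^esub> x \<subseteq> S \<inter> T" by blast
  next
    fix K x
    assume "\<forall>S\<in>K. S \<subseteq> carrier R \<and> (\<forall>x\<in>S. \<exists>N. ideal_pow R I N +>\<^bsub>R\<^esub> x \<subseteq> S)" "x \<in> \<Union>K"
    then show "\<exists>N. ideal_pow R I N +>\<^bsub>R\<^esub> x \<subseteq> \<Union>K" by (meson Union_iff Union_upper subset_trans)
  qed blast+
  then show ?thesis by (simp add: adic_topology_def topology_inverse')
qed

lemma topspace_adic_topology:
  assumes "ideal I R"
  shows "topspace (adic_topology R I) = carrier R"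
proof -
  interpret ideal I R by fact
  have "openin (adic_topology R I) (carrier R)"
    unfolding openin_adic_topology[OF assms] 
  proof (intro conjI ballI exI subset_refl)
    fix x assume "x \<in> carrier R"
    then show "ideal_pow R I 0 +>\<^bsub>R\<^esub> x \<subseteq> carrier R"
      by (simp add: a_r_coset_subset_G)
  qed
  then show ?thesis
    using openin_topspace[of "adic_topology R I"] openin_subset[of "adic_topology R I" "carrier R"]
    unfolding openin_adic_topology[OF assms] by blast
qed

lemma restrict_quiver_simps [simp]:
  "verts (restrict_quiver G V) = verts G"
  "arcs (restrict_quiver G V) = {a \<in> arcs G. tail G a \<in> V \<and> head G a \<in> V}"
  "tail (restrict_quiver G V) = tail G"
  "head (restrict_quiver G V) = head G"
  by (simp_all add: restrict_quiver_def)

lemma path_end_restrict_quiver [simp]: "path_end (restrict_quiver G V) = path_end G"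
  by (simp add: path_end_def fun_eq_iff)

lemma (in wf_digraph) wf_restrict_quiver: "wf_digraph (restrict_quiver G V)"
  by unfold_locales auto

lemma (in wf_digraph) cpa_proj_ring_hom:
  "cpa_proj (restrict_quiver G V) \<in> Ring.ring_hom (cpa G) (cpa (restrict_quiver G V))"
proof -
  let ?Q = "restrict_quiver G V"
  interpret Q: wf_digraph ?Q by (rule wf_restrict_quiver)
  show ?thesis
  proof (rule ring_hom_memI)
    fix f g assume "f \<in> carrier (cpa G)" "g \<in> carrier (cpa G)"
    show "cpa_proj ?Q (f \<otimes>\<^bsub>cpa G\<^esub> g) = cpa_proj ?Q f \<otimes>\<^bsub>cpa ?Q\<^esub> cpa_proj ?Q g"
    proof (rule ext, clarify)
      fix u w
      have iff: "(u, w) \<in> qpaths ?Q \<longleftrightarrow>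
          (u, take k w) \<in> qpaths ?Q \<and> (path_end G u (take k w), drop k w) \<in> qpaths ?Q" for k
        using Q.qpaths_split[of u w k] by simp
      show "cpa_proj ?Q (f \<otimes>\<^bsub>cpa G\<^esub> g) (u, w) = (cpa_proj ?Q f \<otimes>\<^bsub>cpa ?Q\<^esub> cpa_proj ?Q g) (u, w)"
      proof (cases "(u, w) \<in> qpaths ?Q")
        case True
        then show ?thesis using iff by (simp add: cpa_proj_def cpa_mult)
      next
        case False
        have "cpa_proj ?Q f (path_end G u (take k w), drop k w) * cpa_proj ?Q g (u, take k w) = 0" for k
          using False iff[of k] by (auto simp: cpa_proj_def)
        then show ?thesis using False by (simp add: cpa_mult) (simp add: cpa_proj_def)
      qed
    qed
  qed (auto simp: cpa_proj_def fun_eq_iff cpa_one)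
qed

text \<open>The basis element of the complete path algebra given by a path.\<close>

definition cpa_path :: "'v \<times> 'a list \<Rightarrow> 'v \<times> 'a list \<Rightarrow> complex" where
  "cpa_path p = (\<lambda>q. if q = p then 1 else 0)"

lemma (in wf_digraph) cpa_proj_path:
  assumes "p \<in> qpaths G"
  shows "cpa_proj (restrict_quiver G V) (cpa_path p) =
    (if p \<in> qpaths (restrict_quiver G V) then cpa_path p else \<zero>\<^bsub>cpa (restrict_quiver G V)\<^esub>)"
  by (auto simp: cpa_proj_def cpa_path_def fun_eq_iff)

lemma (in wf_digraph) continuous_map_cpa_proj:
  fixes V
  defines "Q \<equiv> restrict_quiver G V"
  shows "continuous_map (adic_topology (cpa G) (arrow_ideal G))
    (adic_topology (cpa Q) (arrow_ideal Q)) (cpa_proj Q)"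
proof -
  interpret Q: wf_digraph Q unfolding Q_def by (rule wf_restrict_quiver)
  note I = ideal_arrow_ideal Q.ideal_arrow_ideal
  have hom: "cpa_proj Q \<in> Ring.ring_hom (cpa G) (cpa Q)"
    unfolding Q_def by (rule cpa_proj_ring_hom)
  have car: "cpa_proj Q f \<in> carrier (cpa Q)" for f by (simp add: cpa_proj_def)
  have pow: "cpa_proj Q f \<in> ideal_pow (cpa Q) (arrow_ideal Q) N"
    if "f \<in> ideal_pow (cpa G) (arrow_ideal G) N" for f N
    using that
  proof (induction N arbitrary: f)
    case 0
    show ?case using car by simp
  next
    case (Suc N)
    have sub: "ideal_pow (cpa G) (arrow_ideal G) N \<subseteq> carrier (cpa G)"
      using ideal_ideal_pow[OF I(1), of N] by (meson ideal.Icarr subsetI)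
    have sub': "s \<in> carrier (cpa G)" if "s \<in> ideal_prod (cpa G) (arrow_ideal G) (ideal_pow (cpa G) (arrow_ideal G) N)" for s
      using that ring.ideal_prod_in_carrier[OF ring_cpa I(1) ideal_ideal_pow[OF I(1)]] by blast
    have "f \<in> ideal_prod (cpa G) (arrow_ideal G) (ideal_pow (cpa G) (arrow_ideal G) N)"
      using Suc.prems by simp
    then have "cpa_proj Q f \<in> ideal_prod (cpa Q) (arrow_ideal Q) (ideal_pow (cpa Q) (arrow_ideal Q) N)"
    proof (induction rule: ideal_prod.induct)
      case (prod i j)
      have "cpa_proj Q i \<in> arrow_ideal Q"
        using prod(1) by (auto simp: arrow_ideal_def cpa_proj_def Q_def)
      moreover have "cpa_proj Q (i \<otimes>\<^bsub>cpa G\<^esub> j) = cpa_proj Q i \<otimes>\<^bsub>cpa Q\<^esub> cpa_proj Q j"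
        by (rule ring_hom_mult[OF hom]) (use prod sub in \<open>auto simp: arrow_ideal_def\<close>)
      ultimately show ?case using Suc.IH[OF prod(2)] by (metis ideal_prod.prod)
    next
      case (sum s t)
      then show ?case
        using ring_hom_add[OF hom sub' sub'] by (metis ideal_prod.sum)
    qed
    then show ?case by simp
  qed
  show ?thesis
    unfolding continuous_map topspace_adic_topology[OF I(1)] topspace_adic_topology[OF I(2)]
  proof (intro conjI allI impI)
    show "cpa_proj Q ` carrier (cpa G) \<subseteq> carrier (cpa Q)" using car by blast
    fix U assume U: "openin (adic_topology (cpa Q) (arrow_ideal Q)) U"
    show "openin (adic_topology (cpa G) (arrow_ideal G)) {f \<in> carrier (cpa G). cpa_proj Q f \<in> U}"
      unfolding openin_adic_topology[OF I(1)]
    proof (intro conjI ballI)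
      fix f assume f: "f \<in> {f \<in> carrier (cpa G). cpa_proj Q f \<in> U}"
      then obtain N where N: "ideal_pow (cpa Q) (arrow_ideal Q) N +>\<^bsub>cpa Q\<^esub> cpa_proj Q f \<subseteq> U"
        using U unfolding openin_adic_topology[OF I(2)] by blast
      have "cpa_proj Q (h \<oplus>\<^bsub>cpa G\<^esub> f) \<in> U" "h \<oplus>\<^bsub>cpa G\<^esub> f \<in> carrier (cpa G)"
        if h: "h \<in> ideal_pow (cpa G) (arrow_ideal G) N" for h
      proof -
        have hc: "h \<in> carrier (cpa G)"
          using h ideal.Icarr[OF ideal_ideal_pow[OF I(1)]] by blast
        have eq: "cpa_proj Q (h \<oplus>\<^bsub>cpa G\<^esub> f) = cpa_proj Q h \<oplus>\<^bsub>cpa Q\<^esub> cpa_proj Q f"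
          by (rule ring_hom_add[OF hom hc]) (use f in blast)
        show "cpa_proj Q (h \<oplus>\<^bsub>cpa G\<^esub> f) \<in> U"
          unfolding eq using N pow[OF h] by (auto simp: a_r_coset_def r_coset_def)
        show "h \<oplus>\<^bsub>cpa G\<^esub> f \<in> carrier (cpa G)" using hc f by simp
      qed
      then have "ideal_pow (cpa G) (arrow_ideal G) N +>\<^bsub>cpa G\<^esub> f \<subseteq> {f \<in> carrier (cpa G). cpa_proj Q f \<in> U}"
        unfolding a_r_coset_def r_coset_def by auto
      then show "\<exists>N. ideal_pow (cpa G) (arrow_ideal G) N +>\<^bsub>cpa G\<^esub> f \<subseteq> {f \<in> carrier (cpa G). cpa_proj Q f \<in> U}"
        by blast
    qed blast
  qed
qed


section \<open>Hom and Ext for left modules\<close>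

text \<open>
  The record \<^typ>\<open>('r, 'x) module\<close> of the library is used for left modules over a ring that need
  not be commutative; its fields \<open>mult\<close> and \<open>one\<close> carry no information. When \<open>R\<close> is a
  \<open>\<complex>\<close>-algebra, \<open>\<iota> :: complex \<Rightarrow> 'r\<close> denotes its structure map.
\<close>

definition lmod_hom ::
    "('r, 'z) ring_scheme \<Rightarrow> ('r, 'x) module \<Rightarrow> ('r, 'y) module \<Rightarrow> ('x \<Rightarrow> 'y) set" where
  "lmod_hom R N M =
    {h \<in> carrier N \<rightarrow>\<^sub>E carrier M.
      (\<forall>x\<in>carrier N. \<forall>y\<in>carrier N. h (x \<oplus>\<^bsub>N\<^esub> y) = h x \<oplus>\<^bsub>M\<^esub> h y) \<and>
      (\<forall>r\<in>carrier R. \<forall>x\<in>carrier N. h (r \<odot>\<^bsub>N\<^esub> x) = r \<odot>\<^bsub>M\<^esub> h x)}"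

definition Hom_space ::
    "('r, 'z) ring_scheme \<Rightarrow> (complex \<Rightarrow> 'r) \<Rightarrow> ('r, 'x) module \<Rightarrow> ('r, 'y) module
      \<Rightarrow> (complex, 'x \<Rightarrow> 'y) module" where
  "Hom_space R \<iota> N M =
    \<lparr>carrier = lmod_hom R N M,
     mult = undefined, one = undefined,
     zero = (\<lambda>x\<in>carrier N. \<zero>\<^bsub>M\<^esub>),
     add = (\<lambda>f g. \<lambda>x\<in>carrier N. f x \<oplus>\<^bsub>M\<^esub> g x),
     smult = (\<lambda>c f. \<lambda>x\<in>carrier N. \<iota> c \<odot>\<^bsub>M\<^esub> f x)\<rparr>"

definition quot_space :: "('k, 'x) module \<Rightarrow> 'x set \<Rightarrow> ('k, 'x set) module" where
  "quot_space V B =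
    \<lparr>carrier = a_rcosets\<^bsub>V\<^esub> B,
     mult = undefined, one = undefined,
     zero = B,
     add = set_add V,
     smult = (\<lambda>c X. \<Union>x\<in>X. B +>\<^bsub>V\<^esub> (c \<odot>\<^bsub>V\<^esub> x))\<rparr>"

definition free_lmod :: "('r, 'z) ring_scheme \<Rightarrow> 'x set \<Rightarrow> ('r, 'x \<Rightarrow> 'r) module" where
  "free_lmod R X =
    \<lparr>carrier = {f \<in> X \<rightarrow>\<^sub>E carrier R. finite {x \<in> X. f x \<noteq> \<zero>\<^bsub>R\<^esub>}},
     mult = undefined, one = undefined,
     zero = (\<lambda>x\<in>X. \<zero>\<^bsub>R\<^esub>),
     add = (\<lambda>f g. \<lambda>x\<in>X. f x \<oplus>\<^bsub>R\<^esub> g x),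
     smult = (\<lambda>r f. \<lambda>x\<in>X. r \<otimes>\<^bsub>R\<^esub> f x)\<rparr>"

text \<open>The canonical surjection onto \<open>N\<close> from the free module on the elements of \<open>N\<close>.\<close>

definition free_cover :: "('r, 'z) ring_scheme \<Rightarrow> ('r, 'x) module \<Rightarrow> ('x \<Rightarrow> 'r) \<Rightarrow> 'x" where
  "free_cover R N f = (\<Oplus>\<^bsub>N\<^esub>x\<in>{x \<in> carrier N. f x \<noteq> \<zero>\<^bsub>R\<^esub>}. f x \<odot>\<^bsub>N\<^esub> x)"

definition free_syzygy :: "('r, 'z) ring_scheme \<Rightarrow> ('r, 'x) module \<Rightarrow> ('r, 'x \<Rightarrow> 'r) module" where
  "free_syzygy R N =
    (free_lmod R (carrier N))
      \<lparr>carrier := {f \<in> carrier (free_lmod R (carrier N)). free_cover R N f = \<zero>\<^bsub>N\<^esub>}\<rparr>"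

text \<open>
  With the canonical presentation \<open>0 \<rightarrow> K \<rightarrow> F \<rightarrow> N \<rightarrow> 0\<close>, where \<open>F\<close> is the free module on the
  elements of \<open>N\<close>, the space \<open>Ext\<^sup>1(N, M)\<close> is the cokernel of the restriction map
  \<open>Hom(F, M) \<rightarrow> Hom(K, M)\<close>, that is, the first right derived functor of \<open>Hom(-, M)\<close> at \<open>N\<close>.
\<close>

definition Ext1_space ::
    "('r, 'z) ring_scheme \<Rightarrow> (complex \<Rightarrow> 'r) \<Rightarrow> ('r, 'x) module \<Rightarrow> ('r, 'y) module
      \<Rightarrow> (complex, (('x \<Rightarrow> 'r) \<Rightarrow> 'y) set) module" where
  "Ext1_space R \<iota> N M =
    quot_space (Hom_space R \<iota> (free_syzygy R N) M)
      ((\<lambda>h. restrict h (carrier (free_syzygy R N))) ` lmod_hom R (free_lmod R (carrier N)) M)"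

definition hom_dim ::
    "('r, 'z) ring_scheme \<Rightarrow> (complex \<Rightarrow> 'r) \<Rightarrow> ('r, 'x) module \<Rightarrow> ('r, 'y) module \<Rightarrow> nat" where
  "hom_dim R \<iota> N M = vectorspace.dim class_ring (Hom_space R \<iota> N M)"

definition ext1_dim ::
    "('r, 'z) ring_scheme \<Rightarrow> (complex \<Rightarrow> 'r) \<Rightarrow> ('r, 'x) module \<Rightarrow> ('r, 'y) module \<Rightarrow> nat" where
  "ext1_dim R \<iota> N M = vectorspace.dim class_ring (Ext1_space R \<iota> N M)"

definition restrict_scalars :: "('s \<Rightarrow> 'r) \<Rightarrow> ('r, 'x) module \<Rightarrow> ('s, 'x) module" where
  "restrict_scalars \<phi> M =
    \<lparr>carrier = carrier M, mult = mult M, one = one M, zero = zero M, add = add M,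
     smult = (\<lambda>s. smult M (\<phi> s))\<rparr>"


section \<open>Representations\<close>

type_synonym 'a rep = "'a \<Rightarrow> complex mat"

definition mat_space :: "('v, 'a) pre_digraph \<Rightarrow> ('v \<Rightarrow> nat) \<Rightarrow> 'a rep set" where
  "mat_space G d = (\<Pi>\<^sub>E a\<in>arcs G. carrier_mat (d (head G a)) (d (tail G a)))"

fun path_mat :: "('v, 'a) pre_digraph \<Rightarrow> ('v \<Rightarrow> nat) \<Rightarrow> 'a rep \<Rightarrow> 'v \<Rightarrow> 'a list \<Rightarrow> complex mat" where
  "path_mat G d M u [] = 1\<^sub>m (d u)"
| "path_mat G d M u (a # w) = path_mat G d M (head G a) w * M a"

definition nilpotent_rep :: "('v, 'a) pre_digraph \<Rightarrow> ('v \<Rightarrow> nat) \<Rightarrow> 'a rep \<Rightarrow> bool" where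
  "nilpotent_rep G d M \<longleftrightarrow>
    (\<exists>N. \<forall>(u, w)\<in>qpaths G. length w \<ge> N \<longrightarrow> path_mat G d M u w = 0\<^sub>m (d (path_end G u w)) (d u))"

definition rep_carrier :: "('v, 'a) pre_digraph \<Rightarrow> ('v \<Rightarrow> nat) \<Rightarrow> ('v \<Rightarrow> complex vec) set" where
  "rep_carrier G d = (\<Pi>\<^sub>E i\<in>verts G. carrier_vec (d i))"

text \<open>
  The action of an element of the complete path algebra. For a nilpotent representation of a
  finite quiver only finitely many paths act by a nonzero matrix, so the sum is finite.
\<close>

definition rep_act :: "('v, 'a) pre_digraph \<Rightarrow> ('v \<Rightarrow> nat) \<Rightarrow> 'a rep
    \<Rightarrow> ('v \<times> 'a list \<Rightarrow> complex) \<Rightarrow> ('v \<Rightarrow> complex vec) \<Rightarrow> ('v \<Rightarrow> complex vec)" where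
  "rep_act G d M f x =
    (\<lambda>j\<in>verts G. vec (d j) (\<lambda>r.
      \<Sum>(u, w) \<in> {(u, w). pre_digraph.awalk G u w j \<and> path_mat G d M u w \<noteq> 0\<^sub>m (d j) (d u)}.
        f (u, w) * (path_mat G d M u w *\<^sub>v x u) $ r))"

definition Rep :: "('v, 'a) pre_digraph \<Rightarrow> ('v \<times> 'a list \<Rightarrow> complex) set \<Rightarrow> ('v \<Rightarrow> nat) \<Rightarrow> 'a rep set" where
  "Rep G J d =
    {M \<in> mat_space G d. nilpotent_rep G d M \<and>
      (\<forall>f\<in>J. \<forall>x\<in>rep_carrier G d. rep_act G d M f x = (\<lambda>i\<in>verts G. 0\<^sub>v (d i)))}"

text \<open>
  The module over a quotient \<open>cpa G Quot J\<close> given by a nilpotent representation annihilated by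
  \<open>J\<close>: a coset acts as any of its elements.
\<close>

definition rep_module :: "('v, 'a) pre_digraph \<Rightarrow> ('v \<Rightarrow> nat) \<Rightarrow> 'a rep
    \<Rightarrow> (('v \<times> 'a list \<Rightarrow> complex) set, 'v \<Rightarrow> complex vec) module" where
  "rep_module G d M =
    \<lparr>carrier = rep_carrier G d,
     mult = undefined, one = undefined,
     zero = (\<lambda>i\<in>verts G. 0\<^sub>v (d i)),
     add = (\<lambda>x y. \<lambda>i\<in>verts G. x i + y i),
     smult = (\<lambda>X x. the_elem ((\<lambda>f. rep_act G d M f x) ` X))\<rparr>"

definition simple_module :: "('v, 'a) pre_digraph \<Rightarrow> 'v
    \<Rightarrow> (('v \<times> 'a list \<Rightarrow> complex) set, 'v \<Rightarrow> complex vec) module" where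
  "simple_module G i =
    (let d = (\<lambda>j. if j = i then 1 else 0)
     in rep_module G d (\<lambda>a\<in>arcs G. 0\<^sub>m (d (head G a)) (d (tail G a))))"


section \<open>Decorated representations and the extended g-vector\<close>

type_synonym ('v, 'a) drep = "'a rep \<times> ('v \<Rightarrow> nat)"

definition decRep :: "('v, 'a) pre_digraph \<Rightarrow> ('v \<times> 'a list \<Rightarrow> complex) set \<Rightarrow> ('v \<Rightarrow> nat)
    \<Rightarrow> ('v \<Rightarrow> nat) \<Rightarrow> ('v, 'a) drep set" where
  "decRep G J d v = Rep G J d \<times> {v}"

inductive_set poly_funs :: "('v, 'a) pre_digraph \<Rightarrow> ('v \<Rightarrow> nat) \<Rightarrow> ('a rep \<Rightarrow> complex) set"
  for G d where
  const: "(\<lambda>_. c) \<in> poly_funs G d"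
| coord: "\<lbrakk>a \<in> arcs G; i < d (head G a); j < d (tail G a)\<rbrakk> \<Longrightarrow> (\<lambda>M. M a $$ (i, j)) \<in> poly_funs G d"
| add: "\<lbrakk>p \<in> poly_funs G d; q \<in> poly_funs G d\<rbrakk> \<Longrightarrow> (\<lambda>M. p M + q M) \<in> poly_funs G d"
| mult: "\<lbrakk>p \<in> poly_funs G d; q \<in> poly_funs G d\<rbrakk> \<Longrightarrow> (\<lambda>M. p M * q M) \<in> poly_funs G d"

definition zariski :: "('v, 'a) pre_digraph \<Rightarrow> ('v \<Rightarrow> nat) \<Rightarrow> 'a rep topology" where
  "zariski G d =
    topology (\<lambda>U. U \<subseteq> mat_space G d \<and>
      (\<exists>P\<subseteq>poly_funs G d. mat_space G d - U = {M \<in> mat_space G d. \<forall>p\<in>P. p M = 0}))"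

lemma openin_zariski:
  "openin (zariski G d) U \<longleftrightarrow> U \<subseteq> mat_space G d \<and>
    (\<exists>P\<subseteq>poly_funs G d. mat_space G d - U = {M \<in> mat_space G d. \<forall>p\<in>P. p M = 0})"
proof -
  have "istopology (\<lambda>U. U \<subseteq> mat_space G d \<and>
    (\<exists>P\<subseteq>poly_funs G d. mat_space G d - U = {M \<in> mat_space G d. \<forall>p\<in>P. p M = 0}))"
    unfolding istopology_def
  proof (intro conjI allI impI)
    fix S T
    assume "S \<subseteq> mat_space G d \<and>
        (\<exists>P\<subseteq>poly_funs G d. mat_space G d - S = {M \<in> mat_space G d. \<forall>p\<in>P. p M = 0})"
      and "T \<subseteq> mat_space G d \<and>
        (\<exists>P\<subseteq>poly_funs G d. mat_space G d - T = {M \<in> mat_space G d. \<forall>p\<in>P. p M = 0})"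
    then obtain P1 P2 where P:
      "S \<subseteq> mat_space G d" "T \<subseteq> mat_space G d" "P1 \<subseteq> poly_funs G d" "P2 \<subseteq> poly_funs G d"
      "mat_space G d - S = {M \<in> mat_space G d. \<forall>p\<in>P1. p M = 0}"
      "mat_space G d - T = {M \<in> mat_space G d. \<forall>p\<in>P2. p M = 0}"
      by blast
    let ?P = "{\<lambda>M. p M * q M | p q. p \<in> P1 \<and> q \<in> P2}"
    have "?P \<subseteq> poly_funs G d" using P(3,4) by (auto intro!: poly_funs.mult)
    moreover have "mat_space G d - S \<inter> T = (mat_space G d - S) \<union> (mat_space G d - T)" by blast
    then have "mat_space G d - S \<inter> T = {M \<in> mat_space G d. \<forall>p\<in>?P. p M = 0}"
      unfolding P(5,6) by (auto; metis mult_eq_0_iff)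
    ultimately show "\<exists>P\<subseteq>poly_funs G d. mat_space G d - S \<inter> T = {M \<in> mat_space G d. \<forall>p\<in>P. p M = 0}"
      by blast
    show "S \<inter> T \<subseteq> mat_space G d" using P(1) by blast
  next
    fix K
    assume K: "\<forall>S\<in>K. S \<subseteq> mat_space G d \<and>
        (\<exists>P\<subseteq>poly_funs G d. mat_space G d - S = {M \<in> mat_space G d. \<forall>p\<in>P. p M = 0})"
    let ?P = "{p \<in> poly_funs G d. \<exists>S\<in>K. \<forall>M\<in>mat_space G d - S. p M = 0}"
    have "mat_space G d - \<Union>K = {M \<in> mat_space G d. \<forall>p\<in>?P. p M = 0}"
    proof (intro equalityI subsetI)
      fix M assume M: "M \<in> {M \<in> mat_space G d. \<forall>p\<in>?P. p M = 0}"
      have False if S: "S \<in> K" and "M \<in> S" for S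
      proof -
        obtain P where P: "P \<subseteq> poly_funs G d"
          "mat_space G d - S = {M \<in> mat_space G d. \<forall>p\<in>P. p M = 0}"
          using K S by meson
        have "M \<notin> mat_space G d - S" using \<open>M \<in> S\<close> by blast
        then obtain p where p: "p \<in> P" "p M \<noteq> 0" using M unfolding P(2) by blast
        have "\<forall>M\<in>mat_space G d - S. p M = 0" using p(1) unfolding P(2) by blast
        then have "p \<in> ?P" using P(1) p(1) S by blast
        then show False using M p(2) by blast
      qed
      then show "M \<in> mat_space G d - \<Union>K" using M by blast
    qed blast
    then show "\<exists>P\<subseteq>poly_funs G d. mat_space G d - \<Union>K = {M \<in> mat_space G d. \<forall>p\<in>P. p M = 0}"
      by (intro exI[of _ ?P]) blast
    show "\<Union>K \<subseteq> mat_space G d" using K by blast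
  qed
  then show ?thesis by (simp add: zariski_def topology_inverse')
qed

lemma topspace_zariski: "topspace (zariski G d) = mat_space G d"
proof -
  have "openin (zariski G d) (mat_space G d)"
    unfolding openin_zariski by (auto intro!: exI[of _ "{\<lambda>_. 1}"] poly_funs.const)
  then show ?thesis
    using openin_topspace[of "zariski G d"] openin_subset[of "zariski G d" "mat_space G d"]
    unfolding openin_zariski by blast
qed

definition decRep_topology :: "('v, 'a) pre_digraph \<Rightarrow> ('v \<times> 'a list \<Rightarrow> complex) set \<Rightarrow> ('v \<Rightarrow> nat)
    \<Rightarrow> ('v \<Rightarrow> nat) \<Rightarrow> ('v, 'a) drep topology" where
  "decRep_topology G J d v = pullback_topology (decRep G J d v) fst (subtopology (zariski G d) (Rep G J d))"

definition upper_semicontinuous :: "'x topology \<Rightarrow> ('x \<Rightarrow> 'b::linorder) \<Rightarrow> bool" where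
  "upper_semicontinuous X f \<longleftrightarrow> (\<forall>c. openin X {x \<in> topspace X. f x < c})"

text \<open>
  \<open>(M, v)\<close> is a decorated representation with dimension vector \<open>d\<close> of
  \<open>\<Lambda> = cpa Q Quot (cpa_proj Q ` J)\<close>. A coset of \<open>J\<close> is mapped by \<open>cpa_proj Q\<close> onto a coset
  of the image of \<open>J\<close>; this is the homomorphism from \<open>cpa G Quot J\<close> to \<open>\<Lambda>\<close> along which \<open>M\<close>
  becomes a module over \<open>cpa G Quot J\<close>.
\<close>

definition ext_g_vector :: "('v, 'a) pre_digraph \<Rightarrow> ('v, 'a) pre_digraph
    \<Rightarrow> ('v \<times> 'a list \<Rightarrow> complex) set \<Rightarrow> ('v \<Rightarrow> nat) \<Rightarrow> ('v, 'a) drep \<Rightarrow> 'v \<Rightarrow> int" where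
  "ext_g_vector G Q J d \<M> i =
    (let R = cpa G Quot J;
         \<iota> = (\<lambda>c. J +>\<^bsub>cpa G\<^esub> cpa_scalar G c);
         S = simple_module G i;
         M = restrict_scalars ((`) (cpa_proj Q)) (rep_module Q d (fst \<M>))
     in - int (hom_dim R \<iota> S M) + int (ext1_dim R \<iota> S M) + int (snd \<M> i))"

end

theory Submission
  imports Defs
begin

text \<open>
  Let \<open>R\<close> be \<open>cpa G Quot J\<close>, let \<open>S\<close> be the simple module at \<open>k\<close>, and let \<open>I\<close> be the left ideal
  of those \<open>r\<close> in \<open>R\<close> that kill a generator \<open>s\<close> of \<open>S\<close>. Since \<open>0 \<rightarrow> I \<rightarrow> R \<rightarrow> S \<rightarrow> 0\<close> is exact, the
  map \<open>M \<rightarrow> Hom(I, M)\<close>, \<open>y \<mapsto> (r \<mapsto> r y)\<close>, has kernel \<open>Hom(S, M)\<close> and cokernel \<open>Ext\<^sup>1(S, M)\<close>. Counting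
  dimensions (\<open>ext1_dim_cyclic\<close>),
  \<open>- dim Hom(S, M) + dim Ext\<^sup>1(S, M) = dim Hom(I, M) - dim M\<close>,
  and \<open>dim M\<close> depends only on the dimension vector. So up to a constant the \<open>k\<close>-th entry of the
  g-vector is \<open>dim Hom(I, M)\<close> (\<open>ext_g_vector_eq\<close>).

  This number is the dimension of the solution space of a linear system whose coefficients are
  polynomials in the entries of \<open>M\<close>. Indeed \<open>I\<close> is generated by the classes of the arrows starting
  at \<open>k\<close> and of the trivial paths at the other vertices, and an element of the complete path algebra
  without constant term at \<open>k\<close> is a left combination of these paths with coefficients that depend
  linearly on it (\<open>path_quotient_decomposition\<close>). Hence a homomorphism \<open>I \<rightarrow> M\<close> is a tuple of values at the
  generators, subject to the relation that each element of \<open>J\<close> imposes (\<open>hom_coord_solves\<close>,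
  \<open>solution_hom\<close>). The action of a formal power series on \<open>M\<close> is polynomial in \<open>M\<close> because all
  nilpotent representations with a given dimension vector are killed by the paths of length at
  least \<open>dim M\<close> (\<open>nilpotent_rep_uniform\<close>), so that one truncation serves for all of them.

  Finally, the solution space of a linear system with polynomial coefficients can only shrink when
  one moves from a point \<open>M0\<close> to a nearby point. Gaussian elimination at \<open>M0\<close>, carried out without
  dividing, gives a polynomial that does not vanish at \<open>M0\<close> and a set of free variables at \<open>M0\<close>
  that determines the solutions wherever the polynomial does not vanish (\<open>generic_elimination\<close>).
\<close>

section \<open>Linear algebra\<close>

lemma (in module) lin_indpt_empty: "lin_indpt {}"
  by (auto simp: lin_dep_def)

lemma injective_linear_imp_fin_dim:
  assumes "linear_map K V W T" and "inj_on T (carrier V)" and "vectorspace.fin_dim K W"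
  shows "vectorspace.fin_dim K V" and "vectorspace.dim K V \<le> vectorspace.dim K W"
proof -
  interpret linear_map K V W T by fact
  have bound: "finite A \<and> card A \<le> W.dim" if A: "A \<subseteq> carrier V \<and> V.module.lin_indpt A" for A
  proof -
    have le: "card B \<le> W.dim" if B: "finite B" "B \<subseteq> A" for B
    proof -
      have BV: "B \<subseteq> carrier V" using A B by blast
      have li: "V.module.lin_indpt B" using V.module.subset_li_is_li A B by blast
      have injB: "inj_on T B" using assms(2) BV inj_on_subset by blast
      have TB: "T ` B \<subseteq> carrier W" using BV by auto
      have "W.module.lin_indpt (T ` B)"
      proof (rule W.module.finite_lin_indpt2)
        show "finite (T ` B)" "T ` B \<subseteq> carrier W" using B TB by simp_all
        fix a assume a: "a \<in> T ` B \<rightarrow> carrier K"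
          and 0: "W.module.lincomb a (T ` B) = \<zero>\<^bsub>W\<^esub>"
        have T0: "T (V.module.lincomb (a \<circ> T) B) = \<zero>\<^bsub>W\<^esub>"
          using lincomb_linear_image[OF assms(2) BV a B(1)] 0 by simp
        have aT: "a \<circ> T \<in> B \<rightarrow> carrier K" using a by auto
        have "V.module.lincomb (a \<circ> T) B = \<zero>\<^bsub>V\<^esub>"
        proof (rule inj_onD[OF assms(2)])
          show "T (V.module.lincomb (a \<circ> T) B) = T \<zero>\<^bsub>V\<^esub>" unfolding T0 f0_is_0 ..
        qed (rule V.module.lincomb_closed[OF BV aT] V.module.M.zero_closed)+
        then have "a \<circ> T \<in> B \<rightarrow> {\<zero>\<^bsub>K\<^esub>}"
          by (rule V.not_lindepD[OF li B(1) subset_refl aT])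
        then show "\<forall>v\<in>T ` B. a v = \<zero>\<^bsub>K\<^esub>" by auto
      qed
      from W.li_le_dim(2)[OF assms(3) TB this] have "card (T ` B) \<le> W.dim" .
      then show ?thesis using card_image[OF injB] by simp
    qed
    have "finite A"
    proof (rule ccontr)
      assume "infinite A"
      then obtain B where "B \<subseteq> A" "finite B" "card B = Suc W.dim"
        by (metis infinite_arbitrarily_large)
      then show False using le[of B] by simp
    qed
    then show ?thesis using le[of A] by simp
  qed
  define li where "li = (\<lambda>S. S \<subseteq> carrier V \<and> V.module.lin_indpt S)"
  have "li {}" unfolding li_def using V.module.lin_indpt_empty by (intro conjI empty_subsetI)
  moreover have "finite A \<and> card A \<le> W.dim" if "li A" for A
    using that unfolding li_def by (rule bound)
  ultimately obtain A where fin: "finite A" and "maximal A li"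
    using maximal_exists[where P = li and B = "{}" and N = W.dim] by (elim meta_impE exE conjE)
  then have bas: "V.basis A" unfolding li_def by (intro V.max_li_is_basis)
  then have A: "V.module.gen_set A" "A \<subseteq> carrier V" "V.module.lin_indpt A"
    unfolding V.basis_def by simp_all
  show "V.fin_dim" unfolding V.fin_dim_def using fin A(1,2) by (intro exI conjI)
  have "V.dim = card A" by (rule V.dim_basis[OF fin bas])
  then show "V.dim \<le> W.dim" using bound[OF conjI[OF A(2,3)]] by (elim conjE) (rule ord_eq_le_trans)
qed

text \<open>
  Picking one new vector at each step of the chain gives a linearly independent set, because the
  vectors picked so far span a subspace of the current member of the chain.
\<close>

lemma (in vectorspace) strict_chain_length_le_dim:
  assumes fd: "fin_dim"
    and U: "\<And>j. subspace K (U j) V" and mono: "\<And>j. U j \<subseteq> U (Suc j)"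
    and strict: "\<And>j. j < r \<Longrightarrow> U j \<noteq> U (Suc j)"
  shows "r \<le> dim"
proof -
  have Usub: "U j \<subseteq> carrier V" for j
    using U[of j] unfolding subspace_def submodule_def by blast
  have "\<exists>A. finite A \<and> card A = s \<and> A \<subseteq> U s \<and> lin_indpt A" if "s \<le> r" for s
    using that
  proof (induction s)
    case 0
    show ?case by (rule exI[of _ "{}"]) (auto simp: lin_dep_def)
  next
    case (Suc s)
    then obtain A where A: "finite A" "card A = s" "A \<subseteq> U s" "lin_indpt A" by auto
    obtain x where x: "x \<in> U (Suc s)" "x \<notin> U s" using mono[of s] strict[of s] Suc.prems by auto
    have AV: "A \<subseteq> carrier V" using A Usub by blast
    have "span A \<subseteq> U s"
      using span_is_subset[OF A(3)] U unfolding subspace_def by blast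
    then have "x \<notin> span A" using x by blast
    moreover have "x \<notin> A" using x A by blast
    ultimately have "lin_indpt (A \<union> {x})"
      using lin_dep_iff_in_span[OF AV A(4)] x Usub by blast
    then show ?case
      using A x mono[of s] \<open>x \<notin> A\<close> by (intro exI[of _ "A \<union> {x}"]) auto
  qed
  from this[of r] obtain A where "card A = r" "A \<subseteq> carrier V" "lin_indpt A"
    using Usub by blast
  then show ?thesis using li_le_dim(2)[OF fd] by blast
qed

text \<open>
  The functionals \<open>\<phi> i\<close> for \<open>i \<in> Z\<close> are the coordinates of a linear map to \<open>\<complex>\<^sup>Z\<close>. It serves to
  compute dimensions of spaces that are not given with a basis.
\<close>

lemma vectorspace_complex_functionals:
  fixes V :: "(complex, 'x) module" and \<phi> :: "'i \<Rightarrow> 'x \<Rightarrow> complex"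
  assumes V: "vectorspace class_ring V" and Z: "finite Z"
    and add: "\<And>i x y. i \<in> Z \<Longrightarrow> x \<in> carrier V \<Longrightarrow> y \<in> carrier V \<Longrightarrow> \<phi> i (x \<oplus>\<^bsub>V\<^esub> y) = \<phi> i x + \<phi> i y"
    and smult: "\<And>i c x. i \<in> Z \<Longrightarrow> x \<in> carrier V \<Longrightarrow> \<phi> i (c \<odot>\<^bsub>V\<^esub> x) = c * \<phi> i x"
    and inj: "\<And>x. x \<in> carrier V \<Longrightarrow> (\<And>i. i \<in> Z \<Longrightarrow> \<phi> i x = 0) \<Longrightarrow> x = \<zero>\<^bsub>V\<^esub>"
  shows "vectorspace.fin_dim class_ring V" and "vectorspace.dim class_ring V \<le> card Z"
    and "(\<And>z. \<exists>x\<in>carrier V. \<forall>i\<in>Z. \<phi> i x = z i) \<Longrightarrow> vectorspace.dim class_ring V = card Z"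
proof -
  obtain b where b: "bij_betw b {..<card Z} Z"
    using ex_bij_betw_nat_finite[OF Z] by (auto simp: atLeast0LessThan)
  let ?n = "card Z"
  interpret V: vectorspace class_ring V by fact
  interpret W: vec_space "TYPE(complex)" ?n .
  define T where "T x = vec ?n (\<lambda>i. \<phi> (b i) x)" for x
  have bZ: "b i \<in> Z" if "i < ?n" for i using b that by (auto simp: bij_betw_def)
  have "mod_hom class_ring V (module_vec TYPE(complex) ?n) T"
  proof (intro mod_hom.intro mod_hom_axioms.intro)
    show "module class_ring V" "module class_ring (module_vec TYPE(complex) ?n)" by unfold_locales
    show "T \<in> module_hom class_ring V (module_vec TYPE(complex) ?n)"
      unfolding module_hom_def
      by (auto simp: T_def module_vec_simps add smult bZ intro!: eq_vecI)
  qed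
  then interpret T: linear_map class_ring V "module_vec TYPE(complex) ?n" T
    by (intro linear_map.intro) (auto intro: assms W.vectorspace_axioms)
  have zero: "x = \<zero>\<^bsub>V\<^esub>" if "x \<in> carrier V" "T x = 0\<^sub>v ?n" for x
  proof (rule inj[OF that(1)])
    fix i assume "i \<in> Z"
    then obtain j where j: "j < ?n" "i = b j" using b by (auto simp: bij_betw_def)
    have "T x $ j = 0" using that(2) j by simp
    then show "\<phi> i x = 0" using j by (simp add: T_def)
  qed
  have inj: "inj_on T (carrier V)"
    by (rule T.Ke0_imp_inj) (use zero in \<open>auto simp: T.ker_def module_vec_simps\<close>)
  show fd: "V.fin_dim" using injective_linear_imp_fin_dim(1)[OF T.linear_map_axioms inj] by simp
  show "V.dim \<le> ?n"
    using injective_linear_imp_fin_dim(2)[OF T.linear_map_axioms inj] W.dim_is_n by simp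
  assume surj: "\<And>z. \<exists>x\<in>carrier V. \<forall>i\<in>Z. \<phi> i x = z i"
  have "T ` carrier V = carrier (module_vec TYPE(complex) ?n)"
  proof
    show "carrier (module_vec TYPE(complex) ?n) \<subseteq> T ` carrier V"
    proof
      fix y :: "complex vec" assume "y \<in> carrier (module_vec TYPE(complex) ?n)"
      then have y: "dim_vec y = ?n" by (auto simp: module_vec_simps)
      obtain x where x: "x \<in> carrier V" "\<And>i. i \<in> Z \<Longrightarrow> \<phi> i x = y $ (the_inv_into {..<?n} b i)"
        using surj[of "\<lambda>i. y $ (the_inv_into {..<?n} b i)"] by blast
      have "T x = y"
        using b by (intro eq_vecI) (auto simp: T_def y x bZ bij_betw_def the_inv_into_f_f)
      then show "y \<in> T ` carrier V" using x by blast
    qed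
  qed (auto simp: T_def module_vec_simps)
  from T.dim_eq[OF fd inj this] show "V.dim = ?n" using W.dim_is_n by simp
qed

text \<open>
  A linear system in the unknowns \<open>x i\<close>, whose coefficients are functions of a parameter \<open>M\<close>
  from an algebra \<open>P\<close>. The unknowns in \<open>Z\<close> can be chosen freely at \<open>M0\<close>, and they determine a solution
  wherever \<open>p\<close> does not vanish. Induct on the set of unknowns. If some row has a coefficient of the
  new unknown \<open>i\<close> that is nonzero at \<open>M0\<close>, use it as a pivot to eliminate \<open>i\<close> from all rows by
  cross-multiplication, which stays inside \<open>P\<close>, and multiply \<open>p\<close> by the pivot. Otherwise \<open>i\<close> is free at
  \<open>M0\<close> and joins \<open>Z\<close>.
\<close>

lemma generic_elimination:
  fixes P :: "('m \<Rightarrow> 'f::field) set" and Rows :: "('m \<Rightarrow> 'i \<Rightarrow> 'f) set"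
  assumes "finite I"
    and const: "\<And>c. (\<lambda>_. c) \<in> P"
    and add: "\<And>p q. p \<in> P \<Longrightarrow> q \<in> P \<Longrightarrow> (\<lambda>M. p M + q M) \<in> P"
    and mult: "\<And>p q. p \<in> P \<Longrightarrow> q \<in> P \<Longrightarrow> (\<lambda>M. p M * q M) \<in> P"
    and "\<forall>\<rho>\<in>Rows. \<forall>i\<in>I. (\<lambda>M. \<rho> M i) \<in> P"
  shows "\<exists>Z p. Z \<subseteq> I \<and> p \<in> P \<and> p M0 \<noteq> 0 \<and>
    (\<forall>z. \<exists>x. (\<forall>i\<in>Z. x i = z i) \<and> (\<forall>\<rho>\<in>Rows. (\<Sum>i\<in>I. \<rho> M0 i * x i) = 0)) \<and>
    (\<forall>M. p M \<noteq> 0 \<longrightarrow>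
      (\<forall>x. (\<forall>i\<in>Z. x i = 0) \<and> (\<forall>\<rho>\<in>Rows. (\<Sum>i\<in>I. \<rho> M i * x i) = 0) \<longrightarrow> (\<forall>i\<in>I. x i = 0)))"
  using assms(1,5)
proof (induction I arbitrary: Rows rule: finite_induct)
  case empty
  show ?case using const[of 1] by (intro exI[of _ "{}"] exI[of _ "\<lambda>_. 1"]) auto
next
  case (insert i I)
  have sum_upd: "(\<Sum>j\<in>I. \<rho> j * (x(i := c)) j) = (\<Sum>j\<in>I. \<rho> j * x j)" for \<rho> x and c :: 'f
    using insert.hyps by (intro sum.cong) auto
  show ?case
  proof (cases "\<exists>\<rho>0\<in>Rows. \<rho>0 M0 i \<noteq> 0")
    case True
    then obtain \<rho>0 where \<rho>0: "\<rho>0 \<in> Rows" "\<rho>0 M0 i \<noteq> 0" by blast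
    \<comment> \<open>The row \<open>\<rho>\<close> with the unknown \<open>i\<close> eliminated by means of \<open>\<rho>0\<close>, denominators cleared.\<close>
    let ?e = "\<lambda>\<rho> M j. \<rho>0 M i * \<rho> M j + (- 1) * (\<rho> M i * \<rho>0 M j)"
    have "(\<lambda>M. ?e \<rho> M j) \<in> P" if "\<rho> \<in> Rows" "j \<in> I" for \<rho> j
      by (intro add mult const) (use that \<rho>0 insert.prems in auto)
    then have "\<forall>\<rho>\<in>?e ` Rows. \<forall>j\<in>I. (\<lambda>M. \<rho> M j) \<in> P" by blast
    from insert.IH[of "?e ` Rows", OF this] obtain Z p where Z: "Z \<subseteq> I" and p: "p \<in> P" "p M0 \<noteq> 0"
      and ex: "\<forall>z. \<exists>x. (\<forall>i\<in>Z. x i = z i) \<and> (\<forall>\<rho>\<in>?e ` Rows. (\<Sum>i\<in>I. \<rho> M0 i * x i) = 0)"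
      and un': "\<forall>M. p M \<noteq> 0 \<longrightarrow> (\<forall>x. (\<forall>i\<in>Z. x i = 0) \<and>
        (\<forall>\<rho>\<in>?e ` Rows. (\<Sum>i\<in>I. \<rho> M i * x i) = 0) \<longrightarrow> (\<forall>i\<in>I. x i = 0))"
      by (elim exE conjE) (rule that)
    note un = un'[THEN spec, THEN mp, THEN spec, THEN mp, OF _ conjI]
    have esum: "(\<Sum>j\<in>I. ?e \<rho> M j * x j) =
        \<rho>0 M i * (\<Sum>j\<in>I. \<rho> M j * x j) - \<rho> M i * (\<Sum>j\<in>I. \<rho>0 M j * x j)" for \<rho> M x
      by (simp add: sum_distrib_left sum_subtractf algebra_simps)
    show ?thesis
    proof (intro exI[of _ Z] exI[of _ "\<lambda>M. p M * \<rho>0 M i"] conjI allI impI)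
      show "Z \<subseteq> insert i I" using Z by blast
      show "(\<lambda>M. p M * \<rho>0 M i) \<in> P" using p \<rho>0 insert.prems by (intro mult) auto
      show "p M0 * \<rho>0 M0 i \<noteq> 0" using p \<rho>0 by simp
      fix z
      obtain x where x: "\<forall>i\<in>Z. x i = z i" "\<And>\<rho>. \<rho> \<in> Rows \<Longrightarrow> (\<Sum>j\<in>I. ?e \<rho> M0 j * x j) = 0"
        using ex[THEN spec, of z] by auto
      \<comment> \<open>Solve the pivot row for the unknown \<open>i\<close>.\<close>
      let ?y = "x(i := - (\<Sum>j\<in>I. \<rho>0 M0 j * x j) / \<rho>0 M0 i)"
      have "(\<Sum>j\<in>insert i I. \<rho> M0 j * ?y j) = 0" if "\<rho> \<in> Rows" for \<rho>
        unfolding sum.insert[OF insert.hyps(1,2)] sum_upd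
        using x(2)[OF that] \<rho>0(2) unfolding esum by (simp add: field_simps)
      moreover have "\<forall>j\<in>Z. ?y j = z j" using x Z insert.hyps by auto
      ultimately show "\<exists>x. (\<forall>i\<in>Z. x i = z i) \<and> (\<forall>\<rho>\<in>Rows. (\<Sum>i\<in>insert i I. \<rho> M0 i * x i) = 0)"
        by blast
    next
      fix M x assume pM: "p M * \<rho>0 M i \<noteq> 0"
        and x: "(\<forall>i\<in>Z. x i = 0) \<and> (\<forall>\<rho>\<in>Rows. (\<Sum>i\<in>insert i I. \<rho> M i * x i) = 0)"
      have row: "\<rho> M i * x i + (\<Sum>j\<in>I. \<rho> M j * x j) = 0" if "\<rho> \<in> Rows" for \<rho>
        using x that insert.hyps by auto
      have "\<forall>\<rho>\<in>?e ` Rows. (\<Sum>j\<in>I. \<rho> M j * x j) = 0"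
      proof clarify
        fix \<rho> assume "\<rho> \<in> Rows"
        then have "(\<Sum>j\<in>I. \<rho> M j * x j) = - (\<rho> M i * x i)"
          "(\<Sum>j\<in>I. \<rho>0 M j * x j) = - (\<rho>0 M i * x i)"
          using row[of \<rho>] row[OF \<rho>0(1)] by (simp_all add: eq_neg_iff_add_eq_0 add.commute)
        then show "(\<Sum>j\<in>I. ?e \<rho> M j * x j) = 0" unfolding esum by (simp add: algebra_simps)
      qed
      then have 0: "\<forall>j\<in>I. x j = 0" using un[of M x] pM x by simp
      then have "\<rho>0 M i * x i = 0" using row[OF \<rho>0(1)] by simp
      then show "\<forall>j\<in>insert i I. x j = 0" using 0 pM by simp
    qed
  next
    case False
    have "\<forall>\<rho>\<in>Rows. \<forall>j\<in>I. (\<lambda>M. \<rho> M j) \<in> P" using insert.prems by blast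
    from insert.IH[of Rows, OF this] obtain Z p where Z: "Z \<subseteq> I" and p: "p \<in> P" "p M0 \<noteq> 0"
      and ex: "\<forall>z. \<exists>x. (\<forall>i\<in>Z. x i = z i) \<and> (\<forall>\<rho>\<in>Rows. (\<Sum>i\<in>I. \<rho> M0 i * x i) = 0)"
      and un': "\<forall>M. p M \<noteq> 0 \<longrightarrow> (\<forall>x. (\<forall>i\<in>Z. x i = 0) \<and>
        (\<forall>\<rho>\<in>Rows. (\<Sum>i\<in>I. \<rho> M i * x i) = 0) \<longrightarrow> (\<forall>i\<in>I. x i = 0))"
      by (elim exE conjE) (rule that)
    note un = un'[THEN spec, THEN mp, THEN spec, THEN mp, OF _ conjI]
    show ?thesis
    proof (intro exI[of _ "insert i Z"] exI[of _ p] conjI allI impI p)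
      show "insert i Z \<subseteq> insert i I" using Z by blast
      fix z
      obtain x where x: "\<forall>i\<in>Z. x i = z i" "\<And>\<rho>. \<rho> \<in> Rows \<Longrightarrow> (\<Sum>j\<in>I. \<rho> M0 j * x j) = 0"
        using ex[THEN spec, of z] by auto
      have "(\<Sum>j\<in>insert i I. \<rho> M0 j * (x(i := z i)) j) = 0" if "\<rho> \<in> Rows" for \<rho>
        unfolding sum.insert[OF insert.hyps(1,2)] sum_upd
        using x(2)[OF that] False that by simp
      moreover have "\<forall>j\<in>insert i Z. (x(i := z i)) j = z j" using x(1) by auto
      ultimately show "\<exists>x. (\<forall>i\<in>insert i Z. x i = z i) \<and>
          (\<forall>\<rho>\<in>Rows. (\<Sum>i\<in>insert i I. \<rho> M0 i * x i) = 0)" by blast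
    next
      fix M x assume "p M \<noteq> 0"
        and x: "(\<forall>i\<in>insert i Z. x i = 0) \<and> (\<forall>\<rho>\<in>Rows. (\<Sum>i\<in>insert i I. \<rho> M i * x i) = 0)"
      moreover have "\<forall>\<rho>\<in>Rows. (\<Sum>j\<in>I. \<rho> M j * x j) = 0"
      proof
        fix \<rho> assume "\<rho> \<in> Rows"
        with x have "(\<Sum>j\<in>insert i I. \<rho> M j * x j) = 0" "x i = 0" by simp_all
        then show "(\<Sum>j\<in>I. \<rho> M j * x j) = 0" using insert.hyps by simp
      qed
      ultimately have "\<forall>j\<in>I. x j = 0" using un[of M x] by simp
      then show "\<forall>j\<in>insert i I. x j = 0" using x by simp
    qed
  qed
qed

text \<open>
  The vector space axioms pass to the image of a map that respects the operations, so quotients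
  need no separate verification.
\<close>

lemma linear_map_onto_image:
  fixes V :: "('k, 'x, 'b) module_scheme" and W :: "('k, 'y, 'd) module_scheme"
  assumes V: "vectorspace K V" and img: "carrier W = q ` carrier V"
    and zero: "\<zero>\<^bsub>W\<^esub> = q \<zero>\<^bsub>V\<^esub>"
    and add: "\<And>x y. x \<in> carrier V \<Longrightarrow> y \<in> carrier V \<Longrightarrow> q x \<oplus>\<^bsub>W\<^esub> q y = q (x \<oplus>\<^bsub>V\<^esub> y)"
    and smult: "\<And>c x. c \<in> carrier K \<Longrightarrow> x \<in> carrier V \<Longrightarrow> c \<odot>\<^bsub>W\<^esub> q x = q (c \<odot>\<^bsub>V\<^esub> x)"
  shows "linear_map K V W q"
proof -
  interpret V: vectorspace K V by fact
  have W: "vectorspace K W"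
  proof (rule vs_criteria)
    show "field K" by unfold_locales
    show "\<zero>\<^bsub>W\<^esub> \<in> carrier W" by (simp add: img zero)
    show "\<forall>v w. v \<in> carrier W \<and> w \<in> carrier W \<longrightarrow> v \<oplus>\<^bsub>W\<^esub> w \<in> carrier W"
      by (auto simp: img add)
    show "\<forall>v\<in>carrier W. \<exists>neg_v\<in>carrier W. v \<oplus>\<^bsub>W\<^esub> neg_v = \<zero>\<^bsub>W\<^esub>"
    proof
      fix v assume "v \<in> carrier W"
      then obtain x where x: "x \<in> carrier V" "v = q x" by (auto simp: img)
      then show "\<exists>neg_v\<in>carrier W. v \<oplus>\<^bsub>W\<^esub> neg_v = \<zero>\<^bsub>W\<^esub>"
        by (intro bexI[of _ "q (\<ominus>\<^bsub>V\<^esub> x)"]) (auto simp: img add zero V.module.M.r_neg)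
    qed
    show "\<forall>c v. c \<in> carrier K \<and> v \<in> carrier W \<longrightarrow> c \<odot>\<^bsub>W\<^esub> v \<in> carrier W"
      by (auto simp: img smult)
  qed (auto simp: img add zero smult V.module.M.a_ac V.smult_l_distr V.smult_r_distr V.smult_assoc1)
  show ?thesis
    by (intro linear_map.intro mod_hom.intro mod_hom_axioms.intro V W)
      (use V W in \<open>auto simp: vectorspace_def module_hom_def img add smult\<close>)
qed

section \<open>Left modules over complex algebras\<close>

text \<open>
  Left modules over a ring that need not be commutative, as path algebras are not.
\<close>

locale left_module =
  fixes R :: "('r, 'z) ring_scheme" and M :: "('r, 'x) module"
  assumes ring_R: "ring R" and group_M: "abelian_group M"
    and smult_closed: "r \<in> carrier R \<Longrightarrow> x \<in> carrier M \<Longrightarrow> r \<odot>\<^bsub>M\<^esub> x \<in> carrier M"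
    and smult_l_distr: "r \<in> carrier R \<Longrightarrow> s \<in> carrier R \<Longrightarrow> x \<in> carrier M \<Longrightarrow>
      (r \<oplus>\<^bsub>R\<^esub> s) \<odot>\<^bsub>M\<^esub> x = r \<odot>\<^bsub>M\<^esub> x \<oplus>\<^bsub>M\<^esub> s \<odot>\<^bsub>M\<^esub> x"
    and smult_r_distr: "r \<in> carrier R \<Longrightarrow> x \<in> carrier M \<Longrightarrow> y \<in> carrier M \<Longrightarrow>
      r \<odot>\<^bsub>M\<^esub> (x \<oplus>\<^bsub>M\<^esub> y) = r \<odot>\<^bsub>M\<^esub> x \<oplus>\<^bsub>M\<^esub> r \<odot>\<^bsub>M\<^esub> y"
    and smult_assoc: "r \<in> carrier R \<Longrightarrow> s \<in> carrier R \<Longrightarrow> x \<in> carrier M \<Longrightarrow>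
      (r \<otimes>\<^bsub>R\<^esub> s) \<odot>\<^bsub>M\<^esub> x = r \<odot>\<^bsub>M\<^esub> (s \<odot>\<^bsub>M\<^esub> x)"
    and smult_one: "x \<in> carrier M \<Longrightarrow> \<one>\<^bsub>R\<^esub> \<odot>\<^bsub>M\<^esub> x = x"
begin

sublocale R: ring R by (rule ring_R)
sublocale M: abelian_group M by (rule group_M)

lemma add_eq_self: "x \<in> carrier M \<Longrightarrow> x \<oplus>\<^bsub>M\<^esub> x = x \<Longrightarrow> x = \<zero>\<^bsub>M\<^esub>"
  by (metis M.add.l_cancel_one' M.zero_closed)

lemma zero_smult: "x \<in> carrier M \<Longrightarrow> \<zero>\<^bsub>R\<^esub> \<odot>\<^bsub>M\<^esub> x = \<zero>\<^bsub>M\<^esub>"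
  using smult_l_distr[of "\<zero>\<^bsub>R\<^esub>" "\<zero>\<^bsub>R\<^esub>" x]
  by (intro add_eq_self) (simp_all add: smult_closed)

lemma smult_zero: "r \<in> carrier R \<Longrightarrow> r \<odot>\<^bsub>M\<^esub> \<zero>\<^bsub>M\<^esub> = \<zero>\<^bsub>M\<^esub>"
  using smult_r_distr[of r "\<zero>\<^bsub>M\<^esub>" "\<zero>\<^bsub>M\<^esub>"]
  by (intro add_eq_self) (simp_all add: smult_closed)

end

locale complex_algebra =
  fixes R :: "('r, 'z) ring_scheme" and \<iota> :: "complex \<Rightarrow> 'r"
  assumes ring_R: "ring R" and \<iota>_closed: "\<iota> c \<in> carrier R"
    and \<iota>_add: "\<iota> (a + b) = \<iota> a \<oplus>\<^bsub>R\<^esub> \<iota> b" and \<iota>_mult: "\<iota> (a * b) = \<iota> a \<otimes>\<^bsub>R\<^esub> \<iota> b"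
    and \<iota>_one: "\<iota> 1 = \<one>\<^bsub>R\<^esub>"
    and \<iota>_central: "r \<in> carrier R \<Longrightarrow> \<iota> c \<otimes>\<^bsub>R\<^esub> r = r \<otimes>\<^bsub>R\<^esub> \<iota> c"

lemma field_class_ring: "field (class_ring :: complex ring)"
  by unfold_locales

lemma vectorspace_restrict_scalars:
  assumes "left_module R M" and "complex_algebra R \<iota>"
  shows "vectorspace class_ring (restrict_scalars \<iota> M)"
proof -
  interpret left_module R M by fact
  interpret complex_algebra R \<iota> by fact
  have neg: "\<exists>y\<in>carrier M. x \<oplus>\<^bsub>M\<^esub> y = \<zero>\<^bsub>M\<^esub>" if "x \<in> carrier M" for x
    using M.r_neg[OF that] M.a_inv_closed[OF that] by blast
  show ?thesis
    by (rule vs_criteria[OF field_class_ring])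
      (use neg in \<open>auto simp: restrict_scalars_def \<iota>_closed \<iota>_add \<iota>_mult \<iota>_one smult_closed
        smult_l_distr smult_r_distr smult_assoc smult_one M.a_ac\<close>)
qed

lemma Hom_space_simps:
  "carrier (Hom_space R \<iota> N M) = lmod_hom R N M"
  "\<zero>\<^bsub>Hom_space R \<iota> N M\<^esub> = (\<lambda>x\<in>carrier N. \<zero>\<^bsub>M\<^esub>)"
  "f \<oplus>\<^bsub>Hom_space R \<iota> N M\<^esub> g = (\<lambda>x\<in>carrier N. f x \<oplus>\<^bsub>M\<^esub> g x)"
  "c \<odot>\<^bsub>Hom_space R \<iota> N M\<^esub> f = (\<lambda>x\<in>carrier N. \<iota> c \<odot>\<^bsub>M\<^esub> f x)"
  by (simp_all add: Hom_space_def)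

lemma lmod_homI:
  assumes "h \<in> carrier N \<rightarrow>\<^sub>E carrier M"
    and "\<And>x y. x \<in> carrier N \<Longrightarrow> y \<in> carrier N \<Longrightarrow> h (x \<oplus>\<^bsub>N\<^esub> y) = h x \<oplus>\<^bsub>M\<^esub> h y"
    and "\<And>r x. r \<in> carrier R \<Longrightarrow> x \<in> carrier N \<Longrightarrow> h (r \<odot>\<^bsub>N\<^esub> x) = r \<odot>\<^bsub>M\<^esub> h x"
  shows "h \<in> lmod_hom R N M"
  using assms by (simp add: lmod_hom_def)

lemma lmod_homD:
  assumes "h \<in> lmod_hom R N M"
  shows "h \<in> extensional (carrier N)" and "x \<in> carrier N \<Longrightarrow> h x \<in> carrier M"
    and "x \<in> carrier N \<Longrightarrow> y \<in> carrier N \<Longrightarrow> h (x \<oplus>\<^bsub>N\<^esub> y) = h x \<oplus>\<^bsub>M\<^esub> h y"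
    and "r \<in> carrier R \<Longrightarrow> x \<in> carrier N \<Longrightarrow> h (r \<odot>\<^bsub>N\<^esub> x) = r \<odot>\<^bsub>M\<^esub> h x"
  using assms by (auto simp: lmod_hom_def PiE_def)

text \<open>
  All that the domain of a homomorphism must satisfy in order that \<open>Hom\<close> into a module be a vector
  space. Free modules, their submodules and left ideals enter below only as domains.
\<close>

locale operator_group =
  fixes R :: "('r, 'z) ring_scheme" and N :: "('r, 'x) module"
  assumes add_closed: "x \<in> carrier N \<Longrightarrow> y \<in> carrier N \<Longrightarrow> x \<oplus>\<^bsub>N\<^esub> y \<in> carrier N"
    and op_closed: "r \<in> carrier R \<Longrightarrow> x \<in> carrier N \<Longrightarrow> r \<odot>\<^bsub>N\<^esub> x \<in> carrier N"

lemma (in left_module) operator_group: "operator_group R M"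
  by unfold_locales (auto simp: smult_closed)

text \<open>
  Centrality of the scalars is what makes scalar multiples of homomorphisms linear over \<open>R\<close>.
\<close>

lemma vectorspace_Hom_space:
  assumes "left_module R M" and "complex_algebra R \<iota>" and "operator_group R N"
  shows "vectorspace class_ring (Hom_space R \<iota> N M)"
proof -
  interpret left_module R M by fact
  interpret complex_algebra R \<iota> by fact
  interpret N: operator_group R N by fact
  have smult_hom: "(\<lambda>x\<in>carrier N. \<iota> c \<odot>\<^bsub>M\<^esub> h x) \<in> lmod_hom R N M" if h: "h \<in> lmod_hom R N M" for c h
  proof (rule lmod_homI)
    fix r x assume rx: "r \<in> carrier R" "x \<in> carrier N"
    have "\<iota> c \<odot>\<^bsub>M\<^esub> (r \<odot>\<^bsub>M\<^esub> h x) = r \<odot>\<^bsub>M\<^esub> (\<iota> c \<odot>\<^bsub>M\<^esub> h x)"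
      using smult_assoc[of "\<iota> c" r "h x"] smult_assoc[of r "\<iota> c" "h x"] rx lmod_homD(2)[OF h]
      by (simp add: \<iota>_central \<iota>_closed)
    then show "(\<lambda>x\<in>carrier N. \<iota> c \<odot>\<^bsub>M\<^esub> h x) (r \<odot>\<^bsub>N\<^esub> x) = r \<odot>\<^bsub>M\<^esub> (\<lambda>x\<in>carrier N. \<iota> c \<odot>\<^bsub>M\<^esub> h x) x"
      using rx by (simp add: N.op_closed lmod_homD(4)[OF h])
  qed (auto simp: lmod_homD[OF h] N.add_closed \<iota>_closed smult_closed smult_r_distr)
  have zero_hom: "(\<lambda>x\<in>carrier N. \<zero>\<^bsub>M\<^esub>) \<in> lmod_hom R N M"
    by (rule lmod_homI) (auto simp: N.add_closed N.op_closed smult_zero)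
  have add_hom: "(\<lambda>x\<in>carrier N. h x \<oplus>\<^bsub>M\<^esub> h' x) \<in> lmod_hom R N M"
    if h: "h \<in> lmod_hom R N M" and h': "h' \<in> lmod_hom R N M" for h h'
    by (rule lmod_homI)
      (auto simp: lmod_homD[OF h] lmod_homD[OF h'] N.add_closed N.op_closed smult_closed
        smult_r_distr M.a_ac)
  have neg: "\<exists>h'\<in>lmod_hom R N M. (\<lambda>x\<in>carrier N. h x \<oplus>\<^bsub>M\<^esub> h' x) = (\<lambda>x\<in>carrier N. \<zero>\<^bsub>M\<^esub>)"
    if h: "h \<in> lmod_hom R N M" for h
  proof
    show "(\<lambda>x\<in>carrier N. \<iota> (-1) \<odot>\<^bsub>M\<^esub> h x) \<in> lmod_hom R N M" by (rule smult_hom[OF h])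
    have \<iota>0: "\<iota> 0 = \<zero>\<^bsub>R\<^esub>"
      using \<iota>_add[of 0 0] \<iota>_closed[of 0] by (simp add: R.add.l_cancel_one')
    have "h x \<oplus>\<^bsub>M\<^esub> \<iota> (-1) \<odot>\<^bsub>M\<^esub> h x = \<zero>\<^bsub>M\<^esub>" if "x \<in> carrier N" for x
    proof -
      have hx: "h x \<in> carrier M" by (rule lmod_homD(2)[OF h that])
      have "h x \<oplus>\<^bsub>M\<^esub> \<iota> (-1) \<odot>\<^bsub>M\<^esub> h x = (\<iota> 1 \<oplus>\<^bsub>R\<^esub> \<iota> (-1)) \<odot>\<^bsub>M\<^esub> h x"
        using smult_l_distr[OF \<iota>_closed \<iota>_closed hx, of 1 "-1"] by (simp add: \<iota>_one smult_one hx)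
      also have "\<iota> 1 \<oplus>\<^bsub>R\<^esub> \<iota> (-1) = \<zero>\<^bsub>R\<^esub>" using \<iota>_add[of 1 "-1"] \<iota>0 by simp
      finally show ?thesis by (simp add: zero_smult hx)
    qed
    then show "(\<lambda>x\<in>carrier N. h x \<oplus>\<^bsub>M\<^esub> (\<lambda>x\<in>carrier N. \<iota> (-1) \<odot>\<^bsub>M\<^esub> h x) x) = (\<lambda>x\<in>carrier N. \<zero>\<^bsub>M\<^esub>)"
      by (auto simp: restrict_def)
  qed
  show ?thesis
  proof (rule vs_criteria[OF field_class_ring], goal_cases)
    case 3
    then show ?case unfolding Hom_space_simps using neg by blast
  qed (auto simp: Hom_space_simps smult_hom zero_hom add_hom \<iota>_closed \<iota>_add \<iota>_mult \<iota>_one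
    lmod_homD M.a_ac smult_closed smult_l_distr smult_r_distr smult_assoc smult_one
    intro!: extensionalityI[where A = "carrier N"])
qed

text \<open>
  The operations of \<open>quot_space\<close> are computed on representatives, so the coset map is linear.
\<close>

lemma quot_space_linear_map:
  fixes V :: "('k, 'x) module"
  assumes V: "vectorspace K V" and B: "subspace K B V"
  shows "linear_map K V (quot_space V B) (\<lambda>x. B +>\<^bsub>V\<^esub> x)"
    and "x \<in> carrier V \<Longrightarrow> B +>\<^bsub>V\<^esub> x = \<zero>\<^bsub>quot_space V B\<^esub> \<longleftrightarrow> x \<in> B"
proof -
  interpret V: vectorspace K V by fact
  interpret B: submodule K B V using B by (simp add: subspace_def)
  have neg: "\<ominus>\<^bsub>V\<^esub> x \<in> B" if "x \<in> B" for x
  proof -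
    have "\<ominus>\<^bsub>V\<^esub> x = (\<ominus>\<^bsub>K\<^esub> \<one>\<^bsub>K\<^esub>) \<odot>\<^bsub>V\<^esub> x"
      using that B.subset V.smult_minus_1 by auto
    then show ?thesis using that by simp
  qed
  have "B \<noteq> {}" using B.zero_closed by blast
  then have "subgroup B (add_monoid V)"
    by (intro V.module.M.add.subgroupI) (use B.subset neg in \<open>auto simp: a_inv_def\<close>)
  then interpret B: abelian_subgroup B V
    by (intro abelian_subgroupI3) (auto intro: additive_subgroup.intro V.module.M.abelian_group_axioms)
  show "linear_map K V (quot_space V B) (\<lambda>x. B +>\<^bsub>V\<^esub> x)"
  proof (rule linear_map_onto_image[OF V])
    show "carrier (quot_space V B) = (\<lambda>x. B +>\<^bsub>V\<^esub> x) ` carrier V"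
      by (auto simp: quot_space_def A_RCOSETS_def')
    show "\<zero>\<^bsub>quot_space V B\<^esub> = B +>\<^bsub>V\<^esub> \<zero>\<^bsub>V\<^esub>"
      using B.subset by (simp add: quot_space_def)
    show "(B +>\<^bsub>V\<^esub> x) \<oplus>\<^bsub>quot_space V B\<^esub> (B +>\<^bsub>V\<^esub> y) = B +>\<^bsub>V\<^esub> (x \<oplus>\<^bsub>V\<^esub> y)"
      if "x \<in> carrier V" "y \<in> carrier V" for x y
      using B.a_rcos_sum that by (simp add: quot_space_def)
    fix c x assume c: "c \<in> carrier K" and x: "x \<in> carrier V"
    have "B +>\<^bsub>V\<^esub> (c \<odot>\<^bsub>V\<^esub> y) = B +>\<^bsub>V\<^esub> (c \<odot>\<^bsub>V\<^esub> x)" if y: "y \<in> B +>\<^bsub>V\<^esub> x" for y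
    proof -
      obtain b where b: "b \<in> B" "y = b \<oplus>\<^bsub>V\<^esub> x" using y by (auto simp: a_r_coset_def r_coset_def)
      have bV: "b \<in> carrier V" using b B.subset by blast
      have "c \<odot>\<^bsub>V\<^esub> y = c \<odot>\<^bsub>V\<^esub> b \<oplus>\<^bsub>V\<^esub> c \<odot>\<^bsub>V\<^esub> x" using c b bV x by (simp add: V.smult_r_distr)
      then have "c \<odot>\<^bsub>V\<^esub> y \<in> B +>\<^bsub>V\<^esub> (c \<odot>\<^bsub>V\<^esub> x)"
        using c b by (auto simp: a_r_coset_def r_coset_def)
      then show ?thesis
        using V.module.M.a_repr_independence[OF _ _ B.a_subgroup] c x by simp
    qed
    then have "\<forall>y\<in>B +>\<^bsub>V\<^esub> x. B +>\<^bsub>V\<^esub> (c \<odot>\<^bsub>V\<^esub> y) = B +>\<^bsub>V\<^esub> (c \<odot>\<^bsub>V\<^esub> x)" by (rule ballI)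
    from UN_constant_eq[OF B.a_rcos_self[OF x] this] show "c \<odot>\<^bsub>quot_space V B\<^esub> (B +>\<^bsub>V\<^esub> x) = B +>\<^bsub>V\<^esub> (c \<odot>\<^bsub>V\<^esub> x)"
      by (simp add: quot_space_def)
  qed
  show "B +>\<^bsub>V\<^esub> x = \<zero>\<^bsub>quot_space V B\<^esub> \<longleftrightarrow> x \<in> B" if "x \<in> carrier V"
  proof -
    have "B +>\<^bsub>V\<^esub> x = B \<longleftrightarrow> x \<in> B"
      by (rule iffI) (rule V.module.M.a_coset_join1[OF _ that B.a_subgroup], assumption,
        rule V.module.M.a_coset_join2[OF that B.a_subgroup])
    then show ?thesis by (simp add: quot_space_def)
  qed
qed

section \<open>The free presentation of a cyclic module\<close>

definition left_ideal_module :: "('r, 'z) ring_scheme \<Rightarrow> 'r set \<Rightarrow> ('r, 'r) module" where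
  "left_ideal_module R I =
    \<lparr>carrier = I, mult = undefined, one = undefined, zero = \<zero>\<^bsub>R\<^esub>, add = add R, smult = mult R\<rparr>"

definition annihilator :: "('r, 'z) ring_scheme \<Rightarrow> ('r, 'x) module \<Rightarrow> 'x \<Rightarrow> 'r set" where
  "annihilator R N s = {r \<in> carrier R. r \<odot>\<^bsub>N\<^esub> s = \<zero>\<^bsub>N\<^esub>}"

locale cyclic_module = N: left_module R N
  for R :: "('r, 'z) ring_scheme" and N :: "('r, 'x) module" +
  fixes s0 :: 'x
  assumes gen_closed: "s0 \<in> carrier N"
    and generates: "x \<in> carrier N \<Longrightarrow> \<exists>r\<in>carrier R. x = r \<odot>\<^bsub>N\<^esub> s0"
begin

abbreviation I where "I \<equiv> left_ideal_module R (annihilator R N s0)"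
abbreviation F where "F \<equiv> free_lmod R (carrier N)"
abbreviation K where "K \<equiv> free_syzygy R N"

lemma I_simps [simp]:
  "carrier I = {r \<in> carrier R. r \<odot>\<^bsub>N\<^esub> s0 = \<zero>\<^bsub>N\<^esub>}" "add I = add R" "smult I = mult R"
  by (simp_all add: left_ideal_module_def annihilator_def)

lemma operator_group_I: "operator_group R I"
  by unfold_locales
    (auto simp: N.smult_l_distr N.smult_assoc N.smult_zero gen_closed)

text \<open>
  A chosen way to write an element as a multiple of the generator. The value one at the generator
  itself makes \<open>lift\<close> a left inverse of \<open>single\<close>.
\<close>

definition coef :: "'x \<Rightarrow> 'r" where
  "coef x = (if x = s0 then \<one>\<^bsub>R\<^esub> else SOME r. r \<in> carrier R \<and> x = r \<odot>\<^bsub>N\<^esub> s0)"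

lemma coef:
  assumes "x \<in> carrier N"
  shows "coef x \<in> carrier R" and "coef x \<odot>\<^bsub>N\<^esub> s0 = x"
proof -
  have "\<exists>r. r \<in> carrier R \<and> x = r \<odot>\<^bsub>N\<^esub> s0" using generates[OF assms] by blast
  then have "(SOME r. r \<in> carrier R \<and> x = r \<odot>\<^bsub>N\<^esub> s0) \<in> carrier R \<and>
      x = (SOME r. r \<in> carrier R \<and> x = r \<odot>\<^bsub>N\<^esub> s0) \<odot>\<^bsub>N\<^esub> s0" by (rule someI_ex)
  then show "coef x \<in> carrier R" "coef x \<odot>\<^bsub>N\<^esub> s0 = x"
    by (auto simp: coef_def N.smult_one gen_closed)
qed

definition supp :: "('x \<Rightarrow> 'r) \<Rightarrow> 'x set" where
  "supp f = {x \<in> carrier N. f x \<noteq> \<zero>\<^bsub>R\<^esub>}"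

text \<open>
  The map \<open>F \<rightarrow> R\<close> over \<open>N\<close> from the free cover by all elements to the free cover by the generator.
\<close>

definition lift :: "('x \<Rightarrow> 'r) \<Rightarrow> 'r" where
  "lift f = (\<Oplus>\<^bsub>R\<^esub>x\<in>supp f. f x \<otimes>\<^bsub>R\<^esub> coef x)"

lemma F_simps:
  "carrier F = {f \<in> carrier N \<rightarrow>\<^sub>E carrier R. finite (supp f)}"
  "f \<oplus>\<^bsub>F\<^esub> g = (\<lambda>x\<in>carrier N. f x \<oplus>\<^bsub>R\<^esub> g x)"
  "r \<odot>\<^bsub>F\<^esub> f = (\<lambda>x\<in>carrier N. r \<otimes>\<^bsub>R\<^esub> f x)"
  by (simp_all add: free_lmod_def supp_def)

lemma F_D:
  assumes "f \<in> carrier F"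
  shows "x \<in> carrier N \<Longrightarrow> f x \<in> carrier R" and "finite (supp f)" and "f \<in> extensional (carrier N)"
  using assms by (auto simp: F_simps PiE_def)

lemma F_add:
  assumes f: "f \<in> carrier F" and g: "g \<in> carrier F"
  shows "f \<oplus>\<^bsub>F\<^esub> g \<in> carrier F" and "supp (f \<oplus>\<^bsub>F\<^esub> g) \<subseteq> supp f \<union> supp g"
proof -
  show sub: "supp (f \<oplus>\<^bsub>F\<^esub> g) \<subseteq> supp f \<union> supp g" by (auto simp: F_simps supp_def)
  have "finite (supp (f \<oplus>\<^bsub>F\<^esub> g))" using sub F_D(2)[OF f] F_D(2)[OF g] finite_subset by blast
  then show "f \<oplus>\<^bsub>F\<^esub> g \<in> carrier F" using F_D[OF f] F_D[OF g] unfolding F_simps by auto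
qed

lemma F_smult:
  assumes r: "r \<in> carrier R" and f: "f \<in> carrier F"
  shows "r \<odot>\<^bsub>F\<^esub> f \<in> carrier F" and "supp (r \<odot>\<^bsub>F\<^esub> f) \<subseteq> supp f"
proof -
  show sub: "supp (r \<odot>\<^bsub>F\<^esub> f) \<subseteq> supp f" using r by (auto simp: F_simps supp_def)
  have "finite (supp (r \<odot>\<^bsub>F\<^esub> f))" using sub F_D(2)[OF f] finite_subset by blast
  then show "r \<odot>\<^bsub>F\<^esub> f \<in> carrier F" using r F_D[OF f] unfolding F_simps by auto
qed

lemma operator_group_F: "operator_group R F"
  by unfold_locales (simp_all add: F_add F_smult)

lemma lift_eq:
  assumes f: "f \<in> carrier F" and T: "finite T" "supp f \<subseteq> T" "T \<subseteq> carrier N"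
  shows "lift f = (\<Oplus>\<^bsub>R\<^esub>x\<in>T. f x \<otimes>\<^bsub>R\<^esub> coef x)"
  unfolding lift_def
proof (rule N.R.add.finprod_mono_neutral_cong_left[OF T(1,2)])
  fix x assume "x \<in> T - supp f"
  then show "f x \<otimes>\<^bsub>R\<^esub> coef x = \<zero>\<^bsub>R\<^esub>" using T(3) coef(1) by (auto simp: supp_def)
qed (use T(3) F_D(1)[OF f] coef(1) in auto)

lemma supp_sub: "supp f \<subseteq> carrier N"
  by (auto simp: supp_def)

lemma lift_closed: "f \<in> carrier F \<Longrightarrow> lift f \<in> carrier R"
  unfolding lift_def
  by (rule N.R.finsum_closed) (use supp_sub F_D(1) coef(1) in blast)

lemma lift_add:
  assumes f: "f \<in> carrier F" and g: "g \<in> carrier F"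
  shows "lift (f \<oplus>\<^bsub>F\<^esub> g) = lift f \<oplus>\<^bsub>R\<^esub> lift g"
proof -
  let ?T = "supp f \<union> supp g"
  have T: "finite ?T" "?T \<subseteq> carrier N" using F_D(2) f g supp_sub by auto
  have mem: "f x \<in> carrier R" "g x \<in> carrier R" "coef x \<in> carrier R" if "x \<in> ?T" for x
    using that T(2) F_D(1) f g coef(1) by blast+
  have "lift (f \<oplus>\<^bsub>F\<^esub> g) = (\<Oplus>\<^bsub>R\<^esub>x\<in>?T. (f \<oplus>\<^bsub>F\<^esub> g) x \<otimes>\<^bsub>R\<^esub> coef x)"
    by (rule lift_eq) (use F_add f g T in auto)
  also have "\<dots> = (\<Oplus>\<^bsub>R\<^esub>x\<in>?T. f x \<otimes>\<^bsub>R\<^esub> coef x \<oplus>\<^bsub>R\<^esub> g x \<otimes>\<^bsub>R\<^esub> coef x)"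
    by (rule N.R.finsum_cong') (use mem T(2) in \<open>auto simp: F_simps N.R.l_distr subset_iff\<close>)
  also have "\<dots> = (\<Oplus>\<^bsub>R\<^esub>x\<in>?T. f x \<otimes>\<^bsub>R\<^esub> coef x) \<oplus>\<^bsub>R\<^esub> (\<Oplus>\<^bsub>R\<^esub>x\<in>?T. g x \<otimes>\<^bsub>R\<^esub> coef x)"
    by (rule N.R.finsum_addf) (use mem in auto)
  also have "\<dots> = lift f \<oplus>\<^bsub>R\<^esub> lift g"
    using lift_eq[OF f T(1) _ T(2)] lift_eq[OF g T(1) _ T(2)] by simp
  finally show ?thesis .
qed

lemma lift_smult:
  assumes r: "r \<in> carrier R" and f: "f \<in> carrier F"
  shows "lift (r \<odot>\<^bsub>F\<^esub> f) = r \<otimes>\<^bsub>R\<^esub> lift f"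
proof -
  have mem: "f x \<in> carrier R" "coef x \<in> carrier R" "x \<in> carrier N" if "x \<in> supp f" for x
    using that supp_sub F_D(1) f coef(1) by blast+
  have "lift (r \<odot>\<^bsub>F\<^esub> f) = (\<Oplus>\<^bsub>R\<^esub>x\<in>supp f. (r \<odot>\<^bsub>F\<^esub> f) x \<otimes>\<^bsub>R\<^esub> coef x)"
    by (rule lift_eq) (use F_smult F_D r f supp_sub in auto)
  also have "\<dots> = (\<Oplus>\<^bsub>R\<^esub>x\<in>supp f. r \<otimes>\<^bsub>R\<^esub> (f x \<otimes>\<^bsub>R\<^esub> coef x))"
    by (rule N.R.finsum_cong') (use mem r in \<open>auto simp: F_simps N.R.m_assoc\<close>)
  also have "\<dots> = r \<otimes>\<^bsub>R\<^esub> lift f"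
    unfolding lift_def
    by (rule N.R.finsum_rdistr[symmetric]) (use mem r F_D(2)[OF f] in auto)
  finally show ?thesis .
qed

text \<open>
  This reduces the canonical presentation of \<open>N\<close> to the presentation \<open>0 \<rightarrow> I \<rightarrow> R \<rightarrow> N \<rightarrow> 0\<close>: the
  syzygies are exactly the elements that \<open>lift\<close> sends to the annihilator of the generator.
\<close>

lemma free_cover_lift:
  assumes f: "f \<in> carrier F"
  shows "free_cover R N f = lift f \<odot>\<^bsub>N\<^esub> s0"
proof -
  have "(\<Oplus>\<^bsub>N\<^esub>x\<in>T. f x \<odot>\<^bsub>N\<^esub> x) = (\<Oplus>\<^bsub>R\<^esub>x\<in>T. f x \<otimes>\<^bsub>R\<^esub> coef x) \<odot>\<^bsub>N\<^esub> s0"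
    if "finite T" "T \<subseteq> carrier N" for T
    using that
  proof (induction T rule: finite_induct)
    case empty
    then show ?case by (simp add: N.zero_smult gen_closed)
  next
    case (insert x T)
    have mem: "f y \<in> carrier R" "coef y \<in> carrier R" "y \<in> carrier N" if "y \<in> insert x T" for y
      using that insert.prems F_D(1)[OF f] coef(1) by blast+
    have "(\<Oplus>\<^bsub>N\<^esub>x\<in>insert x T. f x \<odot>\<^bsub>N\<^esub> x) = f x \<odot>\<^bsub>N\<^esub> x \<oplus>\<^bsub>N\<^esub> (\<Oplus>\<^bsub>N\<^esub>x\<in>T. f x \<odot>\<^bsub>N\<^esub> x)"
      using insert.hyps mem by (intro N.M.finsum_insert) (auto simp: N.smult_closed)
    also have "f x \<odot>\<^bsub>N\<^esub> x = (f x \<otimes>\<^bsub>R\<^esub> coef x) \<odot>\<^bsub>N\<^esub> s0"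
      using mem[of x] coef(2)[of x] by (simp add: N.smult_assoc gen_closed)
    also have "(\<Oplus>\<^bsub>N\<^esub>x\<in>T. f x \<odot>\<^bsub>N\<^esub> x) = (\<Oplus>\<^bsub>R\<^esub>x\<in>T. f x \<otimes>\<^bsub>R\<^esub> coef x) \<odot>\<^bsub>N\<^esub> s0"
      using insert by simp
    also have "(f x \<otimes>\<^bsub>R\<^esub> coef x) \<odot>\<^bsub>N\<^esub> s0 \<oplus>\<^bsub>N\<^esub> (\<Oplus>\<^bsub>R\<^esub>x\<in>T. f x \<otimes>\<^bsub>R\<^esub> coef x) \<odot>\<^bsub>N\<^esub> s0 =
        (f x \<otimes>\<^bsub>R\<^esub> coef x \<oplus>\<^bsub>R\<^esub> (\<Oplus>\<^bsub>R\<^esub>x\<in>T. f x \<otimes>\<^bsub>R\<^esub> coef x)) \<odot>\<^bsub>N\<^esub> s0"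
      using mem by (intro N.smult_l_distr[symmetric] N.R.finsum_closed gen_closed) auto
    also have "f x \<otimes>\<^bsub>R\<^esub> coef x \<oplus>\<^bsub>R\<^esub> (\<Oplus>\<^bsub>R\<^esub>x\<in>T. f x \<otimes>\<^bsub>R\<^esub> coef x) =
        (\<Oplus>\<^bsub>R\<^esub>x\<in>insert x T. f x \<otimes>\<^bsub>R\<^esub> coef x)"
      using insert.hyps mem by (intro N.R.finsum_insert[symmetric]) auto
    finally show ?case .
  qed
  from this[OF F_D(2)[OF f] supp_sub] show ?thesis
    by (simp add: free_cover_def lift_def supp_def)
qed

lemma K_simps:
  "carrier K = {f \<in> carrier F. lift f \<in> carrier I}" "add K = add F" "smult K = smult F"
  using lift_closed by (auto simp: free_syzygy_def free_cover_lift free_lmod_def)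

lemma operator_group_K: "operator_group R K"
proof -
  interpret I: operator_group R I by (rule operator_group_I)
  interpret F: operator_group R F by (rule operator_group_F)
  show ?thesis
    using I.add_closed I.op_closed
    by unfold_locales (auto simp: K_simps lift_add lift_smult F.add_closed F.op_closed simp del: I_simps(1) | simp)+
qed

text \<open>
  The embedding of \<open>R\<close> into \<open>F\<close> as the summand that belongs to the generator.
\<close>

definition single :: "'r \<Rightarrow> 'x \<Rightarrow> 'r" where
  "single r = (\<lambda>x\<in>carrier N. if x = s0 then r else \<zero>\<^bsub>R\<^esub>)"

lemma single:
  assumes r: "r \<in> carrier R"
  shows "single r \<in> carrier F" and "lift (single r) = r"
proof -
  have sub: "supp (single r) \<subseteq> {s0}" by (auto simp: supp_def single_def)
  show F: "single r \<in> carrier F"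
    using sub finite_subset r unfolding F_simps by (auto simp: single_def)
  have "lift (single r) = (\<Oplus>\<^bsub>R\<^esub>x\<in>{s0}. single r x \<otimes>\<^bsub>R\<^esub> coef x)"
    by (rule lift_eq[OF F]) (use sub gen_closed in auto)
  also have "\<dots> = r"
    using r gen_closed by (simp add: single_def coef_def)
  finally show "lift (single r) = r" .
qed

lemma single_add: "r \<in> carrier R \<Longrightarrow> r' \<in> carrier R \<Longrightarrow>
    single (r \<oplus>\<^bsub>R\<^esub> r') = single r \<oplus>\<^bsub>F\<^esub> single r'"
  by (auto simp: single_def F_simps fun_eq_iff)

lemma single_smult: "r \<in> carrier R \<Longrightarrow> r' \<in> carrier R \<Longrightarrow>
    single (r' \<otimes>\<^bsub>R\<^esub> r) = r' \<odot>\<^bsub>F\<^esub> single r"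
  by (auto simp: single_def F_simps fun_eq_iff)

text \<open>
  The projection of \<open>F\<close> along this summand. It lands in the syzygies, whatever \<open>f\<close> is; hence
  homomorphisms on the syzygies extend to \<open>F\<close> after a correction on the annihilator.
\<close>

definition syzygy_part :: "('x \<Rightarrow> 'r) \<Rightarrow> ('x \<Rightarrow> 'r)" where
  "syzygy_part f = f \<oplus>\<^bsub>F\<^esub> single (\<ominus>\<^bsub>R\<^esub> lift f)"

lemma syzygy_part:
  assumes f: "f \<in> carrier F"
  shows "syzygy_part f \<in> carrier K" and "syzygy_part f \<oplus>\<^bsub>F\<^esub> single (lift f) = f"
proof -
  have l: "lift f \<in> carrier R" by (rule lift_closed[OF f])
  show "syzygy_part f \<in> carrier K"
    using l by (simp add: K_simps syzygy_part_def f F_add lift_add single N.R.r_neg N.zero_smult gen_closed)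
  show "syzygy_part f \<oplus>\<^bsub>F\<^esub> single (lift f) = f"
    using l F_D(1,3)[OF f]
    by (auto simp: syzygy_part_def F_simps single_def fun_eq_iff N.R.a_assoc N.R.l_neg extensional_def)
qed

lemma syzygy_part_add:
  assumes f: "f \<in> carrier F" and g: "g \<in> carrier F"
  shows "syzygy_part (f \<oplus>\<^bsub>F\<^esub> g) = syzygy_part f \<oplus>\<^bsub>F\<^esub> syzygy_part g"
  unfolding syzygy_part_def lift_add[OF f g]
  using lift_closed[OF f] lift_closed[OF g] F_D(1)[OF f] F_D(1)[OF g]
  by (auto simp: F_simps single_def fun_eq_iff N.R.minus_add N.R.a_ac)

lemma syzygy_part_smult:
  assumes r: "r \<in> carrier R" and f: "f \<in> carrier F"
  shows "syzygy_part (r \<odot>\<^bsub>F\<^esub> f) = r \<odot>\<^bsub>F\<^esub> syzygy_part f"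
  unfolding syzygy_part_def lift_smult[OF r f]
  using lift_closed[OF f] F_D(1)[OF f] r
  by (auto simp: F_simps single_def fun_eq_iff N.R.r_minus N.R.r_distr)

end

section \<open>Extensions of a cyclic module\<close>

lemma linear_mapI:
  assumes "vectorspace K V" and "vectorspace K W"
    and "\<And>x. x \<in> carrier V \<Longrightarrow> T x \<in> carrier W"
    and "\<And>x y. x \<in> carrier V \<Longrightarrow> y \<in> carrier V \<Longrightarrow> T (x \<oplus>\<^bsub>V\<^esub> y) = T x \<oplus>\<^bsub>W\<^esub> T y"
    and "\<And>c x. c \<in> carrier K \<Longrightarrow> x \<in> carrier V \<Longrightarrow> T (c \<odot>\<^bsub>V\<^esub> x) = c \<odot>\<^bsub>W\<^esub> T x"
  shows "linear_map K V W T"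
  using assms
  by (intro linear_map.intro mod_hom.intro mod_hom_axioms.intro)
    (auto simp: vectorspace_def module_hom_def)

lemma rank_nullity_image_kernel:
  assumes "linear_map K V W T" and "vectorspace.fin_dim K V"
  shows "vectorspace.dim K (W\<lparr>carrier := T ` carrier V\<rparr>) +
    vectorspace.dim K (V\<lparr>carrier := {x \<in> carrier V. T x = \<zero>\<^bsub>W\<^esub>}\<rparr>) = vectorspace.dim K V"
proof -
  interpret linear_map K V W T by fact
  show ?thesis using rank_nullity[OF assms(2)] by (simp add: im_def ker_def)
qed

lemma injective_linear_dim_image:
  assumes "linear_map K V W T" and "inj_on T (carrier V)" and "vectorspace.fin_dim K V"
  shows "vectorspace.dim K (W\<lparr>carrier := T ` carrier V\<rparr>) = vectorspace.dim K V"
proof -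
  interpret linear_map K V W T by fact
  show ?thesis using rank_nullity[OF assms(3)] inj_imp_dim_ker0[OF assms(2)] by (simp add: im_def)
qed

lemma linear_map_inj:
  assumes "linear_map K V W T" and "\<And>x. x \<in> carrier V \<Longrightarrow> T x = \<zero>\<^bsub>W\<^esub> \<Longrightarrow> x = \<zero>\<^bsub>V\<^esub>"
  shows "inj_on T (carrier V)"
proof -
  interpret linear_map K V W T by fact
  have "\<zero>\<^bsub>V\<^esub> \<in> ker" by (simp add: ker_def)
  then have "ker = {\<zero>\<^bsub>V\<^esub>}" using assms(2) by (auto simp: ker_def)
  then show ?thesis by (intro Ke0_imp_inj) simp
qed

locale cyclic_ext = cyclic_module R N s0 + M: left_module R M + complex_algebra R \<iota>
  for R :: "('r, 'z) ring_scheme" and N :: "('r, 'x) module" and s0 :: 'x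
    and M :: "('r, 'y) module" and \<iota> :: "complex \<Rightarrow> 'r"
begin

abbreviation VM where "VM \<equiv> restrict_scalars \<iota> M"
abbreviation HI where "HI \<equiv> Hom_space R \<iota> I M"
abbreviation HN where "HN \<equiv> Hom_space R \<iota> N M"
abbreviation HF where "HF \<equiv> Hom_space R \<iota> F M"
abbreviation HK where "HK \<equiv> Hom_space R \<iota> K M"

lemma vectorspaces:
  "vectorspace class_ring VM" "vectorspace class_ring HI" "vectorspace class_ring HN"
  "vectorspace class_ring HF" "vectorspace class_ring HK"
  using M.left_module_axioms complex_algebra_axioms
  by (auto intro!: vectorspace_restrict_scalars vectorspace_Hom_space
      operator_group_I operator_group_K operator_group_F N.operator_group)

lemma VM_simps: "carrier VM = carrier M" "add VM = add M" "c \<odot>\<^bsub>VM\<^esub> x = \<iota> c \<odot>\<^bsub>M\<^esub> x"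
  "\<zero>\<^bsub>VM\<^esub> = \<zero>\<^bsub>M\<^esub>"
  by (simp_all add: restrict_scalars_def)

definition act_on :: "'y \<Rightarrow> 'r \<Rightarrow> 'y" where
  "act_on y = (\<lambda>r\<in>carrier I. r \<odot>\<^bsub>M\<^esub> y)"

lemma act_on_hom: "y \<in> carrier M \<Longrightarrow> act_on y \<in> lmod_hom R I M"
  using operator_group.add_closed[OF operator_group_I] operator_group.op_closed[OF operator_group_I]
  by (intro lmod_homI) (auto simp: act_on_def M.smult_closed M.smult_l_distr M.smult_assoc simp del: I_simps(1) | simp)+

lemma linear_act_on: "linear_map class_ring VM HI act_on"
proof (rule linear_mapI[OF vectorspaces(1,2)])
  fix c y assume "y \<in> carrier VM"
  then have y: "y \<in> carrier M" by (simp add: VM_simps)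
  have "r \<odot>\<^bsub>M\<^esub> (\<iota> c \<odot>\<^bsub>M\<^esub> y) = \<iota> c \<odot>\<^bsub>M\<^esub> (r \<odot>\<^bsub>M\<^esub> y)" if "r \<in> carrier R" for r
    using M.smult_assoc[OF that \<iota>_closed y] M.smult_assoc[OF \<iota>_closed that y] \<iota>_central[OF that]
    by simp
  then show "act_on (c \<odot>\<^bsub>VM\<^esub> y) = c \<odot>\<^bsub>HI\<^esub> act_on y"
    by (auto simp: act_on_def VM_simps Hom_space_simps fun_eq_iff)
next
  fix x y assume "x \<in> carrier VM" "y \<in> carrier VM"
  then show "act_on (x \<oplus>\<^bsub>VM\<^esub> y) = act_on x \<oplus>\<^bsub>HI\<^esub> act_on y"
    by (simp add: VM_simps Hom_space_simps act_on_def M.smult_r_distr fun_eq_iff)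
qed (simp add: act_on_hom VM_simps Hom_space_simps)

text \<open>
  A homomorphism from \<open>N\<close> is determined by its value at the generator, which may be any element
  annihilated by \<open>I\<close>.
\<close>

lemma hom_dim_annihilated:
  assumes "vectorspace.fin_dim class_ring VM"
  shows "vectorspace.dim class_ring
    (VM\<lparr>carrier := {y \<in> carrier VM. act_on y = \<zero>\<^bsub>HI\<^esub>}\<rparr>) = hom_dim R \<iota> N M"
proof -
  let ?ev = "\<lambda>h. h s0"
  have lin: "linear_map class_ring HN VM ?ev"
    by (rule linear_mapI[OF vectorspaces(3,1)])
      (auto simp: Hom_space_simps VM_simps lmod_homD gen_closed)
  have "h = \<zero>\<^bsub>HN\<^esub>" if h: "h \<in> carrier HN" and 0: "h s0 = \<zero>\<^bsub>VM\<^esub>" for h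
  proof
    have hom: "h \<in> lmod_hom R N M" using h by (simp add: Hom_space_simps)
    fix x
    show "h x = \<zero>\<^bsub>HN\<^esub> x"
    proof (cases "x \<in> carrier N")
      case True
      then obtain r where r: "r \<in> carrier R" "x = r \<odot>\<^bsub>N\<^esub> s0" using generates by blast
      then show ?thesis
        using True 0 lmod_homD(4)[OF hom r(1) gen_closed] M.smult_zero[OF r(1)]
        by (simp add: Hom_space_simps VM_simps)
    next
      case False
      then show ?thesis
        using lmod_homD(1)[OF hom] by (simp add: Hom_space_simps extensional_def)
    qed
  qed
  then have inj: "inj_on ?ev (carrier HN)" by (rule linear_map_inj[OF lin])
  have fd: "vectorspace.fin_dim class_ring HN"
    by (rule injective_linear_imp_fin_dim(1)[OF lin inj assms])
  have "?ev ` carrier HN = {y \<in> carrier VM. act_on y = \<zero>\<^bsub>HI\<^esub>}"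
  proof (intro equalityI subsetI)
    fix y assume "y \<in> ?ev ` carrier HN"
    then obtain h where h: "h \<in> lmod_hom R N M" "y = h s0" by (auto simp: Hom_space_simps)
    have h0: "h \<zero>\<^bsub>N\<^esub> = \<zero>\<^bsub>M\<^esub>"
      using lmod_homD(3)[OF h(1), of "\<zero>\<^bsub>N\<^esub>" "\<zero>\<^bsub>N\<^esub>"] lmod_homD(2)[OF h(1), of "\<zero>\<^bsub>N\<^esub>"]
      by (intro M.add_eq_self) simp_all
    have "r \<odot>\<^bsub>M\<^esub> y = \<zero>\<^bsub>M\<^esub>" if "r \<in> carrier I" for r
      using that lmod_homD(4)[OF h(1) _ gen_closed, of r] h0 h(2) by simp
    then show "y \<in> {y \<in> carrier VM. act_on y = \<zero>\<^bsub>HI\<^esub>}"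
      using lmod_homD(2)[OF h(1) gen_closed] h(2)
      by (simp add: VM_simps act_on_def Hom_space_simps fun_eq_iff)
  next
    fix y assume y: "y \<in> {y \<in> carrier VM. act_on y = \<zero>\<^bsub>HI\<^esub>}"
    then have yM: "y \<in> carrier M" by (simp add: VM_simps)
    have kill: "r \<odot>\<^bsub>M\<^esub> y = \<zero>\<^bsub>M\<^esub>" if "r \<in> carrier R" "r \<odot>\<^bsub>N\<^esub> s0 = \<zero>\<^bsub>N\<^esub>" for r
    proof -
      have "act_on y r = \<zero>\<^bsub>HI\<^esub> r" using y by simp
      then show ?thesis using that by (simp add: act_on_def Hom_space_simps)
    qed
    \<comment> \<open>The action on \<open>y\<close> depends only on the element of \<open>N\<close>, not on its coefficient.\<close>
    have wd: "r \<odot>\<^bsub>M\<^esub> y = r' \<odot>\<^bsub>M\<^esub> y"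
      if r: "r \<in> carrier R" "r' \<in> carrier R" and eq: "r \<odot>\<^bsub>N\<^esub> s0 = r' \<odot>\<^bsub>N\<^esub> s0" for r r'
    proof -
      have "(r \<oplus>\<^bsub>R\<^esub> \<ominus>\<^bsub>R\<^esub> r') \<odot>\<^bsub>N\<^esub> s0 = (r' \<oplus>\<^bsub>R\<^esub> \<ominus>\<^bsub>R\<^esub> r') \<odot>\<^bsub>N\<^esub> s0"
        using r eq gen_closed by (simp only: N.smult_l_distr N.R.a_inv_closed)
      then have "(r \<oplus>\<^bsub>R\<^esub> \<ominus>\<^bsub>R\<^esub> r') \<odot>\<^bsub>M\<^esub> y = \<zero>\<^bsub>M\<^esub>"
        using r by (intro kill) (simp_all add: N.R.r_neg N.zero_smult gen_closed)
      moreover have "((r \<oplus>\<^bsub>R\<^esub> \<ominus>\<^bsub>R\<^esub> r') \<oplus>\<^bsub>R\<^esub> r') \<odot>\<^bsub>M\<^esub> y =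
          (r \<oplus>\<^bsub>R\<^esub> \<ominus>\<^bsub>R\<^esub> r') \<odot>\<^bsub>M\<^esub> y \<oplus>\<^bsub>M\<^esub> r' \<odot>\<^bsub>M\<^esub> y"
        using r yM by (intro M.smult_l_distr) simp_all
      moreover have "(r \<oplus>\<^bsub>R\<^esub> \<ominus>\<^bsub>R\<^esub> r') \<oplus>\<^bsub>R\<^esub> r' = r" using r by (simp add: N.R.a_assoc N.R.l_neg)
      ultimately show ?thesis using r yM by (simp add: M.smult_closed)
    qed
    let ?h = "\<lambda>x\<in>carrier N. coef x \<odot>\<^bsub>M\<^esub> y"
    have "?h \<in> lmod_hom R N M"
    proof (rule lmod_homI)
      fix x x' assume x: "x \<in> carrier N" "x' \<in> carrier N"
      have "coef (x \<oplus>\<^bsub>N\<^esub> x') \<odot>\<^bsub>M\<^esub> y = (coef x \<oplus>\<^bsub>R\<^esub> coef x') \<odot>\<^bsub>M\<^esub> y"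
        by (rule wd) (use x in \<open>simp_all add: coef N.smult_l_distr gen_closed\<close>)
      then show "?h (x \<oplus>\<^bsub>N\<^esub> x') = ?h x \<oplus>\<^bsub>M\<^esub> ?h x'"
        using x by (simp add: coef M.smult_l_distr yM)
    next
      fix r x assume x: "r \<in> carrier R" "x \<in> carrier N"
      have "coef (r \<odot>\<^bsub>N\<^esub> x) \<odot>\<^bsub>M\<^esub> y = (r \<otimes>\<^bsub>R\<^esub> coef x) \<odot>\<^bsub>M\<^esub> y"
        by (rule wd) (use x in \<open>simp_all add: coef N.smult_assoc N.smult_closed gen_closed\<close>)
      then show "?h (r \<odot>\<^bsub>N\<^esub> x) = r \<odot>\<^bsub>M\<^esub> ?h x"
        using x by (simp add: coef M.smult_assoc yM N.smult_closed)
    qed (auto simp: coef M.smult_closed yM)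
    moreover have "?h s0 = y" by (simp add: gen_closed coef_def M.smult_one yM)
    ultimately show "y \<in> ?ev ` carrier HN" by (auto simp: Hom_space_simps image_iff intro: bexI[of _ ?h])
  qed
  then show ?thesis
    using injective_linear_dim_image[OF lin inj fd] by (simp add: hom_dim_def)
qed

text \<open>
  The subspace by which \<open>Ext1_space\<close> divides.
\<close>

definition extendable where "extendable = (\<lambda>h. restrict h (carrier K)) ` lmod_hom R F M"

lemma K_sub_F: "f \<in> carrier K \<Longrightarrow> f \<in> carrier F"
  by (simp add: K_simps)

lemma subspace_extendable: "subspace class_ring extendable HK"
proof -
  interpret F: operator_group R F by (rule operator_group_F)
  interpret K: operator_group R K by (rule operator_group_K)
  have res: "restrict h (carrier K) \<in> lmod_hom R K M" if h: "h \<in> lmod_hom R F M" for h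
    using K.add_closed K.op_closed K_simps(2,3)
    by (intro lmod_homI) (simp_all add: lmod_homD[OF h] K_sub_F)
  have "linear_map class_ring HF HK (\<lambda>h. restrict h (carrier K))"
    by (rule linear_mapI[OF vectorspaces(4,5)])
      (auto simp: Hom_space_simps res K_sub_F fun_eq_iff)
  then interpret linear_map class_ring HF HK "\<lambda>h. restrict h (carrier K)" .
  show ?thesis using imT_is_subspace by (simp add: im_def extendable_def Hom_space_simps)
qed

definition pullback :: "('r \<Rightarrow> 'y) \<Rightarrow> ('x \<Rightarrow> 'r) \<Rightarrow> 'y" where
  "pullback \<theta> = (\<lambda>f\<in>carrier K. \<theta> (lift f))"

lemma lift_K: "f \<in> carrier K \<Longrightarrow> lift f \<in> carrier I"
  by (simp add: K_simps)

lemma pullback_hom: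
  assumes "\<theta> \<in> lmod_hom R I M"
  shows "pullback \<theta> \<in> lmod_hom R K M"
proof -
  interpret K: operator_group R K by (rule operator_group_K)
  show ?thesis
  proof (rule lmod_homI)
    fix f g assume f: "f \<in> carrier K" "g \<in> carrier K"
    have "\<theta> (lift f \<oplus>\<^bsub>R\<^esub> lift g) = \<theta> (lift f) \<oplus>\<^bsub>M\<^esub> \<theta> (lift g)"
      using lmod_homD(3)[OF assms lift_K lift_K] f by simp
    then show "pullback \<theta> (f \<oplus>\<^bsub>K\<^esub> g) = pullback \<theta> f \<oplus>\<^bsub>M\<^esub> pullback \<theta> g"
      using f K.add_closed[OF f] by (simp add: pullback_def K_simps(2) lift_add K_sub_F)
  next
    fix r f assume r: "r \<in> carrier R" and f: "f \<in> carrier K"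
    have "\<theta> (r \<otimes>\<^bsub>R\<^esub> lift f) = r \<odot>\<^bsub>M\<^esub> \<theta> (lift f)"
      using lmod_homD(4)[OF assms r lift_K[OF f]] by simp
    then show "pullback \<theta> (r \<odot>\<^bsub>K\<^esub> f) = r \<odot>\<^bsub>M\<^esub> pullback \<theta> f"
      using f K.op_closed[OF r f] r by (simp add: pullback_def K_simps(3) lift_smult K_sub_F)
  qed (auto simp: pullback_def intro!: lmod_homD(2)[OF assms] lift_K simp del: I_simps(1))
qed

lemma single_K: "r \<in> carrier I \<Longrightarrow> single r \<in> carrier K"
  by (simp add: K_simps(1) single)

text \<open>
  If the pullback of \<open>\<theta>\<close> extends to \<open>g\<close> on \<open>F\<close>, restricting \<open>g\<close> to the summand of the generator
  shows that \<open>\<theta>\<close> is given by the action on the value of \<open>g\<close> there. Conversely the action on \<open>y\<close> makes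
  sense on all of \<open>R\<close>.
\<close>

lemma pullback_extendable_iff:
  assumes \<theta>: "\<theta> \<in> lmod_hom R I M"
  shows "pullback \<theta> \<in> extendable \<longleftrightarrow> (\<exists>y\<in>carrier M. \<theta> = act_on y)"
proof
  assume "pullback \<theta> \<in> extendable"
  then obtain g where g: "g \<in> lmod_hom R F M" "pullback \<theta> = restrict g (carrier K)" by (auto simp: extendable_def)
  let ?y = "g (single \<one>\<^bsub>R\<^esub>)"
  have "\<theta> = act_on ?y"
  proof
    fix r
    show "\<theta> r = act_on ?y r"
    proof (cases "r \<in> carrier I")
      case True
      then have r: "r \<in> carrier R" by simp
      have "\<theta> r = pullback \<theta> (single r)" using True single_K[OF True] r by (simp add: pullback_def single)
      also have "\<dots> = g (single (r \<otimes>\<^bsub>R\<^esub> \<one>\<^bsub>R\<^esub>))" using g(2) single_K[OF True] r by simp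
      also have "\<dots> = r \<odot>\<^bsub>M\<^esub> ?y"
        using r by (simp only: single_smult N.R.one_closed lmod_homD(4)[OF g(1)] single)
      finally show ?thesis using True by (simp add: act_on_def)
    next
      case False
      then show ?thesis
        using lmod_homD(1)[OF \<theta>] unfolding act_on_def extensional_def by (simp del: I_simps(1))
    qed
  qed
  moreover have "?y \<in> carrier M" by (rule lmod_homD(2)[OF g(1)]) (simp add: single)
  ultimately show "\<exists>y\<in>carrier M. \<theta> = act_on y" by blast
next
  assume "\<exists>y\<in>carrier M. \<theta> = act_on y"
  then obtain y where y: "y \<in> carrier M" "\<theta> = act_on y" by blast
  interpret F: operator_group R F by (rule operator_group_F)
  let ?g = "\<lambda>f\<in>carrier F. lift f \<odot>\<^bsub>M\<^esub> y"
  have "?g \<in> lmod_hom R F M"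
    by (rule lmod_homI)
      (auto simp: F.add_closed F.op_closed lift_add lift_smult lift_closed M.smult_closed y
        M.smult_l_distr M.smult_assoc)
  moreover have "pullback \<theta> = restrict ?g (carrier K)"
    using lift_K by (auto simp: pullback_def y(2) act_on_def K_sub_F fun_eq_iff simp del: I_simps(1))
  ultimately show "pullback \<theta> \<in> extendable" unfolding extendable_def by (intro image_eqI)
qed

text \<open>
  Split a syzygy into its \<open>syzygy_part\<close> and the multiple \<open>lift f\<close> of the generator. On the first
  summand \<open>\<phi>\<close> extends to \<open>F\<close>, and on the second it is a homomorphism on \<open>I\<close>.
\<close>

lemma HK_mod_extendable:
  assumes \<phi>: "\<phi> \<in> lmod_hom R K M"
  shows "\<exists>\<theta>\<in>lmod_hom R I M. \<exists>b\<in>extendable. \<phi> = b \<oplus>\<^bsub>HK\<^esub> pullback \<theta>"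
proof -
  interpret I: operator_group R I by (rule operator_group_I)
  interpret F: operator_group R F by (rule operator_group_F)
  interpret K: operator_group R K by (rule operator_group_K)
  let ?\<theta> = "\<lambda>r\<in>carrier I. \<phi> (single r)"
  let ?g = "\<lambda>f\<in>carrier F. \<phi> (syzygy_part f)"
  have "?\<theta> \<in> lmod_hom R I M"
  proof (rule lmod_homI)
    fix r s assume rs: "r \<in> carrier I" "s \<in> carrier I"
    then show "?\<theta> (r \<oplus>\<^bsub>I\<^esub> s) = ?\<theta> r \<oplus>\<^bsub>M\<^esub> ?\<theta> s"
      using I.add_closed[OF rs] lmod_homD(3)[OF \<phi> single_K single_K, of r s]
      by (simp add: single_add K_simps(2))
  next
    fix r s assume rs: "r \<in> carrier R" "s \<in> carrier I"
    then show "?\<theta> (r \<odot>\<^bsub>I\<^esub> s) = r \<odot>\<^bsub>M\<^esub> ?\<theta> s"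
      using I.op_closed[OF rs] lmod_homD(4)[OF \<phi> rs(1) single_K, of s]
      by (simp add: single_smult K_simps(3))
  qed (auto intro!: lmod_homD(2)[OF \<phi>] single_K simp del: I_simps(1))
  moreover have "?g \<in> lmod_hom R F M"
  proof (rule lmod_homI)
    fix f g assume f: "f \<in> carrier F" "g \<in> carrier F"
    then show "?g (f \<oplus>\<^bsub>F\<^esub> g) = ?g f \<oplus>\<^bsub>M\<^esub> ?g g"
      using F.add_closed[OF f] lmod_homD(3)[OF \<phi> syzygy_part(1) syzygy_part(1), of f g]
      by (simp add: syzygy_part_add K_simps(2))
  next
    fix r f assume r: "r \<in> carrier R" and f: "f \<in> carrier F"
    then show "?g (r \<odot>\<^bsub>F\<^esub> f) = r \<odot>\<^bsub>M\<^esub> ?g f"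
      using F.op_closed[OF r f] lmod_homD(4)[OF \<phi> r syzygy_part(1)[OF f]]
      by (simp add: syzygy_part_smult K_simps(3))
  qed (auto intro!: lmod_homD(2)[OF \<phi>] syzygy_part(1))
  then have "restrict ?g (carrier K) \<in> extendable" unfolding extendable_def by (rule imageI)
  moreover have "\<phi> = restrict ?g (carrier K) \<oplus>\<^bsub>HK\<^esub> pullback ?\<theta>"
  proof
    fix f
    show "\<phi> f = (restrict ?g (carrier K) \<oplus>\<^bsub>HK\<^esub> pullback ?\<theta>) f"
    proof (cases "f \<in> carrier K")
      case True
      have "\<phi> f = \<phi> (syzygy_part f \<oplus>\<^bsub>K\<^esub> single (lift f))"
        by (simp only: K_simps(2) syzygy_part(2)[OF K_sub_F[OF True]])
      also have "\<dots> = \<phi> (syzygy_part f) \<oplus>\<^bsub>M\<^esub> \<phi> (single (lift f))"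
        by (rule lmod_homD(3)[OF \<phi> syzygy_part(1)[OF K_sub_F[OF True]] single_K[OF lift_K[OF True]]])
      finally show ?thesis
        using True lift_K[OF True] K_sub_F[OF True]
        by (simp add: Hom_space_simps pullback_def del: I_simps(1))
    next
      case False
      then show ?thesis
        using lmod_homD(1)[OF \<phi>] by (simp add: Hom_space_simps extensional_def)
    qed
  qed
  ultimately show ?thesis by blast
qed

text \<open>
  Rank and nullity for the two maps \<open>M \<rightarrow> Hom(I, M) \<rightarrow> Ext\<^sup>1(N, M)\<close>, the second of which is onto
  with kernel the image of the first.
\<close>

theorem ext1_dim_cyclic:
  assumes fM: "vectorspace.fin_dim class_ring VM" and fI: "vectorspace.fin_dim class_ring HI"
  shows "ext1_dim R \<iota> N M + vectorspace.dim class_ring VM = hom_dim R \<iota> N M + hom_dim R \<iota> I M"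
proof -
  let ?E = "quot_space HK extendable"
  let ?\<beta> = "\<lambda>\<theta>. extendable +>\<^bsub>HK\<^esub> pullback \<theta>"
  note quot = quot_space_linear_map[OF vectorspaces(5) subspace_extendable]
  have pullback_lin: "linear_map class_ring HI HK pullback"
  proof (rule linear_mapI[OF vectorspaces(2,5)])
    fix \<theta> \<eta> assume "\<theta> \<in> carrier HI" "\<eta> \<in> carrier HI"
    show "pullback (\<theta> \<oplus>\<^bsub>HI\<^esub> \<eta>) = pullback \<theta> \<oplus>\<^bsub>HK\<^esub> pullback \<eta>"
      using lift_K by (auto simp: pullback_def Hom_space_simps fun_eq_iff simp del: I_simps(1))
  next
    fix c \<theta> assume "\<theta> \<in> carrier HI"
    show "pullback (c \<odot>\<^bsub>HI\<^esub> \<theta>) = c \<odot>\<^bsub>HK\<^esub> pullback \<theta>"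
      using lift_K by (auto simp: pullback_def Hom_space_simps fun_eq_iff simp del: I_simps(1))
  qed (simp add: Hom_space_simps pullback_hom)
  have \<beta>: "linear_map class_ring HI ?E ?\<beta>"
  proof -
    interpret p: linear_map class_ring HI HK pullback by (rule pullback_lin)
    interpret q: linear_map class_ring HK ?E "\<lambda>x. extendable +>\<^bsub>HK\<^esub> x" by (rule quot(1))
    show ?thesis
      by (rule linear_mapI[OF vectorspaces(2) q.W.vectorspace_axioms]) simp_all
  qed
  have sub: "extendable \<subseteq> carrier HK" using subspace_extendable by (simp add: subspace_def submodule_def)
  have "?\<beta> ` carrier HI = carrier ?E"
  proof (intro equalityI subsetI)
    fix X assume "X \<in> ?\<beta> ` carrier HI"
    then show "X \<in> carrier ?E"
      using pullback_hom by (auto simp: quot_space_def A_RCOSETS_def' Hom_space_simps(1))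
  next
    fix X assume "X \<in> carrier ?E"
    then obtain \<phi> where \<phi>: "\<phi> \<in> lmod_hom R K M" "X = extendable +>\<^bsub>HK\<^esub> \<phi>"
      by (auto simp: quot_space_def A_RCOSETS_def' Hom_space_simps(1))
    obtain \<theta> b where \<theta>: "\<theta> \<in> lmod_hom R I M" and b: "b \<in> extendable" "\<phi> = b \<oplus>\<^bsub>HK\<^esub> pullback \<theta>"
      using HK_mod_extendable[OF \<phi>(1)] by blast
    interpret q: linear_map class_ring HK ?E "\<lambda>x. extendable +>\<^bsub>HK\<^esub> x" by (rule quot(1))
    have bc: "b \<in> carrier HK" and pc: "pullback \<theta> \<in> carrier HK"
      using b(1) sub pullback_hom[OF \<theta>] by (auto simp: Hom_space_simps(1))
    have "extendable +>\<^bsub>HK\<^esub> b = \<zero>\<^bsub>?E\<^esub>" using quot(2)[OF bc] b(1) by simp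
    then have "X = extendable +>\<^bsub>HK\<^esub> pullback \<theta>"
      unfolding \<phi>(2) b(2) q.f_add[OF bc pc] using q.f_im[OF pc] by simp
    then show "X \<in> ?\<beta> ` carrier HI" using \<theta> by (simp add: Hom_space_simps(1))
  qed
  moreover have "{\<theta> \<in> carrier HI. ?\<beta> \<theta> = \<zero>\<^bsub>?E\<^esub>} = act_on ` carrier VM"
    using quot(2) pullback_extendable_iff pullback_hom act_on_hom by (auto simp: Hom_space_simps(1) VM_simps)
  ultimately have "vectorspace.dim class_ring ?E +
      vectorspace.dim class_ring (HI\<lparr>carrier := act_on ` carrier VM\<rparr>) = vectorspace.dim class_ring HI"
    using rank_nullity_image_kernel[OF \<beta> fI] by simp
  moreover have "vectorspace.dim class_ring (HI\<lparr>carrier := act_on ` carrier VM\<rparr>) +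
      hom_dim R \<iota> N M = vectorspace.dim class_ring VM"
    using rank_nullity_image_kernel[OF linear_act_on fM] hom_dim_annihilated[OF fM] by simp
  ultimately show ?thesis
    by (simp add: ext1_dim_def Ext1_space_def hom_dim_def extendable_def)
qed

end

section \<open>Nilpotent representations as modules\<close>

lemma (in wf_digraph) awalk_iff_qpaths:
  "awalk u w v \<longleftrightarrow> (u, w) \<in> qpaths G \<and> path_end G u w = v"
proof (induction w arbitrary: u)
  case Nil
  then show ?case by (auto simp: awalk_Nil_iff)
next
  case (Cons a w)
  then show ?case by (auto simp: awalk_Cons_iff qpaths_Cons)
qed

lemma (in wf_digraph) qpaths_start_in_verts: "(u, w) \<in> qpaths G \<Longrightarrow> u \<in> verts G"
  by (auto simp: qpaths_def awalk_def)

lemma (in fin_digraph) finite_short_qpaths: "finite {(u, w) \<in> qpaths G. length w < N}"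
proof (rule finite_subset)
  show "{(u, w) \<in> qpaths G. length w < N} \<subseteq> verts G \<times> {w. set w \<subseteq> arcs G \<and> length w \<le> N}"
    by (auto simp: qpaths_def awalk_def)
qed (use finite_lists_length_le[of "arcs G" N] in auto)

lemma (in wf_digraph) path_mat_carrier:
  assumes "M \<in> mat_space G d" and "(u, w) \<in> qpaths G"
  shows "path_mat G d M u w \<in> carrier_mat (d (path_end G u w)) (d u)"
  using assms(2)
proof (induction w arbitrary: u)
  case (Cons a w)
  then have "M a \<in> carrier_mat (d (head G a)) (d u)"
    using assms(1) by (auto simp: mat_space_def qpaths_Cons PiE_def Pi_def)
  moreover have "path_mat G d M (head G a) w \<in>
      carrier_mat (d (path_end G (head G a) w)) (d (head G a))"
    using Cons by (simp add: qpaths_Cons)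
  ultimately show ?case by (simp add: mult_carrier_mat[rotated])
qed simp

lemma (in wf_digraph) path_mat_append:
  assumes "M \<in> mat_space G d" and "(u, w @ w') \<in> qpaths G"
  shows "path_mat G d M u (w @ w') = path_mat G d M (path_end G u w) w' * path_mat G d M u w"
  using assms(2)
proof (induction w arbitrary: u)
  case Nil
  then show ?case using path_mat_carrier[OF assms(1), of u w'] by simp
next
  case (Cons a w)
  then have q: "(head G a, w @ w') \<in> qpaths G" and a: "a \<in> arcs G" "tail G a = u"
    by (auto simp: qpaths_Cons)
  have "M a \<in> carrier_mat (d (head G a)) (d u)"
    using assms(1) a by (auto simp: mat_space_def PiE_def Pi_def)
  moreover have "path_mat G d M (head G a) w \<in>
      carrier_mat (d (path_end G (head G a) w)) (d (head G a))"
    using q path_mat_carrier[OF assms(1)] by (auto simp: qpaths_append)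
  moreover have "path_mat G d M (path_end G (head G a) w) w' \<in>
      carrier_mat (d (path_end G (path_end G (head G a) w) w')) (d (path_end G (head G a) w))"
    using q path_mat_carrier[OF assms(1)] by (auto simp: qpaths_append)
  ultimately show ?case using Cons.IH[OF q] by (simp add: assoc_mult_mat)
qed

lemma zero_mult_mat_vec_index:
  fixes v :: "complex vec"
  assumes "v \<in> carrier_vec n" and "r < m"
  shows "(0\<^sub>m m n *\<^sub>v v) $ r = 0"
  using assms by (simp add: scalar_prod_def)

lemma abelian_group_rep_module: "abelian_group (rep_module G d M)"
proof (rule abelian_groupI)
  fix x assume "x \<in> carrier (rep_module G d M)"
  then show "\<exists>y\<in>carrier (rep_module G d M). y \<oplus>\<^bsub>rep_module G d M\<^esub> x = \<zero>\<^bsub>rep_module G d M\<^esub>"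
    by (intro bexI[of _ "\<lambda>i\<in>verts G. - x i"])
      (auto simp: rep_module_def rep_carrier_def PiE_def Pi_def fun_eq_iff restrict_def extensional_def)
qed (auto simp: rep_module_def rep_carrier_def PiE_def Pi_def fun_eq_iff restrict_def extensional_def
    comm_add_vec assoc_add_vec)

text \<open>
  The paths that can act by a nonzero matrix into the space at \<open>j\<close> when \<open>N\<close> bounds the nilpotency.
\<close>

definition short_paths_to :: "('v, 'a) pre_digraph \<Rightarrow> nat \<Rightarrow> 'v \<Rightarrow> ('v \<times> 'a list) set" where
  "short_paths_to G N j = {(u, w) \<in> qpaths G. length w < N \<and> path_end G u w = j}"

locale nilpotent_representation = fin_digraph G for G :: "('v, 'a) pre_digraph" +
  fixes d :: "'v \<Rightarrow> nat" and M :: "'a rep" and N :: nat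
  assumes M: "M \<in> mat_space G d"
    and long_path: "(u, w) \<in> qpaths G \<Longrightarrow> N \<le> length w \<Longrightarrow>
      path_mat G d M u w = 0\<^sub>m (d (path_end G u w)) (d u)"
begin

abbreviation pm where "pm \<equiv> path_mat G d M"

abbreviation paths_to where "paths_to \<equiv> short_paths_to G N"
lemmas paths_to_def = short_paths_to_def

lemma finite_paths_to: "finite (paths_to j)"
  by (rule finite_subset[OF _ finite_short_qpaths[of N]]) (auto simp: paths_to_def)

lemma rep_carrierD: "x \<in> rep_carrier G d \<Longrightarrow> i \<in> verts G \<Longrightarrow> x i \<in> carrier_vec (d i)"
  by (auto simp: rep_carrier_def)

lemma pm_carrier: "(u, w) \<in> paths_to j \<Longrightarrow> pm u w \<in> carrier_mat (d j) (d u)"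
  using path_mat_carrier[OF M] by (auto simp: paths_to_def)

lemma rep_act_index:
  assumes j: "j \<in> verts G" and r: "r < d j" and x: "x \<in> rep_carrier G d"
  shows "rep_act G d M f x j $ r = (\<Sum>(u, w)\<in>paths_to j. f (u, w) * (pm u w *\<^sub>v x u) $ r)"
proof -
  have "rep_act G d M f x j $ r =
      (\<Sum>(u, w)\<in>{(u, w). awalk u w j \<and> pm u w \<noteq> 0\<^sub>m (d j) (d u)}. f (u, w) * (pm u w *\<^sub>v x u) $ r)"
    using j r by (simp add: rep_act_def)
  also have "\<dots> = (\<Sum>(u, w)\<in>paths_to j. f (u, w) * (pm u w *\<^sub>v x u) $ r)"
  proof (rule sum.mono_neutral_left[OF finite_paths_to])
    show "{(u, w). awalk u w j \<and> pm u w \<noteq> 0\<^sub>m (d j) (d u)} \<subseteq> paths_to j"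
      using long_path by (auto simp: paths_to_def awalk_iff_qpaths not_less[symmetric])
    show "\<forall>i\<in>paths_to j - {(u, w). awalk u w j \<and> pm u w \<noteq> 0\<^sub>m (d j) (d u)}.
        (case i of (u, w) \<Rightarrow> f (u, w) * (pm u w *\<^sub>v x u) $ r) = 0"
    proof
      fix p assume p: "p \<in> paths_to j - {(u, w). awalk u w j \<and> pm u w \<noteq> 0\<^sub>m (d j) (d u)}"
      obtain u w where uw: "p = (u, w)" by (cases p)
      have "pm u w = 0\<^sub>m (d j) (d u)" and "u \<in> verts G"
        using p qpaths_start_in_verts by (auto simp: uw paths_to_def awalk_iff_qpaths)
      then show "(case p of (u, w) \<Rightarrow> f (u, w) * (pm u w *\<^sub>v x u) $ r) = 0"
        using zero_mult_mat_vec_index[OF rep_carrierD[OF x] r] by (simp add: uw)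
    qed
  qed
  finally show ?thesis .
qed

lemma rep_eqI:
  assumes "y \<in> rep_carrier G d" and "z \<in> rep_carrier G d"
    and "\<And>j r. j \<in> verts G \<Longrightarrow> r < d j \<Longrightarrow> y j $ r = z j $ r"
  shows "y = z"
proof
  fix j
  show "y j = z j"
  proof (cases "j \<in> verts G")
    case True
    then show ?thesis
      using rep_carrierD[OF assms(1) True] rep_carrierD[OF assms(2) True] assms(3)
      by (intro eq_vecI) auto
  next
    case False
    then show ?thesis using assms(1,2) by (auto simp: rep_carrier_def PiE_def extensional_def)
  qed
qed

lemma rep_act_closed: "rep_act G d M f x \<in> rep_carrier G d"
  by (auto simp: rep_act_def rep_carrier_def)

lemma rep_add_closed:
  "x \<in> rep_carrier G d \<Longrightarrow> y \<in> rep_carrier G d \<Longrightarrow> (\<lambda>i\<in>verts G. x i + y i) \<in> rep_carrier G d"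
  by (auto simp: rep_carrier_def PiE_def Pi_def)

lemma rep_add_index:
  assumes "x \<in> rep_carrier G d" and "y \<in> rep_carrier G d" and j: "j \<in> verts G" and r: "r < d j"
  shows "(\<lambda>i\<in>verts G. x i + y i) j $ r = x j $ r + y j $ r"
  using rep_carrierD[OF assms(1) j] rep_carrierD[OF assms(2) j] j r by simp

lemma rep_act_add_left:
  assumes x: "x \<in> rep_carrier G d"
  shows "rep_act G d M (\<lambda>p. f p + g p) x = (\<lambda>i\<in>verts G. rep_act G d M f x i + rep_act G d M g x i)"
proof (rule rep_eqI[OF rep_act_closed rep_add_closed[OF rep_act_closed rep_act_closed]])
  fix j r assume j: "j \<in> verts G" and r: "r < d j"
  show "rep_act G d M (\<lambda>p. f p + g p) x j $ r =
      (\<lambda>i\<in>verts G. rep_act G d M f x i + rep_act G d M g x i) j $ r"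
    unfolding rep_add_index[OF rep_act_closed rep_act_closed j r] rep_act_index[OF j r x]
      sum.distrib[symmetric]
    by (rule sum.cong[OF refl]) (simp add: case_prod_beta distrib_right)
qed

lemma rep_act_add_right:
  assumes x: "x \<in> rep_carrier G d" and y: "y \<in> rep_carrier G d"
  shows "rep_act G d M f (\<lambda>i\<in>verts G. x i + y i) =
    (\<lambda>i\<in>verts G. rep_act G d M f x i + rep_act G d M f y i)"
proof (rule rep_eqI[OF rep_act_closed rep_add_closed[OF rep_act_closed rep_act_closed]])
  fix j r assume j: "j \<in> verts G" and r: "r < d j"
  have "(\<Sum>(u, w)\<in>paths_to j. f (u, w) * (pm u w *\<^sub>v (\<lambda>i\<in>verts G. x i + y i) u) $ r) =
      (\<Sum>(u, w)\<in>paths_to j. f (u, w) * (pm u w *\<^sub>v x u) $ r + f (u, w) * (pm u w *\<^sub>v y u) $ r)"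
  proof (rule sum.cong[OF refl], clarify)
    fix u w assume uw: "(u, w) \<in> paths_to j"
    then have u: "u \<in> verts G" using qpaths_start_in_verts by (auto simp: paths_to_def)
    have "pm u w *\<^sub>v (x u + y u) = pm u w *\<^sub>v x u + pm u w *\<^sub>v y u"
      by (rule mult_add_distrib_mat_vec[OF pm_carrier[OF uw] rep_carrierD[OF x u] rep_carrierD[OF y u]])
    then show "f (u, w) * (pm u w *\<^sub>v (\<lambda>i\<in>verts G. x i + y i) u) $ r =
        f (u, w) * (pm u w *\<^sub>v x u) $ r + f (u, w) * (pm u w *\<^sub>v y u) $ r"
      using u r pm_carrier[OF uw] by (simp add: distrib_left)
  qed
  also have "\<dots> = (\<Sum>(u, w)\<in>paths_to j. f (u, w) * (pm u w *\<^sub>v x u) $ r) +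
      (\<Sum>(u, w)\<in>paths_to j. f (u, w) * (pm u w *\<^sub>v y u) $ r)"
    unfolding sum.distrib[symmetric] by (rule sum.cong[OF refl]) (simp add: case_prod_beta)
  finally show "rep_act G d M f (\<lambda>i\<in>verts G. x i + y i) j $ r =
      (\<lambda>i\<in>verts G. rep_act G d M f x i + rep_act G d M f y i) j $ r"
    unfolding rep_add_index[OF rep_act_closed rep_act_closed j r] rep_act_index[OF j r x]
      rep_act_index[OF j r y] rep_act_index[OF j r rep_add_closed[OF x y]] .
qed

lemma rep_act_vertices:
  assumes x: "x \<in> rep_carrier G d" and f: "\<And>u w. w \<noteq> [] \<Longrightarrow> f (u, w) = 0"
  shows "rep_act G d M f x = (\<lambda>i\<in>verts G. f (i, []) \<cdot>\<^sub>v x i)"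
proof (rule rep_eqI[OF rep_act_closed])
  show "(\<lambda>i\<in>verts G. f (i, []) \<cdot>\<^sub>v x i) \<in> rep_carrier G d"
    using x by (auto simp: rep_carrier_def PiE_def Pi_def)
  fix j r assume j: "j \<in> verts G" and r: "r < d j"
  note xj = rep_carrierD[OF x j]
  show "rep_act G d M f x j $ r = (\<lambda>i\<in>verts G. f (i, []) \<cdot>\<^sub>v x i) j $ r"
  proof (cases "N = 0")
    case True
    \<comment> \<open>Then even the trivial paths act by zero, so there is no index \<open>r\<close>.\<close>
    then have "(1\<^sub>m (d j) :: complex mat) = 0\<^sub>m (d j) (d j)" using long_path[of j "[]"] j by simp
    then have "(1\<^sub>m (d j) :: complex mat) $$ (r, r) = 0" using r by simp
    then show ?thesis using r by simp
  next
    case False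
    then have jp: "(j, []) \<in> paths_to j" using j by (simp add: paths_to_def)
    have "rep_act G d M f x j $ r = (\<Sum>(u, w)\<in>{(j, [])}. f (u, w) * (pm u w *\<^sub>v x u) $ r)"
      unfolding rep_act_index[OF j r x]
    proof (rule sum.mono_neutral_right[OF finite_paths_to])
      show "\<forall>p\<in>paths_to j - {(j, [])}. (case p of (u, w) \<Rightarrow> f (u, w) * (pm u w *\<^sub>v x u) $ r) = 0"
      proof
        fix p assume p: "p \<in> paths_to j - {(j, [])}"
        obtain u w where uw: "p = (u, w)" by (cases p)
        have "w \<noteq> []" using p by (auto simp: uw paths_to_def)
        then show "(case p of (u, w) \<Rightarrow> f (u, w) * (pm u w *\<^sub>v x u) $ r) = 0" by (simp add: uw f)
      qed
    qed (use jp in auto)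
    then show ?thesis using j r xj by simp
  qed
qed

lemma rep_act_scalar:
  assumes x: "x \<in> rep_carrier G d"
  shows "rep_act G d M (cpa_scalar G c) x = (\<lambda>i\<in>verts G. c \<cdot>\<^sub>v x i)"
  by (subst rep_act_vertices[OF x]) (auto simp: cpa_scalar_def cpa_one)

text \<open>
  Both sides are sums over pairs of consecutive paths. A pair whose concatenation has length at
  least \<open>N\<close> acts by zero, and the remaining pairs correspond to a short path with a cut point.
\<close>

lemma rep_act_mult:
  assumes x: "x \<in> rep_carrier G d"
  shows "rep_act G d M (f \<otimes>\<^bsub>cpa G\<^esub> g) x = rep_act G d M f (rep_act G d M g x)"
proof (rule rep_eqI[OF rep_act_closed rep_act_closed])
  fix j r assume j: "j \<in> verts G" and r: "r < d j"
  define T where "T u w = (pm u w *\<^sub>v x u) $ r" for u w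
  let ?F = "\<lambda>(v, w2) (u, w1). f (v, w2) * g (u, w1) * T u (w1 @ w2)"
  let ?S = "SIGMA p:paths_to j. paths_to (fst p)"
  \<comment> \<open>The pairs whose concatenation is a short path.\<close>
  let ?S' = "{(p, q) \<in> ?S. length (snd p) + length (snd q) < N}"
  have comp: "(u, w1 @ w2) \<in> qpaths G \<and> path_end G u (w1 @ w2) = j \<and>
      pm u (w1 @ w2) = pm v w2 * pm u w1"
    if "(v, w2) \<in> paths_to j" "(u, w1) \<in> paths_to v" for u v w1 w2
    using that path_mat_append[OF M, of u w1 w2] by (auto simp: paths_to_def qpaths_append)
  have inner: "(pm v w2 *\<^sub>v rep_act G d M g x v) $ r = (\<Sum>(u, w1)\<in>paths_to v. g (u, w1) * T u (w1 @ w2))"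
    if p: "(v, w2) \<in> paths_to j" for v w2
  proof -
    have v: "v \<in> verts G" using p qpaths_start_in_verts by (auto simp: paths_to_def)
    note P = pm_carrier[OF p]
    note y = rep_carrierD[OF rep_act_closed v, of g x]
    have "(pm v w2 *\<^sub>v rep_act G d M g x v) $ r = (\<Sum>s<d v. pm v w2 $$ (r, s) * rep_act G d M g x v $ s)"
      using P y r by (simp add: scalar_prod_def atLeast0LessThan)
    also have "\<dots> = (\<Sum>s<d v. \<Sum>q\<in>paths_to v. g q * (pm v w2 $$ (r, s) * (pm (fst q) (snd q) *\<^sub>v x (fst q)) $ s))"
      by (rule sum.cong[OF refl]) (simp add: rep_act_index[OF v _ x] sum_distrib_left case_prod_beta mult_ac)
    also have "\<dots> = (\<Sum>q\<in>paths_to v. g q * (\<Sum>s<d v. pm v w2 $$ (r, s) * (pm (fst q) (snd q) *\<^sub>v x (fst q)) $ s))"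
      by (subst sum.swap) (simp add: sum_distrib_left)
    also have "\<dots> = (\<Sum>q\<in>paths_to v. g q * T (fst q) (snd q @ w2))"
    proof (rule sum.cong[OF refl])
      fix q assume q: "q \<in> paths_to v"
      obtain u w1 where uw: "q = (u, w1)" by (cases q)
      have u: "u \<in> verts G" using q uw qpaths_start_in_verts by (auto simp: paths_to_def)
      have Q: "pm u w1 \<in> carrier_mat (d v) (d u)" using pm_carrier q uw by blast
      have "(\<Sum>s<d v. pm v w2 $$ (r, s) * (pm u w1 *\<^sub>v x u) $ s) = (pm v w2 *\<^sub>v (pm u w1 *\<^sub>v x u)) $ r"
        using P Q r by (simp add: scalar_prod_def atLeast0LessThan)
      also have "\<dots> = T u (w1 @ w2)"
        using comp[OF p, of u w1] q uw assoc_mult_mat_vec[OF P Q rep_carrierD[OF x u]]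
        by (simp add: T_def)
      finally show "g q * (\<Sum>s<d v. pm v w2 $$ (r, s) * (pm (fst q) (snd q) *\<^sub>v x (fst q)) $ s) =
          g q * T (fst q) (snd q @ w2)" by (simp add: uw)
    qed
    finally show ?thesis by (simp add: case_prod_beta)
  qed
  have fin: "finite ?S" using finite_paths_to by auto
  have "rep_act G d M f (rep_act G d M g x) j $ r =
      (\<Sum>p\<in>paths_to j. \<Sum>q\<in>paths_to (fst p). ?F p q)"
    unfolding rep_act_index[OF j r rep_act_closed]
    by (rule sum.cong[OF refl]) (auto simp: inner sum_distrib_left case_prod_beta mult_ac)
  also have "\<dots> = (\<Sum>(p, q)\<in>?S. ?F p q)"
    by (rule sum.Sigma) (auto simp: finite_paths_to)
  also have "\<dots> = (\<Sum>(p, q)\<in>?S'. ?F p q)"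
  proof (rule sum.mono_neutral_right[OF fin])
    have "T u (w1 @ w2) = 0"
      if "(v, w2) \<in> paths_to j" "(u, w1) \<in> paths_to v" "N \<le> length w2 + length w1" for u v w1 w2
    proof -
      have "u \<in> verts G" using that(2) qpaths_start_in_verts by (auto simp: paths_to_def)
      then show ?thesis
        using comp[OF that(1,2)] long_path[of u "w1 @ w2"] that(3)
          zero_mult_mat_vec_index[OF rep_carrierD[OF x] r] by (simp add: T_def)
    qed
    then have short: "length w2 + length w1 < N"
      if "(v, w2) \<in> paths_to j" "(u, w1) \<in> paths_to v" "T u (w1 @ w2) \<noteq> 0" for u v w1 w2
      using that not_less by blast
    show "\<forall>i\<in>?S - ?S'. (case i of (p, q) \<Rightarrow> ?F p q) = 0" by (auto dest: short)
  qed auto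
  also have "\<dots> = (\<Sum>((u, w), k)\<in>(SIGMA p:paths_to j. {..length (snd p)}).
      f (path_end G u (take k w), drop k w) * g (u, take k w) * T u w)"
  proof (rule sum.reindex_bij_witness[of _
        "\<lambda>((u, w), k). ((path_end G u (take k w), drop k w), (u, take k w))"
        "\<lambda>((v, w2), (u, w1)). ((u, w1 @ w2), length w1)"], goal_cases)
    case (1 a)
    then show ?case by (auto simp: paths_to_def)
  next
    case (2 a)
    then show ?case using comp by (auto simp: paths_to_def)
  next
    case (3 b)
    then show ?case by (auto simp: paths_to_def)
  next
    case (4 b)
    then obtain u w k where b: "b = ((u, w), k)" "(u, w) \<in> paths_to j" "k \<le> length w" by auto
    have "path_end G (path_end G u (take k w)) (drop k w) = path_end G u w"
      using path_end_append[of G u "take k w" "drop k w"] by simp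
    then show ?case
      using b qpaths_split[of u w k] by (auto simp: paths_to_def)
  next
    case (5 a)
    then show ?case by (auto simp: paths_to_def)
  qed
  also have "\<dots> = (\<Sum>p\<in>paths_to j. \<Sum>k\<le>length (snd p).
      f (path_end G (fst p) (take k (snd p)), drop k (snd p)) * g (fst p, take k (snd p)) * T (fst p) (snd p))"
    by (subst sum.Sigma) (auto simp: finite_paths_to case_prod_beta)
  also have "\<dots> = rep_act G d M (f \<otimes>\<^bsub>cpa G\<^esub> g) x j $ r"
    unfolding rep_act_index[OF j r x]
    by (rule sum.cong[OF refl]) (auto simp: cpa_mult sum_distrib_right T_def)
  finally show "rep_act G d M (f \<otimes>\<^bsub>cpa G\<^esub> g) x j $ r = rep_act G d M f (rep_act G d M g x) j $ r" ..
qed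

end

text \<open>
  Well-definedness of the action of cosets is contained in the assumption on \<open>smult\<close>.
\<close>

lemma left_module_quotient:
  fixes A :: "('f, 'z) ring_scheme" and M :: "('f set, 'x) module"
  assumes J: "ideal J A" and M: "abelian_group M"
    and closed: "\<And>f x. f \<in> carrier A \<Longrightarrow> x \<in> carrier M \<Longrightarrow> act f x \<in> carrier M"
    and add_left: "\<And>f g x. f \<in> carrier A \<Longrightarrow> g \<in> carrier A \<Longrightarrow> x \<in> carrier M \<Longrightarrow>
      act (f \<oplus>\<^bsub>A\<^esub> g) x = act f x \<oplus>\<^bsub>M\<^esub> act g x"
    and add_right: "\<And>f x y. f \<in> carrier A \<Longrightarrow> x \<in> carrier M \<Longrightarrow> y \<in> carrier M \<Longrightarrow>
      act f (x \<oplus>\<^bsub>M\<^esub> y) = act f x \<oplus>\<^bsub>M\<^esub> act f y"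
    and mult: "\<And>f g x. f \<in> carrier A \<Longrightarrow> g \<in> carrier A \<Longrightarrow> x \<in> carrier M \<Longrightarrow>
      act (f \<otimes>\<^bsub>A\<^esub> g) x = act f (act g x)"
    and one: "\<And>x. x \<in> carrier M \<Longrightarrow> act \<one>\<^bsub>A\<^esub> x = x"
    and smult: "\<And>f x. f \<in> carrier A \<Longrightarrow> x \<in> carrier M \<Longrightarrow> (J +>\<^bsub>A\<^esub> f) \<odot>\<^bsub>M\<^esub> x = act f x"
  shows "left_module (A Quot J) M"
proof -
  interpret J: ideal J A by (rule J)
  interpret M: abelian_group M by (rule M)
  have car: "carrier (A Quot J) = (\<lambda>f. J +>\<^bsub>A\<^esub> f) ` carrier A"
    by (auto simp: FactRing_def A_RCOSETS_def')
  have ops: "(J +>\<^bsub>A\<^esub> f) \<oplus>\<^bsub>A Quot J\<^esub> (J +>\<^bsub>A\<^esub> g) = J +>\<^bsub>A\<^esub> (f \<oplus>\<^bsub>A\<^esub> g)"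
    "(J +>\<^bsub>A\<^esub> f) \<otimes>\<^bsub>A Quot J\<^esub> (J +>\<^bsub>A\<^esub> g) = J +>\<^bsub>A\<^esub> (f \<otimes>\<^bsub>A\<^esub> g)"
    if "f \<in> carrier A" "g \<in> carrier A" for f g
    using that J.a_rcos_sum J.rcoset_mult_add by (simp_all add: FactRing_def)
  have "\<one>\<^bsub>A Quot J\<^esub> = J +>\<^bsub>A\<^esub> \<one>\<^bsub>A\<^esub>" by (simp add: FactRing_def)
  then show ?thesis
    by (intro left_module.intro J.quotient_is_ring M)
      (auto simp: car ops smult closed add_left add_right mult one)
qed

lemma (in wf_digraph) cpa_scalar_mult:
  assumes f: "f \<in> carrier (cpa G)"
  shows "cpa_scalar G c \<otimes>\<^bsub>cpa G\<^esub> f = (\<lambda>p. c * f p)" and "f \<otimes>\<^bsub>cpa G\<^esub> cpa_scalar G c = (\<lambda>p. c * f p)"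
proof -
  interpret A: ring "cpa G" by (rule ring_cpa)
  have "(cpa_scalar G c \<otimes>\<^bsub>cpa G\<^esub> f) p = c * (\<one>\<^bsub>cpa G\<^esub> \<otimes>\<^bsub>cpa G\<^esub> f) p" for p
    by (cases p) (simp add: cpa_mult cpa_scalar_def sum_distrib_left mult_ac)
  then show "cpa_scalar G c \<otimes>\<^bsub>cpa G\<^esub> f = (\<lambda>p. c * f p)" using A.l_one[OF f] by auto
  have "(f \<otimes>\<^bsub>cpa G\<^esub> cpa_scalar G c) p = c * (f \<otimes>\<^bsub>cpa G\<^esub> \<one>\<^bsub>cpa G\<^esub>) p" for p
    by (cases p) (simp add: cpa_mult cpa_scalar_def sum_distrib_left mult_ac)
  then show "f \<otimes>\<^bsub>cpa G\<^esub> cpa_scalar G c = (\<lambda>p. c * f p)" using A.r_one[OF f] by auto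
qed

lemma (in wf_digraph) cpa_scalar_closed: "cpa_scalar G c \<in> carrier (cpa G)"
  by (auto simp: cpa_scalar_def cpa_one)

lemma (in wf_digraph) complex_algebra_cpa_Quot:
  assumes J: "ideal J (cpa G)"
  shows "complex_algebra (cpa G Quot J) (\<lambda>c. J +>\<^bsub>cpa G\<^esub> cpa_scalar G c)"
proof -
  interpret J: ideal J "cpa G" by (rule J)
  have car: "carrier (cpa G Quot J) = (\<lambda>f. J +>\<^bsub>cpa G\<^esub> f) ` carrier (cpa G)"
    by (auto simp: FactRing_def A_RCOSETS_def')
  have mult: "cpa_scalar G (a * b) = cpa_scalar G a \<otimes>\<^bsub>cpa G\<^esub> cpa_scalar G b" for a b
    unfolding cpa_scalar_mult(1)[OF cpa_scalar_closed] by (simp add: cpa_scalar_def mult_ac)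
  have add: "cpa_scalar G (a + b) = cpa_scalar G a \<oplus>\<^bsub>cpa G\<^esub> cpa_scalar G b" for a b
    by (simp add: cpa_scalar_def distrib_right)
  have one: "cpa_scalar G 1 = \<one>\<^bsub>cpa G\<^esub>" by (simp add: cpa_scalar_def)
  show ?thesis
  proof (intro complex_algebra.intro J.quotient_is_ring)
    show "J +>\<^bsub>cpa G\<^esub> cpa_scalar G c \<in> carrier (cpa G Quot J)" for c
      using cpa_scalar_closed by (auto simp only: car)
    show "J +>\<^bsub>cpa G\<^esub> cpa_scalar G (a + b) = (J +>\<^bsub>cpa G\<^esub> cpa_scalar G a) \<oplus>\<^bsub>cpa G Quot J\<^esub> (J +>\<^bsub>cpa G\<^esub> cpa_scalar G b)" for a b
      unfolding add by (simp only: FactRing_def ring.simps J.a_rcos_sum[OF cpa_scalar_closed cpa_scalar_closed])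
    show "J +>\<^bsub>cpa G\<^esub> cpa_scalar G (a * b) = (J +>\<^bsub>cpa G\<^esub> cpa_scalar G a) \<otimes>\<^bsub>cpa G Quot J\<^esub> (J +>\<^bsub>cpa G\<^esub> cpa_scalar G b)" for a b
      unfolding mult by (simp only: FactRing_def monoid.simps J.rcoset_mult_add[OF cpa_scalar_closed cpa_scalar_closed])
    show "J +>\<^bsub>cpa G\<^esub> cpa_scalar G 1 = \<one>\<^bsub>cpa G Quot J\<^esub>"
      unfolding one by (simp only: FactRing_def monoid.simps)
    fix c r assume "r \<in> carrier (cpa G Quot J)"
    then obtain f where f: "f \<in> carrier (cpa G)" "r = J +>\<^bsub>cpa G\<^esub> f" unfolding car by blast
    show "(J +>\<^bsub>cpa G\<^esub> cpa_scalar G c) \<otimes>\<^bsub>cpa G Quot J\<^esub> r = r \<otimes>\<^bsub>cpa G Quot J\<^esub> (J +>\<^bsub>cpa G\<^esub> cpa_scalar G c)"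
      unfolding f(2) FactRing_def monoid.simps
      by (simp only: J.rcoset_mult_add[OF cpa_scalar_closed f(1)] J.rcoset_mult_add[OF f(1) cpa_scalar_closed]
          cpa_scalar_mult[OF f(1)])
  qed
qed

section \<open>A uniform bound for nilpotency\<close>

text \<open>
  The complex vector space underlying all representations with dimension vector \<open>d\<close>.
\<close>

definition rep_space :: "('v, 'a) pre_digraph \<Rightarrow> ('v \<Rightarrow> nat) \<Rightarrow> (complex, 'v \<Rightarrow> complex vec) module" where
  "rep_space G d =
    \<lparr>carrier = rep_carrier G d, mult = undefined, one = undefined,
     zero = (\<lambda>i\<in>verts G. 0\<^sub>v (d i)), add = (\<lambda>x y. \<lambda>i\<in>verts G. x i + y i),
     smult = (\<lambda>c x. \<lambda>i\<in>verts G. c \<cdot>\<^sub>v x i)\<rparr>"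

lemma rep_space_simps:
  "carrier (rep_space G d) = rep_carrier G d"
  "\<zero>\<^bsub>rep_space G d\<^esub> = (\<lambda>i\<in>verts G. 0\<^sub>v (d i))"
  "x \<oplus>\<^bsub>rep_space G d\<^esub> y = (\<lambda>i\<in>verts G. x i + y i)"
  "c \<odot>\<^bsub>rep_space G d\<^esub> x = (\<lambda>i\<in>verts G. c \<cdot>\<^sub>v x i)"
  by (simp_all add: rep_space_def)

lemma vectorspace_rep_space: "vectorspace class_ring (rep_space G d)"
proof (rule vs_criteria[OF field_class_ring], goal_cases)
  case 3
  show ?case
    by (intro ballI bexI[of _ "\<lambda>i\<in>verts G. - _ i"])
      (auto simp: rep_space_simps rep_carrier_def PiE_def Pi_def fun_eq_iff)
qed (auto simp: rep_space_simps rep_carrier_def PiE_def Pi_def fun_eq_iff restrict_def extensional_def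
    comm_add_vec assoc_add_vec smult_add_distrib_vec add_smult_distrib_vec smult_smult_assoc)

lemma fin_dim_rep_space:
  assumes "finite (verts G)"
  shows "vectorspace.fin_dim class_ring (rep_space G d)"
proof (rule vectorspace_complex_functionals(1)[OF vectorspace_rep_space,
      where Z = "SIGMA i:verts G. {..<d i}" and \<phi> = "\<lambda>(i, s) x. x i $ s"])
  fix x assume x: "x \<in> carrier (rep_space G d)"
    and 0: "\<And>i. i \<in> (SIGMA i:verts G. {..<d i}) \<Longrightarrow> (case i of (i, s) \<Rightarrow> \<lambda>x. x i $ s) x = 0"
  have "x i = 0\<^sub>v (d i)" if "i \<in> verts G" for i
  proof (rule eq_vecI)
    have "x i \<in> carrier_vec (d i)" using x that by (auto simp: rep_space_simps rep_carrier_def)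
    then show "dim_vec (x i) = dim_vec (0\<^sub>v (d i))" by simp
    show "x i $ s = 0\<^sub>v (d i) $ s" if "s < dim_vec (0\<^sub>v (d i))" for s
      using 0[of "(i, s)"] that \<open>i \<in> verts G\<close> by simp
  qed
  then show "x = \<zero>\<^bsub>rep_space G d\<^esub>"
    using x by (auto simp: rep_space_simps rep_carrier_def PiE_def extensional_def fun_eq_iff)
qed (use assms in \<open>auto simp: rep_space_simps rep_carrier_def PiE_def Pi_def\<close>)

lemma mult_mat_zero_vec:
  fixes A :: "'b::comm_ring_1 mat"
  shows "A \<in> carrier_mat m n \<Longrightarrow> A *\<^sub>v 0\<^sub>v n = 0\<^sub>v m"
  by (intro eq_vecI) auto

context fin_digraph
begin

context
  fixes d :: "'a \<Rightarrow> nat" and M :: "'b rep"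
  assumes M: "M \<in> mat_space G d"
begin

text \<open>
  The elements killed by all paths of length \<open>j\<close>. For \<open>j = 0, 1, ...\<close> they form a chain of
  subspaces which starts at zero and, for a nilpotent representation, reaches the whole space.
\<close>

definition killed_after :: "nat \<Rightarrow> ('a \<Rightarrow> complex vec) set" where
  "killed_after j = {x \<in> rep_carrier G d. \<forall>u w. (u, w) \<in> qpaths G \<and> length w = j \<longrightarrow>
    path_mat G d M u w *\<^sub>v x u = 0\<^sub>v (d (path_end G u w))}"

lemma killed_after_mono: "killed_after j \<subseteq> killed_after (Suc j)"
proof
  fix x assume x: "x \<in> killed_after j"
  then have xc: "x \<in> rep_carrier G d" by (simp add: killed_after_def)
  show "x \<in> killed_after (Suc j)"
    unfolding killed_after_def
  proof (intro CollectI conjI allI impI xc)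
    fix u w assume w: "(u, w) \<in> qpaths G \<and> length w = Suc j"
    let ?w = "take j w" and ?v = "path_end G u (take j w)"
    have q: "(u, ?w) \<in> qpaths G" "(?v, drop j w) \<in> qpaths G"
      using w qpaths_split[of u w j] by auto
    have "path_mat G d M u w = path_mat G d M ?v (drop j w) * path_mat G d M u ?w"
      using path_mat_append[OF M, of u ?w "drop j w"] w by simp
    moreover have "path_mat G d M u ?w *\<^sub>v x u = 0\<^sub>v (d ?v)"
      using x w q by (auto simp: killed_after_def)
    moreover have "path_end G ?v (drop j w) = path_end G u w"
      using path_end_append[of G u "take j w" "drop j w"] by simp
    moreover have "x u \<in> carrier_vec (d u)" using xc q qpaths_start_in_verts by (auto simp: rep_carrier_def)
    ultimately show "path_mat G d M u w *\<^sub>v x u = 0\<^sub>v (d (path_end G u w))"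
      using path_mat_carrier[OF M q(1)] path_mat_carrier[OF M q(2)]
      by (simp add: assoc_mult_mat_vec mult_mat_zero_vec)
  qed
qed

text \<open>
  An element is killed by the paths of length \<open>j + 2\<close> if and only if its images under all arrows
  are killed by the paths of length \<open>j + 1\<close>.
\<close>

lemma killed_after_stable:
  assumes eq: "killed_after j = killed_after (Suc j)"
  shows "killed_after (Suc j) = killed_after (Suc (Suc j))"
proof
  show "killed_after (Suc (Suc j)) \<subseteq> killed_after (Suc j)"
  proof
    fix x assume x: "x \<in> killed_after (Suc (Suc j))"
    then have xc: "x \<in> rep_carrier G d" by (simp add: killed_after_def)
    show "x \<in> killed_after (Suc j)"
      unfolding killed_after_def
    proof (intro CollectI conjI allI impI xc)
      fix u w' assume w': "(u, w') \<in> qpaths G \<and> length w' = Suc j"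
      then obtain a w where w: "w' = a # w" "length w = j" by (cases w') auto
      then have a: "a \<in> arcs G" "tail G a = u" "(head G a, w) \<in> qpaths G"
        using w' by (auto simp: qpaths_Cons)
      have Ma: "M a \<in> carrier_mat (d (head G a)) (d u)"
        using M a by (auto simp: mat_space_def PiE_def Pi_def)
      have xu: "x u \<in> carrier_vec (d u)" using xc a by (auto simp: rep_carrier_def)
      \<comment> \<open>The image of \<open>x\<close> under the arrow \<open>a\<close>.\<close>
      let ?y = "\<lambda>i\<in>verts G. if i = head G a then M a *\<^sub>v x u else 0\<^sub>v (d i)"
      have yc: "?y \<in> rep_carrier G d" using Ma xu by (auto simp: rep_carrier_def)
      have "?y \<in> killed_after (Suc j)"
        unfolding killed_after_def
      proof (intro CollectI conjI allI impI yc)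
        fix i v assume v: "(i, v) \<in> qpaths G \<and> length v = Suc j"
        have i: "i \<in> verts G" using v qpaths_start_in_verts by blast
        have P: "path_mat G d M i v \<in> carrier_mat (d (path_end G i v)) (d i)"
          using path_mat_carrier[OF M] v by blast
        show "path_mat G d M i v *\<^sub>v ?y i = 0\<^sub>v (d (path_end G i v))"
        proof (cases "i = head G a")
          case True
          have "(u, a # v) \<in> qpaths G" "length (a # v) = Suc (Suc j)"
            using v a True by (auto simp: qpaths_Cons)
          then have "path_mat G d M u (a # v) *\<^sub>v x u = 0\<^sub>v (d (path_end G u (a # v)))"
            using x unfolding killed_after_def by blast
          then show ?thesis using True i P Ma xu by (simp add: assoc_mult_mat_vec)
        next
          case False
          then show ?thesis using i P by (simp add: mult_mat_zero_vec)
        qed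
      qed
      then have "?y \<in> killed_after j" using eq by simp
      then have "path_mat G d M (head G a) w *\<^sub>v ?y (head G a) = 0\<^sub>v (d (path_end G (head G a) w))"
        using a(3) w(2) unfolding killed_after_def by blast
      then show "path_mat G d M u w' *\<^sub>v x u = 0\<^sub>v (d (path_end G u w'))"
        using w(1) Ma xu a path_mat_carrier[OF M a(3)] by (simp add: assoc_mult_mat_vec)
    qed
  qed
qed (rule killed_after_mono)

lemma subspace_killed_after: "subspace class_ring (killed_after j) (rep_space G d)"
proof -
  have car: "path_mat G d M u w \<in> carrier_mat (d (path_end G u w)) (d u)" "u \<in> verts G"
    if "(u, w) \<in> qpaths G" for u w
    using that path_mat_carrier[OF M] qpaths_start_in_verts by auto
  have "submodule class_ring (killed_after j) (rep_space G d)"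
  proof (rule submodule.intro)
    show "module class_ring (rep_space G d)"
      using vectorspace_rep_space[of G d] by (simp add: vectorspace_def)
    show "killed_after j \<subseteq> carrier (rep_space G d)"
      by (auto simp: killed_after_def rep_space_simps)
    show "\<zero>\<^bsub>rep_space G d\<^esub> \<in> killed_after j"
      using car mult_mat_zero_vec[OF car(1)] by (auto simp: killed_after_def rep_space_simps rep_carrier_def)
  next
    fix c :: complex and x assume x: "x \<in> killed_after j"
    have xv: "x u \<in> carrier_vec (d u)" if "u \<in> verts G" for u
      using x that by (auto simp: killed_after_def rep_carrier_def)
    show "c \<odot>\<^bsub>rep_space G d\<^esub> x \<in> killed_after j"
    proof -
      have "path_mat G d M u w *\<^sub>v (c \<cdot>\<^sub>v x u) = 0\<^sub>v (d (path_end G u w))"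
        if "(u, w) \<in> qpaths G" "length w = j" for u w
        using that x mult_mat_vec[OF car(1) xv, of u w c] car(2)[OF that(1)]
        by (auto simp: killed_after_def)
      then show ?thesis
        using xv car(2) by (auto simp: killed_after_def rep_space_simps rep_carrier_def)
    qed
  next
    fix x y assume x: "x \<in> killed_after j" and y: "y \<in> killed_after j"
    have xv: "x u \<in> carrier_vec (d u)" if "u \<in> verts G" for u
      using x that by (auto simp: killed_after_def rep_carrier_def)
    have yv: "y u \<in> carrier_vec (d u)" if "u \<in> verts G" for u
      using y that by (auto simp: killed_after_def rep_carrier_def)
    have "path_mat G d M u w *\<^sub>v (x u + y u) = 0\<^sub>v (d (path_end G u w))"
      if "(u, w) \<in> qpaths G" "length w = j" for u w
      using that x y mult_add_distrib_mat_vec[OF car(1) xv yv, of u w] car(2)[OF that(1)]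
      by (auto simp: killed_after_def)
    then show "x \<oplus>\<^bsub>rep_space G d\<^esub> y \<in> killed_after j"
      using xv yv car(2) by (auto simp: killed_after_def rep_space_simps rep_carrier_def)
  qed
  then show ?thesis using vectorspace_rep_space by (simp add: subspace_def)
qed

end

text \<open>
  The chain of the subspaces \<open>killed_after j\<close> is strictly increasing until it becomes stationary, so
  it is stationary from an index not above the dimension on. The bound is the same for all
  nilpotent representations with the given dimension vector.
\<close>

lemma nilpotent_rep_uniform:
  assumes M: "M \<in> mat_space G d" and nil: "nilpotent_rep G d M"
  shows "nilpotent_representation G d M (vectorspace.dim class_ring (rep_space G d))"
proof
  let ?D = "vectorspace.dim class_ring (rep_space G d)"
  let ?U = "killed_after d M"
  show "M \<in> mat_space G d" by (rule M)
  have "\<exists>j\<le>?D. ?U j = ?U (Suc j)"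
  proof (rule ccontr)
    assume "\<not> ?thesis"
    then have "Suc ?D \<le> ?D"
      by (intro vectorspace.strict_chain_length_le_dim[OF vectorspace_rep_space, where U = ?U] fin_dim_rep_space
            subspace_killed_after[OF M] killed_after_mono[OF M]) auto
    then show False by simp
  qed
  then obtain j where j: "j \<le> ?D" "?U j = ?U (Suc j)" by (elim exE conjE)
  have stable: "?U (j + i) = ?U (Suc (j + i))" for i
  proof (induction i)
    case 0
    show ?case using j(2) by (simp only: add_0_right)
  next
    case (Suc i)
    show ?case using killed_after_stable[OF M Suc] by (simp only: add_Suc_right)
  qed
  have const: "?U (j + i) = ?U j" for i
  proof (induction i)
    case (Suc i)
    show ?case using trans[OF stable[symmetric] Suc] by (simp only: add_Suc_right)
  qed simp
  obtain N where N: "\<And>u w. (u, w) \<in> qpaths G \<Longrightarrow> N \<le> length w \<Longrightarrow>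
      path_mat G d M u w = 0\<^sub>m (d (path_end G u w)) (d u)"
    using nil unfolding nilpotent_rep_def by blast
  have all: "?U i = rep_carrier G d" if "j \<le> i" for i
  proof -
    have "rep_carrier G d \<subseteq> ?U (j + N)"
    proof
      fix x assume x: "x \<in> rep_carrier G d"
      have "path_mat G d M u w *\<^sub>v x u = 0\<^sub>v (d (path_end G u w))"
        if uw: "(u, w) \<in> qpaths G" "length w = j + N" for u w
      proof -
        have "x u \<in> carrier_vec (d u)"
          using x qpaths_start_in_verts[OF uw(1)] by (auto simp: rep_carrier_def)
        from zero_mult_mat_vec_index[OF this] show ?thesis
          using N[OF uw(1)] uw(2) by (intro eq_vecI) simp_all
      qed
      then show "x \<in> ?U (j + N)" using x by (simp add: killed_after_def[OF M])
    qed
    then have "rep_carrier G d \<subseteq> ?U i" using const[of N] const[of "i - j"] that by simp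
    then show ?thesis by (auto simp: killed_after_def[OF M])
  qed
  fix u w assume uw: "(u, w) \<in> qpaths G" and len: "?D \<le> length w"
  have P: "path_mat G d M u w \<in> carrier_mat (d (path_end G u w)) (d u)"
    by (rule path_mat_carrier[OF M uw])
  show "path_mat G d M u w = 0\<^sub>m (d (path_end G u w)) (d u)"
  proof (rule eq_matI)
    fix r s assume rs: "r < dim_row (0\<^sub>m (d (path_end G u w)) (d u))" "s < dim_col (0\<^sub>m (d (path_end G u w)) (d u))"
    let ?x = "\<lambda>i\<in>verts G. if i = u then unit_vec (d u) s else 0\<^sub>v (d i)"
    have "?x \<in> ?U (length w)" using all[of "length w"] j len by (auto simp: rep_carrier_def)
    then have "path_mat G d M u w *\<^sub>v ?x u = 0\<^sub>v (d (path_end G u w))"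
      using uw by (simp add: killed_after_def[OF M])
    then have "(path_mat G d M u w *\<^sub>v unit_vec (d u) s) $ r = 0"
      using rs qpaths_start_in_verts[OF uw] by simp
    then show "path_mat G d M u w $$ (r, s) = 0\<^sub>m (d (path_end G u w)) (d u) $$ (r, s)"
      using P rs by simp
  qed (use P in auto)
qed

end

section \<open>The simple module and the inflated representation\<close>

definition simple_vector :: "('v, 'a) pre_digraph \<Rightarrow> 'v \<Rightarrow> 'v \<Rightarrow> complex vec" where
  "simple_vector G k = (\<lambda>j\<in>verts G. vec (if j = k then 1 else 0) (\<lambda>_. 1))"

abbreviation simple_dim :: "'v \<Rightarrow> 'v \<Rightarrow> nat" where
  "simple_dim k \<equiv> (\<lambda>j. if j = k then 1 else 0)"

abbreviation zero_rep :: "('v, 'a) pre_digraph \<Rightarrow> ('v \<Rightarrow> nat) \<Rightarrow> 'a rep" where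
  "zero_rep G d \<equiv> (\<lambda>a\<in>arcs G. 0\<^sub>m (d (head G a)) (d (tail G a)))"

lemma (in fin_digraph) nilpotent_zero_rep: "nilpotent_representation G d (zero_rep G d) 1"
proof
  show M: "zero_rep G d \<in> mat_space G d" by (auto simp: mat_space_def)
  fix u w assume uw: "(u, w) \<in> qpaths G" and "1 \<le> length w"
  then obtain a w' where w: "w = a # w'" by (cases w) auto
  then have a: "a \<in> arcs G" "tail G a = u" "(head G a, w') \<in> qpaths G"
    using uw by (auto simp: qpaths_Cons)
  then show "path_mat G d (zero_rep G d) u w = 0\<^sub>m (d (path_end G u w)) (d u)"
    using path_mat_carrier[OF M a(3)] by (simp add: w)
qed

lemma the_elem_image_const:
  assumes "x \<in> A" and "\<And>y. y \<in> A \<Longrightarrow> f y = c"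
  shows "the_elem (f ` A) = c"
proof -
  have "f ` A = {c}" using assms by auto
  then show ?thesis by simp
qed

locale admissible_quotient = fin_digraph G for G :: "('v, 'a) pre_digraph" +
  fixes J :: "('v \<times> 'a list \<Rightarrow> complex) set"
  assumes J: "ideal J (cpa G)" and J_arrow: "J \<subseteq> arrow_ideal G"
begin

sublocale A: ring "cpa G" by (rule ring_cpa)
sublocale J: ideal J "cpa G" by (rule J)

abbreviation R where "R \<equiv> cpa G Quot J"
abbreviation \<iota> where "\<iota> \<equiv> (\<lambda>c. J +>\<^bsub>cpa G\<^esub> cpa_scalar G c)"
abbreviation cls where "cls f \<equiv> J +>\<^bsub>cpa G\<^esub> f"

lemma carrier_R: "carrier R = cls ` carrier (cpa G)"
  by (auto simp: FactRing_def A_RCOSETS_def')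

lemma cls_closed: "f \<in> carrier (cpa G) \<Longrightarrow> cls f \<in> carrier R"
  unfolding carrier_R by (rule imageI)

lemma cls_add: "f \<in> carrier (cpa G) \<Longrightarrow> g \<in> carrier (cpa G) \<Longrightarrow>
    cls f \<oplus>\<^bsub>R\<^esub> cls g = cls (f \<oplus>\<^bsub>cpa G\<^esub> g)"
  by (simp only: FactRing_def ring.simps J.a_rcos_sum)

lemma cls_mult: "f \<in> carrier (cpa G) \<Longrightarrow> g \<in> carrier (cpa G) \<Longrightarrow>
    cls f \<otimes>\<^bsub>R\<^esub> cls g = cls (f \<otimes>\<^bsub>cpa G\<^esub> g)"
  by (simp only: FactRing_def monoid.simps J.rcoset_mult_add)

lemma cls_eqD:
  assumes f: "f \<in> carrier (cpa G)" and g: "g \<in> carrier (cpa G)" and eq: "cls f = cls g"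
  shows "\<exists>h\<in>J. f = h \<oplus>\<^bsub>cpa G\<^esub> g"
proof -
  have "f \<in> cls f" by (rule J.a_rcos_self[OF f])
  then have "f \<in> cls g" using eq by (simp only:)
  then show ?thesis unfolding a_r_coset_def r_coset_def by auto
qed

lemma cls_J: "f \<in> J \<Longrightarrow> cls f = \<zero>\<^bsub>R\<^esub>"
  using A.a_coset_join2[OF _ J.a_subgroup, of f] J.a_Hcarr[of f] by (simp add: FactRing_def)

lemma J_zero: "f \<in> J \<Longrightarrow> u \<in> verts G \<Longrightarrow> f (u, []) = 0"
  using J_arrow by (auto simp: arrow_ideal_def)

text \<open>
  An action that is constant on cosets of \<open>J\<close> is what \<open>the_elem\<close> extracts from the coset.
\<close>

lemma coset_action:
  assumes f: "f \<in> carrier (cpa G)"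
    and add: "\<And>h. h \<in> J \<Longrightarrow> act (h \<oplus>\<^bsub>cpa G\<^esub> f) = act f"
  shows "the_elem (act ` cls f) = act f"
proof (rule the_elem_image_const[where x = f])
  show "f \<in> cls f" by (rule J.a_rcos_self[OF f])
  fix g assume "g \<in> cls f"
  then obtain h where "h \<in> J" "g = h \<oplus>\<^bsub>cpa G\<^esub> f" unfolding a_r_coset_def r_coset_def by auto
  then show "act g = act f" using add by simp
qed

lemma complex_algebra_R: "complex_algebra R \<iota>"
  by (rule complex_algebra_cpa_Quot[OF J])

context
  fixes k assumes k: "k \<in> verts G"
begin

text \<open>
  On the simple module at \<open>k\<close> only the trivial path at \<open>k\<close> acts.
\<close>

lemma simple_act:
  assumes x: "x \<in> rep_carrier G (simple_dim k)"
  shows "rep_act G (simple_dim k) (zero_rep G (simple_dim k)) f x = (\<lambda>j\<in>verts G. f (k, []) \<cdot>\<^sub>v x j)"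
proof -
  interpret S: nilpotent_representation G "simple_dim k" "zero_rep G (simple_dim k)" 1
    by (rule nilpotent_zero_rep)
  have xj: "x j \<in> carrier_vec (simple_dim k j)" if "j \<in> verts G" for j
    by (rule S.rep_carrierD[OF x that])
  show ?thesis
  proof (rule S.rep_eqI[OF S.rep_act_closed])
    show "(\<lambda>j\<in>verts G. f (k, []) \<cdot>\<^sub>v x j) \<in> rep_carrier G (simple_dim k)"
      using xj by (auto simp: rep_carrier_def)
    fix j r assume j: "j \<in> verts G" and r: "r < simple_dim k j"
    then have jk: "j = k" "r = 0" by (auto split: if_splits)
    have "S.paths_to k = {(k, [])}" unfolding S.paths_to_def using k by auto
    then show "rep_act G (simple_dim k) (zero_rep G (simple_dim k)) f x j $ r =
        (\<lambda>j\<in>verts G. f (k, []) \<cdot>\<^sub>v x j) j $ r"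
      unfolding S.rep_act_index[OF j r x] using jk k xj[OF k] by simp
  qed
qed

lemma simple_smult:
  assumes f: "f \<in> carrier (cpa G)" and x: "x \<in> rep_carrier G (simple_dim k)"
  shows "cls f \<odot>\<^bsub>simple_module G k\<^esub> x = (\<lambda>j\<in>verts G. f (k, []) \<cdot>\<^sub>v x j)"
proof -
  have "the_elem ((\<lambda>f. rep_act G (simple_dim k) (zero_rep G (simple_dim k)) f x) ` cls f) =
      rep_act G (simple_dim k) (zero_rep G (simple_dim k)) f x"
    by (rule coset_action[OF f]) (simp add: simple_act[OF x] J_zero k)
  then show ?thesis by (simp add: simple_module_def Let_def rep_module_def simple_act[OF x])
qed

lemma simple_carrier: "carrier (simple_module G k) = rep_carrier G (simple_dim k)"
  by (simp add: simple_module_def Let_def rep_module_def)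

lemma left_module_simple: "left_module R (simple_module G k)"
proof -
  interpret S: nilpotent_representation G "simple_dim k" "zero_rep G (simple_dim k)" 1
    by (rule nilpotent_zero_rep)
  let ?act = "rep_act G (simple_dim k) (zero_rep G (simple_dim k))"
  show ?thesis
  proof (rule left_module_quotient[OF J, where act = ?act], unfold simple_carrier)
    show "abelian_group (simple_module G k)"
      by (simp add: simple_module_def Let_def abelian_group_rep_module)
    show "?act \<one>\<^bsub>cpa G\<^esub> x = x" if "x \<in> rep_carrier G (simple_dim k)" for x
      using that k by (auto simp: simple_act cpa_one rep_carrier_def PiE_def extensional_def fun_eq_iff)
    show "cls f \<odot>\<^bsub>simple_module G k\<^esub> x = ?act f x"
      if "f \<in> carrier (cpa G)" "x \<in> rep_carrier G (simple_dim k)" for f x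
      using that by (simp add: simple_smult simple_act)
  qed (simp_all add: S.rep_act_closed S.rep_act_add_left S.rep_act_mult simple_module_def Let_def
      rep_module_def S.rep_act_add_right)
qed

lemma cyclic_simple: "cyclic_module R (simple_module G k) (simple_vector G k)"
proof (intro cyclic_module.intro left_module_simple cyclic_module_axioms.intro)
  show s0: "simple_vector G k \<in> carrier (simple_module G k)"
    by (auto simp: simple_carrier simple_vector_def rep_carrier_def)
  fix x assume "x \<in> carrier (simple_module G k)"
  then have x: "x \<in> rep_carrier G (simple_dim k)" by (simp add: simple_carrier)
  have xj: "x j \<in> carrier_vec (simple_dim k j)" if "j \<in> verts G" for j
    using PiE_mem[OF x[unfolded rep_carrier_def] that] .
  have "x = (\<lambda>j\<in>verts G. cpa_scalar G (x k $ 0) (k, []) \<cdot>\<^sub>v simple_vector G k j)"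
  proof
    fix j
    show "x j = (\<lambda>j\<in>verts G. cpa_scalar G (x k $ 0) (k, []) \<cdot>\<^sub>v simple_vector G k j) j"
    proof (cases "j \<in> verts G")
      case True
      then show ?thesis
        using xj[OF True] k by (auto simp: simple_vector_def cpa_scalar_def cpa_one intro!: eq_vecI)
    next
      case False
      then show ?thesis using x by (auto simp: rep_carrier_def PiE_def extensional_def)
    qed
  qed
  also have "\<dots> = \<iota> (x k $ 0) \<odot>\<^bsub>simple_module G k\<^esub> simple_vector G k"
    using simple_smult[OF cpa_scalar_closed, of "simple_vector G k"] s0 by (simp add: simple_carrier)
  finally show "\<exists>r\<in>carrier R. x = r \<odot>\<^bsub>simple_module G k\<^esub> simple_vector G k"
    using cls_closed[OF cpa_scalar_closed] by blast
qed

lemma simple_annihilator: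
  assumes f: "f \<in> carrier (cpa G)"
  shows "cls f \<odot>\<^bsub>simple_module G k\<^esub> simple_vector G k = \<zero>\<^bsub>simple_module G k\<^esub> \<longleftrightarrow> f (k, []) = 0"
proof -
  have s0: "simple_vector G k \<in> rep_carrier G (simple_dim k)"
    by (auto simp: simple_vector_def rep_carrier_def)
  have z: "\<zero>\<^bsub>simple_module G k\<^esub> = (\<lambda>j\<in>verts G. 0\<^sub>v (simple_dim k j))"
    by (simp add: simple_module_def Let_def rep_module_def)
  show ?thesis
  proof
    assume "cls f \<odot>\<^bsub>simple_module G k\<^esub> simple_vector G k = \<zero>\<^bsub>simple_module G k\<^esub>"
    then have "(\<lambda>j\<in>verts G. f (k, []) \<cdot>\<^sub>v simple_vector G k j) k $ 0 =
        (\<lambda>j\<in>verts G. 0\<^sub>v (simple_dim k j)) k $ 0"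
      by (simp only: simple_smult[OF f s0] z)
    then show "f (k, []) = 0" using k by (simp add: simple_vector_def)
  next
    assume "f (k, []) = 0"
    then show "cls f \<odot>\<^bsub>simple_module G k\<^esub> simple_vector G k = \<zero>\<^bsub>simple_module G k\<^esub>"
      unfolding simple_smult[OF f s0] z
      by (auto simp: simple_vector_def fun_eq_iff intro!: eq_vecI)
  qed
qed

end

end

text \<open>
  A nilpotent representation of the subquiver that is annihilated by the image of \<open>J\<close>.
\<close>

locale restricted_representation =
  admissible_quotient G J + rep: nilpotent_representation "restrict_quiver G V" d M N
  for G :: "('v, 'a) pre_digraph" and J V d M N +
  assumes annihilated: "f \<in> J \<Longrightarrow> x \<in> rep_carrier (restrict_quiver G V) d \<Longrightarrow>
    rep_act (restrict_quiver G V) d M (cpa_proj (restrict_quiver G V) f) x =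
      (\<lambda>i\<in>verts G. 0\<^sub>v (d i))"
begin

abbreviation Q where "Q \<equiv> restrict_quiver G V"

definition act where "act f x = rep_act Q d M (cpa_proj Q f) x"

text \<open>
  The representation as a module over \<open>cpa G Quot J\<close>.
\<close>

definition inflated where "inflated = restrict_scalars ((`) (cpa_proj Q)) (rep_module Q d M)"

lemma inflated_simps:
  "carrier inflated = rep_carrier Q d" "x \<oplus>\<^bsub>inflated\<^esub> y = (\<lambda>i\<in>verts G. x i + y i)"
  "\<zero>\<^bsub>inflated\<^esub> = (\<lambda>i\<in>verts G. 0\<^sub>v (d i))"
  by (simp_all add: inflated_def restrict_scalars_def rep_module_def)

lemma act_add_left:
  assumes x: "x \<in> rep_carrier Q d"
  shows "act (\<lambda>p. f p + g p) x = (\<lambda>i\<in>verts G. act f x i + act g x i)"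
proof -
  have "cpa_proj Q (\<lambda>p. f p + g p) = (\<lambda>p. cpa_proj Q f p + cpa_proj Q g p)"
    by (auto simp: cpa_proj_def)
  then show ?thesis using rep.rep_act_add_left[OF x] by (simp add: act_def)
qed

lemma act_add_right:
  assumes "x \<in> rep_carrier Q d" and "y \<in> rep_carrier Q d"
  shows "act f (\<lambda>i\<in>verts G. x i + y i) = (\<lambda>i\<in>verts G. act f x i + act f y i)"
  using rep.rep_act_add_right[OF assms] by (simp add: act_def)

lemma act_closed: "act f x \<in> rep_carrier Q d"
  unfolding act_def by (rule rep.rep_act_closed)

lemma act_mult:
  assumes "f \<in> carrier (cpa G)" "g \<in> carrier (cpa G)" "x \<in> rep_carrier Q d"
  shows "act (f \<otimes>\<^bsub>cpa G\<^esub> g) x = act f (act g x)"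
  using ring_hom_mult[OF cpa_proj_ring_hom[of V] assms(1,2)] rep.rep_act_mult[OF assms(3)]
  by (simp add: act_def)

lemma inflated_smult:
  assumes f: "f \<in> carrier (cpa G)" and x: "x \<in> rep_carrier Q d"
  shows "cls f \<odot>\<^bsub>inflated\<^esub> x = act f x"
proof -
  have "the_elem ((\<lambda>f. act f x) ` cls f) = act f x"
  proof (rule coset_action[OF f])
    fix h assume h: "h \<in> J"
    have "act (h \<oplus>\<^bsub>cpa G\<^esub> f) x = (\<lambda>i\<in>verts G. 0\<^sub>v (d i) + act f x i)"
      using annihilated[OF h x] by (simp add: act_add_left[OF x] act_def[of h] cong: restrict_cong)
    also have "\<dots> = act f x"
      using act_closed[of f x] by (auto simp: rep_carrier_def PiE_def Pi_def extensional_def fun_eq_iff)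
    finally show "act (h \<oplus>\<^bsub>cpa G\<^esub> f) x = act f x" .
  qed
  then show ?thesis
    by (simp add: inflated_def restrict_scalars_def rep_module_def image_image act_def)
qed

lemma left_module_inflated: "left_module R inflated"
proof (rule left_module_quotient[OF J, where act = act], unfold inflated_simps)
  show "abelian_group inflated"
  proof -
    interpret abelian_group "rep_module Q d M" by (rule abelian_group_rep_module)
    show ?thesis
    proof (rule abelian_groupI)
      fix x assume "x \<in> carrier inflated"
      then show "\<exists>y\<in>carrier inflated. y \<oplus>\<^bsub>inflated\<^esub> x = \<zero>\<^bsub>inflated\<^esub>"
        by (intro bexI[of _ "\<ominus>\<^bsub>rep_module Q d M\<^esub> x"])
          (simp_all add: inflated_def restrict_scalars_def l_neg)
    qed (auto simp: inflated_def restrict_scalars_def a_ac)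
  qed
  show "act \<one>\<^bsub>cpa G\<^esub> x = x" if "x \<in> rep_carrier Q d" for x
  proof -
    have "cpa_proj Q \<one>\<^bsub>cpa G\<^esub> = cpa_scalar Q 1"
      using ring_hom_one[OF cpa_proj_ring_hom[of V]] by (simp add: cpa_scalar_def)
    then have "act \<one>\<^bsub>cpa G\<^esub> x = (\<lambda>i\<in>verts G. 1 \<cdot>\<^sub>v x i)"
      using rep.rep_act_scalar[OF that, of 1] by (simp add: act_def)
    also have "\<dots> = x"
      using that by (auto simp: rep_carrier_def PiE_def extensional_def fun_eq_iff)
    finally show ?thesis .
  qed
qed (simp_all add: act_closed act_add_left act_mult inflated_smult act_add_right)

lemma inflated_scalar:
  assumes x: "x \<in> rep_carrier Q d"
  shows "\<iota> c \<odot>\<^bsub>inflated\<^esub> x = (\<lambda>i\<in>verts G. c \<cdot>\<^sub>v x i)"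
proof -
  have "cpa_proj Q (cpa_scalar G c) = cpa_scalar Q c"
    by (auto simp: cpa_proj_def cpa_scalar_def cpa_one fun_eq_iff)
  then show ?thesis
    using rep.rep_act_scalar[OF x] inflated_smult[OF cpa_scalar_closed x] by (simp add: act_def)
qed

lemma linear_rep_space_inflated: "linear_map class_ring (rep_space Q d) (restrict_scalars \<iota> inflated) (\<lambda>x. x)"
proof (rule linear_mapI[OF vectorspace_rep_space vectorspace_restrict_scalars[OF left_module_inflated complex_algebra_R]])
  fix c :: complex and x assume "x \<in> carrier (rep_space Q d)"
  then show "c \<odot>\<^bsub>rep_space Q d\<^esub> x = c \<odot>\<^bsub>restrict_scalars \<iota> inflated\<^esub> x"
    by (simp add: restrict_scalars_def rep_space_simps inflated_scalar)
qed (simp_all add: rep_space_simps restrict_scalars_def inflated_simps)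

text \<open>
  In particular the dimension of the module does not depend on the matrices in the representation.
\<close>

lemma inflated_space:
  shows "vectorspace.fin_dim class_ring (restrict_scalars \<iota> inflated)"
    and "vectorspace.dim class_ring (restrict_scalars \<iota> inflated) = vectorspace.dim class_ring (rep_space Q d)"
proof -
  have fd: "vectorspace.fin_dim class_ring (rep_space Q d)"
    by (rule fin_dim_rep_space) simp
  have onto: "(\<lambda>x. x) ` carrier (rep_space Q d) = carrier (restrict_scalars \<iota> inflated)"
    by (simp add: rep_space_simps restrict_scalars_def inflated_simps)
  show "vectorspace.fin_dim class_ring (restrict_scalars \<iota> inflated)"
    by (rule linear_map.surj_fin_dim[OF linear_rep_space_inflated fd onto])
  show "vectorspace.dim class_ring (restrict_scalars \<iota> inflated) = vectorspace.dim class_ring (rep_space Q d)"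
    by (rule linear_map.dim_eq[OF linear_rep_space_inflated fd _ onto, symmetric]) simp
qed

end

section \<open>Generators of the annihilator and their relations\<close>

text \<open>
  Paths whose classes generate the annihilator of the simple module at \<open>k\<close>. Every path other than
  the trivial one at \<open>k\<close> begins with exactly one of them.
\<close>

definition annihilator_gens :: "('v, 'a) pre_digraph \<Rightarrow> 'v \<Rightarrow> ('v \<times> 'a list) set" where
  "annihilator_gens G k = (\<lambda>u. (u, [])) ` (verts G - {k}) \<union> (\<lambda>a. (k, [a])) ` {a \<in> arcs G. tail G a = k}"

definition target :: "('v, 'a) pre_digraph \<Rightarrow> 'v \<times> 'a list \<Rightarrow> 'v" where
  "target G g = path_end G (fst g) (snd g)"

text \<open>
  Right division of \<open>f\<close> by the path \<open>g\<close>: the left coefficient of \<open>g\<close> in \<open>f\<close>.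
\<close>

definition path_quotient :: "('v, 'a) pre_digraph \<Rightarrow> 'v \<times> 'a list \<Rightarrow> ('v \<times> 'a list \<Rightarrow> complex)
    \<Rightarrow> ('v \<times> 'a list \<Rightarrow> complex)" where
  "path_quotient G g f = (\<lambda>(u, w). if u = target G g then f (fst g, snd g @ w) else 0)"

context wf_digraph
begin

lemma annihilator_gens_qpaths: "g \<in> annihilator_gens G k \<Longrightarrow> g \<in> qpaths G"
  by (auto simp: annihilator_gens_def qpaths_Cons)

lemma target_in_verts: "g \<in> annihilator_gens G k \<Longrightarrow> target G g \<in> verts G"
  by (auto simp: annihilator_gens_def target_def)

lemma path_quotient_closed: "f \<in> carrier (cpa G) \<Longrightarrow> path_quotient G g f \<in> carrier (cpa G)"
  by (auto simp: path_quotient_def target_def qpaths_append)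

lemma path_quotient_add: "path_quotient G g (\<lambda>p. f p + h p) = (\<lambda>p. path_quotient G g f p + path_quotient G g h p)"
  by (auto simp: path_quotient_def)

text \<open>
  Because \<open>f\<close> has no constant term at \<open>k\<close>, no summand of the product cuts a path inside its initial
  segment \<open>g\<close>.
\<close>

lemma path_quotient_mult:
  assumes g: "g \<in> annihilator_gens G k" and f: "f (k, []) = 0"
  shows "path_quotient G g (h \<otimes>\<^bsub>cpa G\<^esub> f) = h \<otimes>\<^bsub>cpa G\<^esub> path_quotient G g f"
proof (rule ext, clarify)
  fix u w
  show "path_quotient G g (h \<otimes>\<^bsub>cpa G\<^esub> f) (u, w) = (h \<otimes>\<^bsub>cpa G\<^esub> path_quotient G g f) (u, w)"
  proof (cases "u = target G g")
    case False
    then show ?thesis by (simp add: path_quotient_def cpa_mult)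
  next
    case True
    consider u' where "g = (u', [])" | a where "g = (k, [a])" using g by (auto simp: annihilator_gens_def)
    then show ?thesis
    proof cases
      case 1
      then show ?thesis using True by (simp add: path_quotient_def cpa_mult target_def)
    next
      case 2
      \<comment> \<open>The summand in which \<open>f\<close> takes the trivial path vanishes.\<close>
      have "(h \<otimes>\<^bsub>cpa G\<^esub> f) (k, a # w) =
          (\<Sum>l\<le>length w. h (path_end G (head G a) (take l w), drop l w) * f (k, a # take l w))"
        by (simp only: cpa_mult length_Cons sum.atMost_Suc_shift) (simp add: f)
      then show ?thesis using True 2 by (simp add: path_quotient_def cpa_mult target_def)
    qed
  qed
qed

lemma path_quotient_mult_path:
  "(path_quotient G g f \<otimes>\<^bsub>cpa G\<^esub> cpa_path g) (u, w) =
    (if u = fst g \<and> take (length (snd g)) w = snd g then f (u, w) else 0)"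
proof -
  let ?c = "u = fst g \<and> take (length (snd g)) w = snd g"
  have "(path_quotient G g f \<otimes>\<^bsub>cpa G\<^esub> cpa_path g) (u, w) =
      (\<Sum>l\<le>length w. if l = length (snd g) then (if ?c then f (u, w) else 0) else 0)"
    unfolding cpa_mult
  proof (rule sum.cong[OF refl])
    fix l assume l: "l \<in> {..length w}"
    show "path_quotient G g f (path_end G u (take l w), drop l w) * cpa_path g (u, take l w) =
        (if l = length (snd g) then (if ?c then f (u, w) else 0) else 0)"
    proof (cases "(u, take l w) = g")
      case True
      then have g: "g = (u, take l w)" ..
      show ?thesis using l by (simp add: g cpa_path_def path_quotient_def target_def min_absorb2)
    next
      case False
      then have "\<not> (l = length (snd g) \<and> ?c)" by (cases g) auto
      then show ?thesis using False by (auto simp: cpa_path_def)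
    qed
  qed
  also have "\<dots> = (if length (snd g) \<le> length w \<and> ?c then f (u, w) else 0)"
    by (simp add: sum.delta)
  also have "\<dots> = (if ?c then f (u, w) else 0)" by (metis nat_le_linear take_all)
  finally show ?thesis .
qed

lemma path_quotient_cpa_path:
  assumes "g \<in> annihilator_gens G k" and "g' \<in> annihilator_gens G k"
  shows "path_quotient G g (cpa_path g') (u, w) = (if g = g' \<and> u = target G g \<and> w = [] then 1 else 0)"
  using assms by (auto simp: annihilator_gens_def path_quotient_def cpa_path_def)

lemma cpa_path_gen_trivial: "g \<in> annihilator_gens G k \<Longrightarrow> cpa_path g (k, []) = 0"
  by (auto simp: annihilator_gens_def cpa_path_def)

lemma cpa_path_closed: "p \<in> qpaths G \<Longrightarrow> cpa_path p \<in> carrier (cpa G)"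
  by (auto simp: cpa_path_def)

lemma mult_trivial_coeff: "(h \<otimes>\<^bsub>cpa G\<^esub> f) (k, []) = h (k, []) * f (k, [])"
  by (simp add: cpa_mult)

end

context fin_digraph
begin

lemma finite_annihilator_gens: "finite (annihilator_gens G k)"
  by (simp add: annihilator_gens_def)

text \<open>
  Sort the paths in \<open>f\<close> by the generator with which they begin.
\<close>

lemma path_quotient_decomposition:
  assumes f: "f \<in> carrier (cpa G)" and f0: "f (k, []) = 0"
  shows "f = (\<lambda>p. \<Sum>g\<in>annihilator_gens G k. (path_quotient G g f \<otimes>\<^bsub>cpa G\<^esub> cpa_path g) p)"
proof (rule ext, clarify)
  fix u and w :: "'b list"
  \<comment> \<open>The generator with which the path begins.\<close>
  let ?g = "if u = k then (k, [hd w]) else (u, [])"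
  show "f (u, w) = (\<Sum>g\<in>annihilator_gens G k. (path_quotient G g f \<otimes>\<^bsub>cpa G\<^esub> cpa_path g) (u, w))"
  proof (cases "f (u, w) = 0")
    case True
    show ?thesis unfolding path_quotient_mult_path True by simp
  next
    case False
    then have q: "(u, w) \<in> qpaths G" using f by auto
    have w: "w \<noteq> []" if "u = k" using that False f0 by auto
    have g: "?g \<in> annihilator_gens G k"
    proof (cases "u = k")
      case True
      then show ?thesis using q w by (cases w) (auto simp: annihilator_gens_def qpaths_Cons)
    next
      case False
      then show ?thesis using q qpaths_start_in_verts by (auto simp: annihilator_gens_def)
    qed
    have "(\<Sum>g\<in>annihilator_gens G k. (path_quotient G g f \<otimes>\<^bsub>cpa G\<^esub> cpa_path g) (u, w)) =
        (\<Sum>g\<in>annihilator_gens G k. if g = ?g then f (u, w) else 0)"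
    proof (rule sum.cong[OF refl])
      fix g assume "g \<in> annihilator_gens G k"
      then have "u = fst g \<and> take (length (snd g)) w = snd g \<longleftrightarrow> g = ?g"
        using w by (cases w) (auto simp: annihilator_gens_def)
      then show "(path_quotient G g f \<otimes>\<^bsub>cpa G\<^esub> cpa_path g) (u, w) = (if g = ?g then f (u, w) else 0)"
        unfolding path_quotient_mult_path by (simp only:)
    qed
    also have "\<dots> = f (u, w)" using g by (simp add: sum.delta finite_annihilator_gens)
    finally show ?thesis ..
  qed
qed

end

text \<open>
  The entry, in row \<open>(j, r)\<close> and column \<open>(i, s)\<close>, of the matrix by which \<open>h\<close> acts on the
  representation \<open>M\<close>, computed with the paths shorter than \<open>N\<close>.
\<close>

definition action_coeff :: "('v, 'a) pre_digraph \<Rightarrow> ('v \<Rightarrow> nat) \<Rightarrow> nat \<Rightarrow> ('v \<times> 'a list \<Rightarrow> complex)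
    \<Rightarrow> 'v \<Rightarrow> nat \<Rightarrow> 'v \<Rightarrow> nat \<Rightarrow> 'a rep \<Rightarrow> complex" where
  "action_coeff Q d N h j r i s M = (\<Sum>(u, w)\<in>short_paths_to Q N j.
    if u = i then cpa_proj Q h (u, w) * path_mat Q d M u w $$ (r, s) else 0)"

text \<open>
  Unknowns for the values at the generators: \<open>(g, i, s)\<close> stands for the entry \<open>s\<close> at the vertex
  \<open>i\<close> of the value at \<open>g\<close>.
\<close>

definition hom_coords :: "('v, 'a) pre_digraph \<Rightarrow> ('v \<Rightarrow> nat) \<Rightarrow> 'v
    \<Rightarrow> (('v \<times> 'a list) \<times> 'v \<times> nat) set" where
  "hom_coords G d k = (SIGMA g:annihilator_gens G k. SIGMA i:verts G. {..<d i})"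

text \<open>
  The first kind of row says that an element of \<open>J\<close>, written as a combination of the generators, is
  sent to zero. The second kind says that the value at \<open>g\<close> lies in the space at the target of \<open>g\<close>.
\<close>

definition hom_rows where
  "hom_rows G Q J d k N =
    {\<lambda>M (g, i, s). action_coeff Q d N (path_quotient G g f) j r i s M | f j r.
      f \<in> J \<and> j \<in> verts G \<and> r < d j} \<union>
    {\<lambda>M q. if q = (g, i, s) then 1 else 0 | g i s.
      (g, i, s) \<in> hom_coords G d k \<and> i \<noteq> target G g}"

lemma ball_setcompr3:
  "(\<forall>y\<in>{F a b c |a b c. P a b c}. S y) \<longleftrightarrow> (\<forall>a b c. P a b c \<longrightarrow> S (F a b c))"
  by blast

context restricted_representation
begin

lemma act_index:
  assumes j: "j \<in> verts G" and r: "r < d j" and x: "x \<in> rep_carrier Q d"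
  shows "act h x j $ r = (\<Sum>i\<in>verts G. \<Sum>s<d i. action_coeff Q d N h j r i s M * x i $ s)"
proof -
  let ?P = "short_paths_to Q N j"
  let ?c = "\<lambda>p i s. if fst p = i then cpa_proj Q h p * path_mat Q d M (fst p) (snd p) $$ (r, s) else 0"
  have "(\<Sum>i\<in>verts G. \<Sum>s<d i. action_coeff Q d N h j r i s M * x i $ s) =
      (\<Sum>i\<in>verts G. \<Sum>p\<in>?P. \<Sum>s<d i. ?c p i s * x i $ s)"
    unfolding action_coeff_def sum_distrib_right
    by (rule sum.cong[OF refl], subst sum.swap, intro sum.cong refl) (auto split: prod.splits)
  also have "\<dots> = (\<Sum>p\<in>?P. \<Sum>i\<in>verts G. if i = fst p then (\<Sum>s<d i. cpa_proj Q h p *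
      path_mat Q d M (fst p) (snd p) $$ (r, s) * x i $ s) else 0)"
    by (subst sum.swap) (auto intro!: sum.cong)
  also have "\<dots> = (\<Sum>p\<in>?P. cpa_proj Q h p * (path_mat Q d M (fst p) (snd p) *\<^sub>v x (fst p)) $ r)"
  proof (rule sum.cong[OF refl])
    fix p assume p: "p \<in> ?P"
    obtain u w where uw: "p = (u, w)" by (cases p)
    have u: "u \<in> verts G" using p uw rep.qpaths_start_in_verts by (auto simp: short_paths_to_def)
    have xu: "x u \<in> carrier_vec (d u)" using rep.rep_carrierD[OF x, of u] u by simp
    have P: "path_mat Q d M u w \<in> carrier_mat (d j) (d u)" using rep.pm_carrier p uw by blast
    have "(\<Sum>i\<in>verts G. if i = u then (\<Sum>s<d i. cpa_proj Q h p * path_mat Q d M u w $$ (r, s) * x i $ s) else 0) =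
        (\<Sum>s<d u. cpa_proj Q h p * path_mat Q d M u w $$ (r, s) * x u $ s)"
      using u by (simp add: sum.delta)
    also have "\<dots> = cpa_proj Q h p * (path_mat Q d M u w *\<^sub>v x u) $ r"
      using P xu r by (simp add: scalar_prod_def atLeast0LessThan sum_distrib_left mult.assoc)
    finally show "(\<Sum>i\<in>verts G. if i = fst p then (\<Sum>s<d i. cpa_proj Q h p *
        path_mat Q d M (fst p) (snd p) $$ (r, s) * x i $ s) else 0) =
        cpa_proj Q h p * (path_mat Q d M (fst p) (snd p) *\<^sub>v x (fst p)) $ r"
      unfolding uw fst_conv snd_conv .
  qed
  finally show ?thesis
    unfolding act_def using rep.rep_act_index[of j r x "cpa_proj Q h"] j r x by (simp add: case_prod_beta)
qed

lemma act_path_quotient_gen: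
  assumes g: "g \<in> annihilator_gens G k" and g': "g' \<in> annihilator_gens G k" and x: "x \<in> rep_carrier Q d"
    and j: "j \<in> verts G" and r: "r < d j"
  shows "act (path_quotient G g (cpa_path g')) x j $ r =
    (if g = g' \<and> j = target G g then x j $ r else 0)"
proof -
  let ?h = "cpa_proj Q (path_quotient G g (cpa_path g'))"
  have h: "?h (u, w) = (if g = g' \<and> u = target G g \<and> w = [] then 1 else 0)" for u w
    unfolding cpa_proj_def path_quotient_cpa_path[OF g g'] using target_in_verts[OF g] by auto
  have "act (path_quotient G g (cpa_path g')) x = (\<lambda>i\<in>verts G. ?h (i, []) \<cdot>\<^sub>v x i)"
    unfolding act_def using rep.rep_act_vertices[OF x, of ?h] h by simp
  moreover have "x j \<in> carrier_vec (d j)" using rep.rep_carrierD[OF x] j by simp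
  ultimately show ?thesis using j r h by simp
qed

definition coord_family :: "(('v \<times> 'a list) \<times> 'v \<times> nat \<Rightarrow> complex) \<Rightarrow> 'v \<times> 'a list \<Rightarrow> 'v \<Rightarrow> complex vec" where
  "coord_family x g = (\<lambda>i\<in>verts G. vec (d i) (\<lambda>s. x (g, i, s)))"

lemma coord_family_closed: "coord_family x g \<in> rep_carrier Q d"
  by (auto simp: coord_family_def rep_carrier_def)

lemma coord_family_index: "i \<in> verts G \<Longrightarrow> s < d i \<Longrightarrow> coord_family x g i $ s = x (g, i, s)"
  by (simp add: coord_family_def)

lemma hom_row_sum:
  assumes j: "j \<in> verts G" and r: "r < d j"
  shows "(\<Sum>p\<in>hom_coords G d k.
      (case p of (g, i, s) \<Rightarrow> action_coeff Q d N (path_quotient G g f) j r i s M) * x p) =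
    (\<Sum>g\<in>annihilator_gens G k. act (path_quotient G g f) (coord_family x g) j $ r)"
proof -
  have "(\<Sum>g\<in>annihilator_gens G k. act (path_quotient G g f) (coord_family x g) j $ r) =
      (\<Sum>g\<in>annihilator_gens G k. \<Sum>i\<in>verts G. \<Sum>s<d i. action_coeff Q d N (path_quotient G g f) j r i s M * x (g, i, s))"
    by (simp add: act_index[OF j r coord_family_closed] coord_family_index)
  also have "\<dots> = (\<Sum>g\<in>annihilator_gens G k. \<Sum>(i, s)\<in>(SIGMA i:verts G. {..<d i}).
      action_coeff Q d N (path_quotient G g f) j r i s M * x (g, i, s))"
    by (simp add: sum.Sigma)
  also have "\<dots> = (\<Sum>(g, i, s)\<in>hom_coords G d k. action_coeff Q d N (path_quotient G g f) j r i s M * x (g, i, s))"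
    unfolding hom_coords_def by (subst sum.Sigma) (auto simp: finite_annihilator_gens case_prod_beta)
  finally show ?thesis by (simp add: case_prod_beta)
qed

definition solves :: "'v \<Rightarrow> (('v \<times> 'a list) \<times> 'v \<times> nat \<Rightarrow> complex) \<Rightarrow> bool" where
  "solves k x \<longleftrightarrow> (\<forall>\<rho>\<in>hom_rows G Q J d k N. (\<Sum>p\<in>hom_coords G d k. \<rho> M p * x p) = 0)"

lemma finite_hom_coords: "finite (hom_coords G d k)"
  by (auto simp: hom_coords_def finite_annihilator_gens)

lemma solves_iff:
  "solves k x \<longleftrightarrow>
    (\<forall>f\<in>J. \<forall>j\<in>verts G. \<forall>r<d j. (\<Sum>g\<in>annihilator_gens G k. act (path_quotient G g f) (coord_family x g) j $ r) = 0) \<and>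
    (\<forall>g i s. (g, i, s) \<in> hom_coords G d k \<and> i \<noteq> target G g \<longrightarrow> x (g, i, s) = 0)"
    (is "_ \<longleftrightarrow> ?A \<and> ?B")
proof -
  have "solves k x \<longleftrightarrow>
      (\<forall>f j r. f \<in> J \<and> j \<in> verts G \<and> r < d j \<longrightarrow> (\<Sum>p\<in>hom_coords G d k.
        (case p of (g, i, s) \<Rightarrow> action_coeff Q d N (path_quotient G g f) j r i s M) * x p) = 0) \<and>
      (\<forall>g i s. (g, i, s) \<in> hom_coords G d k \<and> i \<noteq> target G g \<longrightarrow>
        (\<Sum>p\<in>hom_coords G d k. (if p = (g, i, s) then 1 else 0) * x p) = 0)" (is "_ \<longleftrightarrow> ?A' \<and> ?B'")
    unfolding solves_def hom_rows_def ball_Un ball_setcompr3 ..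
  moreover have "?A' \<longleftrightarrow> ?A" using hom_row_sum by auto
  moreover have "(\<Sum>p\<in>hom_coords G d k. (if p = (g, i, s) then 1 else 0) * x p) = x (g, i, s)"
    if "(g, i, s) \<in> hom_coords G d k" for g i s
    using sum.delta[OF finite_hom_coords, of "(g, i, s)" x] that by (simp add: if_distrib[of "\<lambda>c. c * _"] cong: if_cong)
  then have "?B' \<longleftrightarrow> ?B" by auto
  ultimately show ?thesis by simp
qed

end

section \<open>Homomorphisms out of the annihilator as solutions of a linear system\<close>

locale simple_ext = restricted_representation G J V d M N
  for G :: "('v, 'a) pre_digraph" and J V d M N +
  fixes k
  assumes k: "k \<in> verts G"
begin

sublocale ext: cyclic_ext R "simple_module G k" "simple_vector G k" inflated \<iota>
  by (intro cyclic_ext.intro cyclic_simple[OF k] left_module_inflated complex_algebra_R)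

lemma cls_in_I_iff: "f \<in> carrier (cpa G) \<Longrightarrow> cls f \<in> carrier ext.I \<longleftrightarrow> f (k, []) = 0"
  using simple_annihilator[OF k] cls_closed by (simp del: cpa_simps(1))

lemma in_I_cases:
  assumes "C \<in> carrier ext.I"
  obtains f where "f \<in> carrier (cpa G)" and "f (k, []) = 0" and "C = cls f"
proof -
  have "C \<in> carrier R" using assms by simp
  then obtain f where f: "f \<in> carrier (cpa G)" "C = cls f" unfolding carrier_R by blast
  then show ?thesis using that assms cls_in_I_iff[OF f(1)] by blast
qed

lemma gen_in_I: "g \<in> annihilator_gens G k \<Longrightarrow> cls (cpa_path g) \<in> carrier ext.I"
  using cls_in_I_iff[OF cpa_path_closed[OF annihilator_gens_qpaths]] cpa_path_gen_trivial by blast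

definition hom_coord :: "(('v \<times> 'a list \<Rightarrow> complex) set \<Rightarrow> 'v \<Rightarrow> complex vec)
    \<Rightarrow> ('v \<times> 'a list) \<times> 'v \<times> nat \<Rightarrow> complex" where
  "hom_coord \<theta> = (\<lambda>(g, i, s). \<theta> (cls (cpa_path g)) i $ s)"

context
  fixes \<theta> assumes \<theta>: "\<theta> \<in> lmod_hom R ext.I inflated"
begin

lemma hom_closed: "C \<in> carrier ext.I \<Longrightarrow> \<theta> C \<in> rep_carrier Q d"
  using lmod_homD(2)[OF \<theta>] by (simp add: inflated_simps del: ext.I_simps(1))

lemma hom_add:
  assumes f: "f \<in> carrier (cpa G)" "f (k, []) = 0" and h: "h \<in> carrier (cpa G)" "h (k, []) = 0"
    and j: "j \<in> verts G" and r: "r < d j"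
  shows "\<theta> (cls (\<lambda>p. f p + h p)) j $ r = \<theta> (cls f) j $ r + \<theta> (cls h) j $ r"
proof -
  have I: "cls f \<in> carrier ext.I" "cls h \<in> carrier ext.I"
    using f h cls_in_I_iff by blast+
  have "cls (\<lambda>p. f p + h p) = cls f \<oplus>\<^bsub>ext.I\<^esub> cls h"
    using cls_add[OF f(1) h(1)] by simp
  then have "\<theta> (cls (\<lambda>p. f p + h p)) = (\<lambda>i\<in>verts G. \<theta> (cls f) i + \<theta> (cls h) i)"
    using lmod_homD(3)[OF \<theta> I] by (simp only: inflated_simps)
  then show ?thesis
    using rep.rep_add_index[OF hom_closed[OF I(1)] hom_closed[OF I(2)], of j r] j r by simp
qed

lemma hom_zero: "\<theta> (cls (\<lambda>_. 0)) = \<zero>\<^bsub>inflated\<^esub>"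
proof -
  have z: "(\<lambda>_. 0) \<in> carrier (cpa G)" by simp
  have I: "cls (\<lambda>_. 0) \<in> carrier ext.I" using cls_in_I_iff[OF z] by blast
  have "cls (\<lambda>_. 0) = cls (\<lambda>_. 0) \<oplus>\<^bsub>ext.I\<^esub> cls (\<lambda>_. 0)"
    using cls_add[OF z z] by simp
  then have "\<theta> (cls (\<lambda>_. 0)) \<oplus>\<^bsub>inflated\<^esub> \<theta> (cls (\<lambda>_. 0)) = \<theta> (cls (\<lambda>_. 0))"
    using lmod_homD(3)[OF \<theta> I I] by simp
  then show ?thesis using lmod_homD(2)[OF \<theta> I] by (intro ext.M.add_eq_self)
qed

lemma hom_sum:
  assumes "finite A" and "\<And>g. g \<in> A \<Longrightarrow> F g \<in> carrier (cpa G)" and "\<And>g. g \<in> A \<Longrightarrow> F g (k, []) = 0"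
    and j: "j \<in> verts G" and r: "r < d j"
  shows "\<theta> (cls (\<lambda>p. \<Sum>g\<in>A. F g p)) j $ r = (\<Sum>g\<in>A. \<theta> (cls (F g)) j $ r)"
  using assms(1-3)
proof (induction A rule: finite_induct)
  case empty
  then show ?case using hom_zero j r by (simp add: inflated_simps)
next
  case (insert a A)
  have c: "(\<lambda>p. \<Sum>g\<in>A. F g p) \<in> carrier (cpa G)"
    using insert.prems(1) by (auto intro!: sum.neutral)
  have "(\<lambda>p. \<Sum>g\<in>insert a A. F g p) = (\<lambda>p. F a p + (\<Sum>g\<in>A. F g p))"
    using insert.hyps by simp
  then show ?case
    using hom_add[OF _ _ c _ j r, of "F a"] insert by simp
qed

text \<open>
  Apply \<open>\<theta>\<close> to the decomposition of \<open>f\<close> along the generators.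
\<close>

lemma hom_formula:
  assumes f: "f \<in> carrier (cpa G)" and f0: "f (k, []) = 0" and j: "j \<in> verts G" and r: "r < d j"
  shows "\<theta> (cls f) j $ r =
    (\<Sum>g\<in>annihilator_gens G k. act (path_quotient G g f) (\<theta> (cls (cpa_path g))) j $ r)"
proof -
  let ?F = "\<lambda>g. path_quotient G g f \<otimes>\<^bsub>cpa G\<^esub> cpa_path g"
  have F: "?F g \<in> carrier (cpa G)" "?F g (k, []) = 0" if "g \<in> annihilator_gens G k" for g
    using cpa_mult_closed[OF path_quotient_closed[OF f] cpa_path_closed[OF annihilator_gens_qpaths[OF that]]]
      cpa_path_gen_trivial[OF that] by (simp_all only: mult_trivial_coeff mult_zero_right)
  have "\<theta> (cls f) j $ r = \<theta> (cls (\<lambda>p. \<Sum>g\<in>annihilator_gens G k. ?F g p)) j $ r"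
    using path_quotient_decomposition[OF f f0] by simp
  also have "\<dots> = (\<Sum>g\<in>annihilator_gens G k. \<theta> (cls (?F g)) j $ r)"
    by (rule hom_sum[OF finite_annihilator_gens F j r])
  also have "\<dots> = (\<Sum>g\<in>annihilator_gens G k. act (path_quotient G g f) (\<theta> (cls (cpa_path g))) j $ r)"
  proof (rule sum.cong[OF refl])
    fix g assume g: "g \<in> annihilator_gens G k"
    have c: "path_quotient G g f \<in> carrier (cpa G)" by (rule path_quotient_closed[OF f])
    have "cls (?F g) = cls (path_quotient G g f) \<odot>\<^bsub>ext.I\<^esub> cls (cpa_path g)"
      using cls_mult[OF c cpa_path_closed[OF annihilator_gens_qpaths[OF g]]] by (simp only: ext.I_simps)
    then have "\<theta> (cls (?F g)) = cls (path_quotient G g f) \<odot>\<^bsub>inflated\<^esub> \<theta> (cls (cpa_path g))"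
      using lmod_homD(4)[OF \<theta> cls_closed[OF c] gen_in_I[OF g]] by (simp only:)
    then show "\<theta> (cls (?F g)) j $ r = act (path_quotient G g f) (\<theta> (cls (cpa_path g))) j $ r"
      using inflated_smult[OF c hom_closed[OF gen_in_I[OF g]]] by (simp only:)
  qed
  finally show ?thesis .
qed

lemma coord_family_hom_coord:
  assumes "g \<in> annihilator_gens G k"
  shows "coord_family (hom_coord \<theta>) g = \<theta> (cls (cpa_path g))"
proof (rule rep.rep_eqI[OF coord_family_closed hom_closed[OF gen_in_I[OF assms]]])
  fix j r assume "j \<in> verts Q" "r < d j"
  then show "coord_family (hom_coord \<theta>) g j $ r = \<theta> (cls (cpa_path g)) j $ r"
    by (simp add: coord_family_index hom_coord_def)
qed

text \<open>
  The rows for elements of \<open>J\<close> hold because their classes are zero. The other rows follow from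
  the formula for a generator \<open>g\<close>, whose only nonzero coefficient is the trivial path at its target.
\<close>

lemma hom_coord_solves: "solves k (hom_coord \<theta>)"
  unfolding solves_iff
proof (intro conjI ballI allI impI)
  fix f j r assume f: "f \<in> J" and j: "j \<in> verts G" and r: "r < d j"
  have "\<theta> (cls f) = \<theta> (cls (\<lambda>_. 0))"
    using cls_J[OF f] cls_J[OF J.zero_closed] by simp
  then have "\<theta> (cls f) j $ r = 0" using hom_zero j r by (simp add: inflated_simps)
  then show "(\<Sum>g\<in>annihilator_gens G k. act (path_quotient G g f) (coord_family (hom_coord \<theta>) g) j $ r) = 0"
    using hom_formula[OF J.a_Hcarr[OF f] J_zero[OF f k] j r] by (simp add: coord_family_hom_coord)
next
  fix g i s assume gis: "(g, i, s) \<in> hom_coords G d k \<and> i \<noteq> target G g"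
  then have g: "g \<in> annihilator_gens G k" and i: "i \<in> verts G" and s: "s < d i"
    by (auto simp: hom_coords_def)
  have "\<theta> (cls (cpa_path g)) i $ s =
      (\<Sum>h\<in>annihilator_gens G k. act (path_quotient G h (cpa_path g)) (\<theta> (cls (cpa_path h))) i $ s)"
    using hom_formula[OF cpa_path_closed[OF annihilator_gens_qpaths[OF g]] cpa_path_gen_trivial[OF g] i s] .
  also have "\<dots> = 0"
  proof (rule sum.neutral, intro ballI)
    fix h assume h: "h \<in> annihilator_gens G k"
    show "act (path_quotient G h (cpa_path g)) (\<theta> (cls (cpa_path h))) i $ s = 0"
      using act_path_quotient_gen[OF h g hom_closed[OF gen_in_I[OF h]] i s] gis by auto
  qed
  finally show "hom_coord \<theta> (g, i, s) = 0" by (simp add: hom_coord_def)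
qed

lemma hom_coord_zero:
  assumes 0: "\<And>p. p \<in> hom_coords G d k \<Longrightarrow> hom_coord \<theta> p = 0"
  shows "\<theta> = \<zero>\<^bsub>Hom_space R \<iota> ext.I inflated\<^esub>"
proof
  fix C
  show "\<theta> C = \<zero>\<^bsub>Hom_space R \<iota> ext.I inflated\<^esub> C"
  proof (cases "C \<in> carrier ext.I")
    case True
    then obtain f where f: "f \<in> carrier (cpa G)" "f (k, []) = 0" "C = cls f" by (rule in_I_cases)
    have fam: "\<theta> (cls (cpa_path g)) i $ s = 0" if "g \<in> annihilator_gens G k" "i \<in> verts G" "s < d i" for g i s
      using 0[of "(g, i, s)"] that by (simp add: hom_coords_def hom_coord_def)
    have "\<theta> C = \<zero>\<^bsub>inflated\<^esub>"
    proof (rule rep.rep_eqI)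
      show "\<theta> C \<in> rep_carrier Q d" by (rule hom_closed[OF True])
      show "\<zero>\<^bsub>inflated\<^esub> \<in> rep_carrier Q d" by (auto simp: inflated_simps rep_carrier_def)
      fix j r assume "j \<in> verts Q" and r: "r < d j"
      then have j: "j \<in> verts G" by simp
      have "act (path_quotient G g f) (\<theta> (cls (cpa_path g))) j $ r = 0" if "g \<in> annihilator_gens G k" for g
        unfolding act_index[OF j r hom_closed[OF gen_in_I[OF that]]]
        using fam[OF that] by (intro sum.neutral ballI) simp
      then show "\<theta> C j $ r = \<zero>\<^bsub>inflated\<^esub> j $ r"
        unfolding f(3) hom_formula[OF f(1,2) j r] using j r by (simp add: inflated_simps)
    qed
    then show ?thesis using True by (simp add: Hom_space_simps del: ext.I_simps(1))
  next
    case False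
    then show ?thesis
      using lmod_homD(1)[OF \<theta>] by (simp add: Hom_space_simps extensional_def del: ext.I_simps(1))
  qed
qed

end

context
  fixes x assumes x: "solves k x"
begin

text \<open>
  The homomorphism with prescribed values at the generators, as a function on the path algebra.
\<close>

definition of_solution :: "('v \<times> 'a list \<Rightarrow> complex) \<Rightarrow> 'v \<Rightarrow> complex vec" where
  "of_solution f = (\<lambda>j\<in>verts G. vec (d j) (\<lambda>r. \<Sum>g\<in>annihilator_gens G k. act (path_quotient G g f) (coord_family x g) j $ r))"

lemma of_solution_closed: "of_solution f \<in> rep_carrier Q d"
  by (auto simp: of_solution_def rep_carrier_def)

lemma of_solution_index: "j \<in> verts G \<Longrightarrow> r < d j \<Longrightarrow>
    of_solution f j $ r = (\<Sum>g\<in>annihilator_gens G k. act (path_quotient G g f) (coord_family x g) j $ r)"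
  by (simp add: of_solution_def)

lemma of_solution_eqI:
  assumes "y \<in> rep_carrier Q d"
    and "\<And>j r. j \<in> verts G \<Longrightarrow> r < d j \<Longrightarrow> of_solution f j $ r = y j $ r"
  shows "of_solution f = y"
  using rep.rep_eqI[OF of_solution_closed assms(1)] assms(2) by simp

lemma of_solution_add: "of_solution (\<lambda>p. f p + h p) = (\<lambda>i\<in>verts G. of_solution f i + of_solution h i)"
proof (rule of_solution_eqI)
  show "(\<lambda>i\<in>verts G. of_solution f i + of_solution h i) \<in> rep_carrier Q d"
    using rep.rep_add_closed[OF of_solution_closed of_solution_closed] by simp
  fix j r assume j: "j \<in> verts G" and r: "r < d j"
  have "act (path_quotient G g (\<lambda>p. f p + h p)) (coord_family x g) j $ r =
      act (path_quotient G g f) (coord_family x g) j $ r + act (path_quotient G g h) (coord_family x g) j $ r" for g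
    unfolding path_quotient_add act_add_left[OF coord_family_closed]
    using rep.rep_add_index[OF act_closed act_closed, of j r] j r by simp
  then show "of_solution (\<lambda>p. f p + h p) j $ r = (\<lambda>i\<in>verts G. of_solution f i + of_solution h i) j $ r"
    using rep.rep_add_index[OF of_solution_closed of_solution_closed, of j r f h] j r
    by (simp add: of_solution_index sum.distrib)
qed

lemma of_solution_J:
  assumes "f \<in> J"
  shows "of_solution f = (\<lambda>i\<in>verts G. 0\<^sub>v (d i))"
proof (rule of_solution_eqI)
  fix j r assume j: "j \<in> verts G" and r: "r < d j"
  then show "of_solution f j $ r = (\<lambda>i\<in>verts G. 0\<^sub>v (d i)) j $ r"
    using x assms unfolding solves_iff by (simp add: of_solution_index)
qed (auto simp: rep_carrier_def)

lemma of_solution_cong: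
  assumes "f \<in> carrier (cpa G)" and "f' \<in> carrier (cpa G)" and "cls f = cls f'"
  shows "of_solution f = of_solution f'"
proof -
  obtain h where h: "h \<in> J" "f = h \<oplus>\<^bsub>cpa G\<^esub> f'" using cls_eqD[OF assms] by blast
  have "of_solution f = (\<lambda>i\<in>verts G. of_solution h i + of_solution f' i)"
    using of_solution_add[of h f'] by (simp add: h(2))
  also have "\<dots> = of_solution f'"
  proof
    fix i
    have "of_solution f' i \<in> carrier_vec (d i)" if "i \<in> verts G"
      using rep.rep_carrierD[OF of_solution_closed, of i f'] that by simp
    then show "(\<lambda>i\<in>verts G. of_solution h i + of_solution f' i) i = of_solution f' i"
      unfolding of_solution_J[OF h(1)] by (auto simp: of_solution_def)
  qed
  finally show ?thesis .
qed

text \<open>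
  Division by a generator commutes with multiplication from the left, and the action is linear.
\<close>

lemma of_solution_mult:
  assumes h: "h \<in> carrier (cpa G)" and f: "f \<in> carrier (cpa G)" and f0: "f (k, []) = 0"
  shows "of_solution (h \<otimes>\<^bsub>cpa G\<^esub> f) = act h (of_solution f)"
proof (rule of_solution_eqI[OF act_closed])
  fix j r assume j: "j \<in> verts G" and r: "r < d j"
  let ?y = "\<lambda>g. act (path_quotient G g f) (coord_family x g)"
  let ?c = "\<lambda>i s. action_coeff Q d N h j r i s M"
  have "of_solution (h \<otimes>\<^bsub>cpa G\<^esub> f) j $ r = (\<Sum>g\<in>annihilator_gens G k. act h (?y g) j $ r)"
    unfolding of_solution_index[OF j r]
    by (rule sum.cong[OF refl])
      (simp only: path_quotient_mult[where f = f, OF _ f0] act_mult[OF h path_quotient_closed[OF f] coord_family_closed])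
  also have "\<dots> = (\<Sum>g\<in>annihilator_gens G k. \<Sum>i\<in>verts G. \<Sum>s<d i. ?c i s * ?y g i $ s)"
    by (simp only: act_index[OF j r act_closed])
  also have "\<dots> = (\<Sum>i\<in>verts G. \<Sum>s<d i. \<Sum>g\<in>annihilator_gens G k. ?c i s * ?y g i $ s)"
    by (subst sum.swap, rule sum.cong[OF refl], rule sum.swap)
  also have "\<dots> = (\<Sum>i\<in>verts G. \<Sum>s<d i. ?c i s * of_solution f i $ s)"
    by (intro sum.cong refl) (simp add: of_solution_index sum_distrib_left)
  also have "\<dots> = act h (of_solution f) j $ r"
    by (rule act_index[OF j r of_solution_closed, symmetric])
  finally show "of_solution (h \<otimes>\<^bsub>cpa G\<^esub> f) j $ r = act h (of_solution f) j $ r" .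
qed

lemma of_solution_gen:
  assumes g: "g \<in> annihilator_gens G k" and i: "i \<in> verts G" and s: "s < d i"
  shows "of_solution (cpa_path g) i $ s = x (g, i, s)"
proof -
  have "of_solution (cpa_path g) i $ s =
      (\<Sum>h\<in>annihilator_gens G k. if h = g then (if i = target G g then x (g, i, s) else 0) else 0)"
    unfolding of_solution_index[OF i s]
  proof (rule sum.cong[OF refl])
    fix h assume h: "h \<in> annihilator_gens G k"
    then show "act (path_quotient G h (cpa_path g)) (coord_family x h) i $ s =
        (if h = g then (if i = target G g then x (g, i, s) else 0) else 0)"
      unfolding act_path_quotient_gen[OF h g coord_family_closed i s] coord_family_index[OF i s] by auto
  qed
  also have "\<dots> = (if i = target G g then x (g, i, s) else 0)"
    using g by (simp add: sum.delta finite_annihilator_gens)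
  also have "\<dots> = x (g, i, s)"
  proof -
    have "(g, i, s) \<in> hom_coords G d k" using assms by (simp add: hom_coords_def)
    moreover have "\<forall>g i s. (g, i, s) \<in> hom_coords G d k \<and> i \<noteq> target G g \<longrightarrow> x (g, i, s) = 0"
      using x unfolding solves_iff by (rule conjunct2)
    ultimately have "i \<noteq> target G g \<longrightarrow> x (g, i, s) = 0" by blast
    then show ?thesis by simp
  qed
  finally show ?thesis .
qed

text \<open>
  \<open>of_solution\<close> kills \<open>J\<close>, so it factors through the classes; a representative is chosen for each.
\<close>

lemma solution_hom: "\<exists>\<theta>\<in>lmod_hom R ext.I inflated. \<forall>p\<in>hom_coords G d k. hom_coord \<theta> p = x p"
proof
  define repr where "repr C = (SOME f. f \<in> carrier (cpa G) \<and> C = cls f)" for C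
  let ?\<theta> = "\<lambda>C\<in>carrier ext.I. of_solution (repr C)"
  have \<theta>: "?\<theta> (cls f) = of_solution f" if f: "f \<in> carrier (cpa G)" "f (k, []) = 0" for f
  proof -
    have "repr (cls f) \<in> carrier (cpa G) \<and> cls f = cls (repr (cls f))"
      unfolding repr_def by (rule someI[of _ f]) (use f in blast)
    then have "of_solution (repr (cls f)) = of_solution f" using of_solution_cong f(1) by metis
    moreover have "cls f \<in> carrier ext.I" using cls_in_I_iff[OF f(1)] f(2) by blast
    ultimately show ?thesis by (simp only: restrict_apply')
  qed
  show "?\<theta> \<in> lmod_hom R ext.I inflated"
  proof (rule lmod_homI)
    show "?\<theta> \<in> carrier ext.I \<rightarrow>\<^sub>E carrier inflated"
      unfolding inflated_simps by (intro restrict_PiE_iff[THEN iffD2] ballI of_solution_closed)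
    fix C C' assume C: "C \<in> carrier ext.I" and C': "C' \<in> carrier ext.I"
    obtain f where f: "f \<in> carrier (cpa G)" "f (k, []) = 0" "C = cls f" by (rule in_I_cases[OF C])
    obtain f' where f': "f' \<in> carrier (cpa G)" "f' (k, []) = 0" "C' = cls f'"
      by (rule in_I_cases[OF C'])
    have "(\<lambda>p. f p + f' p) \<in> carrier (cpa G)" using f(1) f'(1) by simp
    then have "?\<theta> (cls (\<lambda>p. f p + f' p)) = of_solution (\<lambda>p. f p + f' p)"
      using f(2) f'(2) by (intro \<theta>) simp_all
    moreover have "C \<oplus>\<^bsub>ext.I\<^esub> C' = cls (\<lambda>p. f p + f' p)"
      using cls_add[OF f(1) f'(1)] f(3) f'(3) by simp
    ultimately show "?\<theta> (C \<oplus>\<^bsub>ext.I\<^esub> C') = ?\<theta> C \<oplus>\<^bsub>inflated\<^esub> ?\<theta> C'"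
      using \<theta>[OF f(1,2)] \<theta>[OF f'(1,2)] f(3) f'(3) by (simp only: of_solution_add inflated_simps)
  next
    fix r C assume r: "r \<in> carrier R" and C: "C \<in> carrier ext.I"
    obtain h where h: "h \<in> carrier (cpa G)" "r = cls h" using r unfolding carrier_R by blast
    obtain f where f: "f \<in> carrier (cpa G)" "f (k, []) = 0" "C = cls f" by (rule in_I_cases[OF C])
    have "?\<theta> (cls (h \<otimes>\<^bsub>cpa G\<^esub> f)) = of_solution (h \<otimes>\<^bsub>cpa G\<^esub> f)"
      using cpa_mult_closed[OF h(1) f(1)] f(2) by (intro \<theta>) (simp_all only: mult_trivial_coeff mult_zero_right)
    moreover have "r \<odot>\<^bsub>ext.I\<^esub> C = cls (h \<otimes>\<^bsub>cpa G\<^esub> f)"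
      using cls_mult[OF h(1) f(1)] h(2) f(3) by (simp only: ext.I_simps)
    ultimately show "?\<theta> (r \<odot>\<^bsub>ext.I\<^esub> C) = r \<odot>\<^bsub>inflated\<^esub> ?\<theta> C"
      using \<theta>[OF f(1,2)] f(3) h(2)
      by (simp only: of_solution_mult[OF h(1) f(1,2)] inflated_smult[OF h(1) of_solution_closed])
  qed
  show "\<forall>p\<in>hom_coords G d k. hom_coord ?\<theta> p = x p"
  proof
    fix p assume p: "p \<in> hom_coords G d k"
    obtain g i s where gis: "p = (g, i, s)" by (cases p)
    then have g: "g \<in> annihilator_gens G k" and i: "i \<in> verts G" and s: "s < d i" using p by (auto simp: hom_coords_def)
    have "?\<theta> (cls (cpa_path g)) = of_solution (cpa_path g)"
      by (rule \<theta>[OF cpa_path_closed[OF annihilator_gens_qpaths[OF g]] cpa_path_gen_trivial[OF g]])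
    then show "hom_coord ?\<theta> p = x p"
      unfolding gis hom_coord_def prod.case using of_solution_gen[OF g i s] by (simp only:)
  qed
qed

end

text \<open>
  The linear system describes the homomorphisms from the annihilator completely; so a set of unknowns
  that determines every solution bounds their dimension, and free unknowns compute it.
\<close>

lemma hom_dim_coordinates:
  assumes Z: "Z \<subseteq> hom_coords G d k"
    and inj: "\<forall>x. solves k x \<and> (\<forall>i\<in>Z. x i = 0) \<longrightarrow> (\<forall>i\<in>hom_coords G d k. x i = 0)"
  shows "vectorspace.fin_dim class_ring (Hom_space R \<iota> ext.I inflated)"
    and "hom_dim R \<iota> ext.I inflated \<le> card Z"
    and "(\<And>z. \<exists>x. solves k x \<and> (\<forall>i\<in>Z. x i = z i)) \<Longrightarrow> hom_dim R \<iota> ext.I inflated = card Z"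
proof -
  let ?H = "Hom_space R \<iota> ext.I inflated"
  let ?\<phi> = "\<lambda>p \<theta>. hom_coord \<theta> p"
  have V: "vectorspace class_ring ?H" by (rule ext.vectorspaces(2))
  have fin: "finite Z" using Z finite_hom_coords finite_subset by blast
  have carH: "\<theta> \<in> carrier ?H \<longleftrightarrow> \<theta> \<in> lmod_hom R ext.I inflated" for \<theta> by (simp only: Hom_space_simps)
  have add: "?\<phi> p (\<theta> \<oplus>\<^bsub>?H\<^esub> \<eta>) = ?\<phi> p \<theta> + ?\<phi> p \<eta>"
    if p: "p \<in> Z" and \<theta>: "\<theta> \<in> carrier ?H" and \<eta>: "\<eta> \<in> carrier ?H" for p \<theta> \<eta>
  proof -
    obtain g i s where gis: "p = (g, i, s)" by (cases p)
    then have g: "g \<in> annihilator_gens G k" and i: "i \<in> verts G" and s: "s < d i"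
      using p Z by (auto simp: hom_coords_def)
    note c = hom_closed[OF \<theta>[unfolded carH] gen_in_I[OF g]] hom_closed[OF \<eta>[unfolded carH] gen_in_I[OF g]]
    have "(\<theta> \<oplus>\<^bsub>?H\<^esub> \<eta>) (cls (cpa_path g)) = (\<lambda>i\<in>verts G. \<theta> (cls (cpa_path g)) i + \<eta> (cls (cpa_path g)) i)"
      using gen_in_I[OF g] by (simp only: Hom_space_simps restrict_apply' inflated_simps)
    then show ?thesis
      using rep.rep_add_index[OF c, of i s] i s by (simp add: gis hom_coord_def)
  qed
  have smult: "?\<phi> p (c \<odot>\<^bsub>?H\<^esub> \<theta>) = c * ?\<phi> p \<theta>" if p: "p \<in> Z" and \<theta>: "\<theta> \<in> carrier ?H" for p c \<theta>
  proof -
    obtain g i s where gis: "p = (g, i, s)" by (cases p)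
    then have g: "g \<in> annihilator_gens G k" and i: "i \<in> verts G" and s: "s < d i"
      using p Z by (auto simp: hom_coords_def)
    note cl = hom_closed[OF \<theta>[unfolded carH] gen_in_I[OF g]]
    have "(c \<odot>\<^bsub>?H\<^esub> \<theta>) (cls (cpa_path g)) = \<iota> c \<odot>\<^bsub>inflated\<^esub> \<theta> (cls (cpa_path g))"
      using gen_in_I[OF g] by (simp only: Hom_space_simps restrict_apply')
    also have "\<dots> = (\<lambda>i\<in>verts G. c \<cdot>\<^sub>v \<theta> (cls (cpa_path g)) i)"
      by (rule inflated_scalar[OF cl])
    finally show ?thesis
      using rep.rep_carrierD[OF cl, of i] i s by (simp add: gis hom_coord_def)
  qed
  have zero: "\<theta> = \<zero>\<^bsub>?H\<^esub>" if \<theta>: "\<theta> \<in> carrier ?H" and 0: "\<And>p. p \<in> Z \<Longrightarrow> ?\<phi> p \<theta> = 0" for \<theta>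
    using hom_coord_zero[OF \<theta>[unfolded carH]] inj hom_coord_solves[OF \<theta>[unfolded carH]] 0 by blast
  show "vectorspace.fin_dim class_ring ?H"
    by (rule vectorspace_complex_functionals(1)[OF V fin add smult zero])
  show "hom_dim R \<iota> ext.I inflated \<le> card Z"
    unfolding hom_dim_def by (rule vectorspace_complex_functionals(2)[OF V fin add smult zero])
  assume surj: "\<And>z. \<exists>x. solves k x \<and> (\<forall>i\<in>Z. x i = z i)"
  have "\<exists>\<theta>\<in>carrier ?H. \<forall>p\<in>Z. ?\<phi> p \<theta> = z p" for z
  proof -
    obtain x where x: "solves k x" "\<forall>i\<in>Z. x i = z i" using surj by blast
    obtain \<theta> where "\<theta> \<in> lmod_hom R ext.I inflated" "\<forall>p\<in>hom_coords G d k. hom_coord \<theta> p = x p"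
      using solution_hom[OF x(1)] by blast
    moreover from this have "\<theta> \<in> carrier ?H" using carH by blast
    ultimately show ?thesis using x(2) Z by (intro bexI[of _ \<theta>]) auto
  qed
  then show "hom_dim R \<iota> ext.I inflated = card Z"
    unfolding hom_dim_def by (intro vectorspace_complex_functionals(3)[OF V fin add smult zero])
qed

text \<open>
  The contribution of \<open>Hom(S, M)\<close> cancels.
\<close>

lemma ext_g_vector_eq:
  "ext_g_vector G Q J d (M, v) k =
    int (hom_dim R \<iota> ext.I inflated) - int (vectorspace.dim class_ring (rep_space Q d)) + int (v k)"
proof -
  have "vectorspace.fin_dim class_ring (Hom_space R \<iota> ext.I inflated)"
    by (rule hom_dim_coordinates(1)[OF subset_refl]) blast
  from ext.ext1_dim_cyclic[OF inflated_space(1) this]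
  have "ext1_dim R \<iota> (simple_module G k) inflated + vectorspace.dim class_ring (rep_space Q d) =
      hom_dim R \<iota> (simple_module G k) inflated + hom_dim R \<iota> ext.I inflated"
    by (simp only: inflated_space(2))
  then show ?thesis by (simp add: ext_g_vector_def Let_def inflated_def)
qed

lemma ext_g_vector_coordinates:
  assumes Z: "Z \<subseteq> hom_coords G d k"
    and inj: "\<forall>x. solves k x \<and> (\<forall>i\<in>Z. x i = 0) \<longrightarrow> (\<forall>i\<in>hom_coords G d k. x i = 0)"
  shows "ext_g_vector G Q J d (M, v) k \<le>
      int (card Z) - int (vectorspace.dim class_ring (rep_space Q d)) + int (v k)"
    and "(\<And>z. \<exists>x. solves k x \<and> (\<forall>i\<in>Z. x i = z i)) \<Longrightarrow> ext_g_vector G Q J d (M, v) k =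
      int (card Z) - int (vectorspace.dim class_ring (rep_space Q d)) + int (v k)"
  using hom_dim_coordinates(2,3)[OF Z inj] unfolding ext_g_vector_eq by simp_all

end

section \<open>Upper semicontinuity\<close>

text \<open>
  Polynomial functions, up to their values on families of matrices of the wrong sizes.
\<close>

definition regular_funs :: "('v, 'a) pre_digraph \<Rightarrow> ('v \<Rightarrow> nat) \<Rightarrow> ('a rep \<Rightarrow> complex) set" where
  "regular_funs Q d = {p. \<exists>q\<in>poly_funs Q d. \<forall>M\<in>mat_space Q d. p M = q M}"

lemma regular_funsI: "q \<in> poly_funs Q d \<Longrightarrow> (\<And>M. M \<in> mat_space Q d \<Longrightarrow> p M = q M) \<Longrightarrow> p \<in> regular_funs Q d"
  by (auto simp: regular_funs_def)

lemma regular_const: "(\<lambda>_. c) \<in> regular_funs Q d"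
  by (rule regular_funsI[OF poly_funs.const]) simp

lemma regular_add: "p \<in> regular_funs Q d \<Longrightarrow> q \<in> regular_funs Q d \<Longrightarrow> (\<lambda>M. p M + q M) \<in> regular_funs Q d"
  unfolding regular_funs_def using poly_funs.add by fastforce

lemma regular_mult: "p \<in> regular_funs Q d \<Longrightarrow> q \<in> regular_funs Q d \<Longrightarrow> (\<lambda>M. p M * q M) \<in> regular_funs Q d"
  unfolding regular_funs_def using poly_funs.mult by fastforce

lemma regular_sum:
  assumes "\<And>i. i \<in> A \<Longrightarrow> f i \<in> regular_funs Q d"
  shows "(\<lambda>M. \<Sum>i\<in>A. f i M) \<in> regular_funs Q d"
  using assms
proof (induction A rule: infinite_finite_induct)
  case (insert x A)
  then have "(\<lambda>M. f x M + (\<Sum>i\<in>A. f i M)) \<in> regular_funs Q d" by (intro regular_add) auto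
  then show ?case using insert.hyps by simp
qed (auto intro: regular_const)

lemma regular_cong: "p \<in> regular_funs Q d \<Longrightarrow> (\<And>M. M \<in> mat_space Q d \<Longrightarrow> p' M = p M) \<Longrightarrow> p' \<in> regular_funs Q d"
  unfolding regular_funs_def by auto

lemma (in wf_digraph) regular_path_mat:
  assumes "(u, w) \<in> qpaths G" and "r < d (path_end G u w)" and "s < d u"
  shows "(\<lambda>M. path_mat G d M u w $$ (r, s)) \<in> regular_funs G d"
  using assms
proof (induction w arbitrary: u s)
  case Nil
  then show ?case by (simp add: regular_const)
next
  case (Cons a w)
  then have a: "a \<in> arcs G" "tail G a = u" "(head G a, w) \<in> qpaths G"
    and r: "r < d (path_end G (head G a) w)" by (auto simp: qpaths_Cons)
  have "(\<lambda>M. \<Sum>t<d (head G a). path_mat G d M (head G a) w $$ (r, t) * M a $$ (t, s)) \<in> regular_funs G d"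
  proof (intro regular_sum regular_mult)
    fix t assume "t \<in> {..<d (head G a)}"
    then show "(\<lambda>M. path_mat G d M (head G a) w $$ (r, t)) \<in> regular_funs G d"
      using Cons.IH[OF a(3) r] by simp
    show "(\<lambda>M. M a $$ (t, s)) \<in> regular_funs G d"
      by (rule regular_funsI[OF poly_funs.coord[OF a(1)]])
        (use \<open>t \<in> {..<d (head G a)}\<close> a Cons.prems in auto)
  qed
  then show ?case
  proof (rule regular_cong)
    fix M assume M: "M \<in> mat_space G d"
    have "M a \<in> carrier_mat (d (head G a)) (d u)"
      using M a by (auto simp: mat_space_def PiE_def Pi_def)
    then show "path_mat G d M u (a # w) $$ (r, s) =
        (\<Sum>t<d (head G a). path_mat G d M (head G a) w $$ (r, t) * M a $$ (t, s))"
      using path_mat_carrier[OF M a(3)] r Cons.prems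
      by (simp add: scalar_prod_def atLeast0LessThan)
  qed
qed

lemma (in wf_digraph) regular_action_coeff:
  assumes "r < d j" and "s < d i"
  shows "action_coeff G d N h j r i s \<in> regular_funs G d"
proof -
  have "(\<lambda>M. \<Sum>(u, w)\<in>short_paths_to G N j.
      if u = i then cpa_proj G h (u, w) * path_mat G d M u w $$ (r, s) else 0) \<in> regular_funs G d"
  proof (rule regular_sum)
    fix p assume p: "p \<in> short_paths_to G N j"
    obtain u w where uw: "p = (u, w)" by (cases p)
    show "(\<lambda>M. case p of (u, w) \<Rightarrow> if u = i then cpa_proj G h (u, w) * path_mat G d M u w $$ (r, s) else 0)
        \<in> regular_funs G d"
    proof (cases "u = i")
      case True
      then have "(\<lambda>M. path_mat G d M u w $$ (r, s)) \<in> regular_funs G d"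
        using p assms by (intro regular_path_mat) (auto simp: uw short_paths_to_def)
      then show ?thesis using True regular_mult[OF regular_const] by (simp add: uw)
    next
      case False
      then show ?thesis by (simp add: uw regular_const)
    qed
  qed
  then show ?thesis by (simp add: action_coeff_def[abs_def])
qed

lemma regular_hom_rows:
  assumes "wf_digraph Q"
  shows "\<forall>\<rho>\<in>hom_rows G Q J d k N. \<forall>p\<in>hom_coords G d k. (\<lambda>M. \<rho> M p) \<in> regular_funs Q d"
proof -
  interpret wf_digraph Q by fact
  show ?thesis
    unfolding hom_rows_def ball_Un ball_setcompr3
    by (auto simp: hom_coords_def regular_const intro!: regular_action_coeff)
qed

lemma openin_zariski_nonvanishing:
  assumes "p \<in> regular_funs Q d"
  shows "openin (zariski Q d) {M \<in> mat_space Q d. p M \<noteq> 0}"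
proof -
  obtain q where q: "q \<in> poly_funs Q d" "\<forall>M\<in>mat_space Q d. p M = q M"
    using assms by (auto simp: regular_funs_def)
  then show ?thesis unfolding openin_zariski by (auto intro!: exI[of _ "{q}"])
qed

lemma (in fin_digraph) fin_restrict_quiver: "fin_digraph (restrict_quiver G V)"
  by (intro fin_digraph.intro wf_restrict_quiver fin_digraph_axioms.intro) auto

text \<open>
  The truncation length is the same for all points of the variety, so the linear systems at different
  points have the same rows.
\<close>

lemma simple_ext_Rep:
  assumes G: "fin_digraph G" and J: "ideal J (cpa G)"
    and J2: "J \<subseteq> ideal_pow (cpa G) (arrow_ideal G) 2"
    and M: "M \<in> Rep (restrict_quiver G V) (cpa_proj (restrict_quiver G V) ` J) d"
    and k: "k \<in> verts G"
  shows "simple_ext G J V d M (vectorspace.dim class_ring (rep_space (restrict_quiver G V) d)) k"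
proof -
  interpret fin_digraph G by (rule G)
  have "ideal_pow (cpa G) (arrow_ideal G) 2 \<subseteq> arrow_ideal G"
    using ring.ideal_prod_inter[OF ring_cpa ideal_arrow_ideal
        ideal_ideal_pow[OF ideal_arrow_ideal], of 1] by (auto simp: numeral_2_eq_2)
  then have "J \<subseteq> arrow_ideal G" using J2 by blast
  then show ?thesis
    using M k fin_digraph.nilpotent_rep_uniform[OF fin_restrict_quiver, of M V d]
    by (intro simple_ext.intro restricted_representation.intro admissible_quotient.intro
        admissible_quotient_axioms.intro restricted_representation_axioms.intro
        simple_ext_axioms.intro G J)
      (auto simp: Rep_def)
qed

text \<open>
  At \<open>M0\<close> the dimension of the solution space equals the number of free unknowns found by the
  elimination; at a point where \<open>p\<close> does not vanish it is at most that number.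
\<close>

lemma g_vector_entry_locally_bounded:
  fixes G :: "('v, 'a) pre_digraph" and V :: "'v set"
  assumes G: "fin_digraph G" and J: "ideal J (cpa G)"
    and J2: "J \<subseteq> ideal_pow (cpa G) (arrow_ideal G) 2"
    and k: "k \<in> verts G"
    and M0: "M0 \<in> Rep (restrict_quiver G V) (cpa_proj (restrict_quiver G V) ` J) d"
  shows "\<exists>p\<in>regular_funs (restrict_quiver G V) d. p M0 \<noteq> 0 \<and>
    (\<forall>M\<in>Rep (restrict_quiver G V) (cpa_proj (restrict_quiver G V) ` J) d. p M \<noteq> 0 \<longrightarrow>
      ext_g_vector G (restrict_quiver G V) J d (M, v) k \<le>
        ext_g_vector G (restrict_quiver G V) J d (M0, v) k)"
proof -
  let ?Q = "restrict_quiver G V"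
  let ?N = "vectorspace.dim class_ring (rep_space ?Q d)"
  let ?C = "hom_coords G d k" and ?rows = "hom_rows G ?Q J d k ?N"
  interpret fin_digraph G by (rule G)
  have fin: "finite ?C" by (auto simp: hom_coords_def finite_annihilator_gens)
  have reg: "\<forall>\<rho>\<in>?rows. \<forall>i\<in>?C. (\<lambda>M. \<rho> M i) \<in> regular_funs ?Q d"
    by (rule regular_hom_rows[OF wf_restrict_quiver])
  have "\<exists>Z p. Z \<subseteq> ?C \<and> p \<in> regular_funs ?Q d \<and> p M0 \<noteq> 0 \<and>
    (\<forall>z. \<exists>x. (\<forall>i\<in>Z. x i = z i) \<and> (\<forall>\<rho>\<in>?rows. (\<Sum>i\<in>?C. \<rho> M0 i * x i) = 0)) \<and>
    (\<forall>M. p M \<noteq> 0 \<longrightarrow> (\<forall>x. (\<forall>i\<in>Z. x i = 0) \<and>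
      (\<forall>\<rho>\<in>?rows. (\<Sum>i\<in>?C. \<rho> M i * x i) = 0) \<longrightarrow> (\<forall>i\<in>?C. x i = 0)))"
    by (rule generic_elimination[OF fin regular_const regular_add regular_mult reg])
  then obtain Z p where Z: "Z \<subseteq> ?C" and p: "p \<in> regular_funs ?Q d" "p M0 \<noteq> 0"
    and surj: "\<forall>z. \<exists>x. (\<forall>i\<in>Z. x i = z i) \<and> (\<forall>\<rho>\<in>?rows. (\<Sum>i\<in>?C. \<rho> M0 i * x i) = 0)"
    and inj: "\<forall>M. p M \<noteq> 0 \<longrightarrow> (\<forall>x. (\<forall>i\<in>Z. x i = 0) \<and>
      (\<forall>\<rho>\<in>?rows. (\<Sum>i\<in>?C. \<rho> M i * x i) = 0) \<longrightarrow> (\<forall>i\<in>?C. x i = 0))"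
    by (elim exE conjE) (rule that)
  have bound: "simple_ext G J V d M ?N k" if "M \<in> Rep ?Q (cpa_proj ?Q ` J) d" for M
    by (rule simple_ext_Rep[OF G J J2 that k])
  interpret M0: simple_ext G J V d M0 ?N k by (rule bound[OF M0])
  let ?b = "int (card Z) - int ?N + int (v k)"
  have eq: "ext_g_vector G ?Q J d (M0, v) k = ?b"
  proof (rule M0.ext_g_vector_coordinates(2)[OF Z])
    show "\<forall>x. M0.solves k x \<and> (\<forall>i\<in>Z. x i = 0) \<longrightarrow> (\<forall>i\<in>?C. x i = 0)"
      using inj p(2) unfolding M0.solves_def by blast
  next
    fix z
    show "\<exists>x. M0.solves k x \<and> (\<forall>i\<in>Z. x i = z i)"
      using surj unfolding M0.solves_def by blast
  qed
  have "ext_g_vector G ?Q J d (M, v) k \<le> ?b"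
    if M: "M \<in> Rep ?Q (cpa_proj ?Q ` J) d" and pM: "p M \<noteq> 0" for M
  proof -
    interpret M: simple_ext G J V d M ?N k by (rule bound[OF M])
    show ?thesis
    proof (rule M.ext_g_vector_coordinates(1)[OF Z])
      show "\<forall>x. M.solves k x \<and> (\<forall>i\<in>Z. x i = 0) \<longrightarrow> (\<forall>i\<in>?C. x i = 0)"
        using inj pM unfolding M.solves_def by blast
    qed
  qed
  then show ?thesis using p eq by (intro bexI[of _ p]) simp_all
qed

lemma openin_g_vector_sublevel:
  fixes G :: "('v, 'a) pre_digraph" and V :: "'v set"
  assumes G: "fin_digraph G" and J: "ideal J (cpa G)"
    and J2: "J \<subseteq> ideal_pow (cpa G) (arrow_ideal G) 2"
    and k: "k \<in> verts G"
  shows "openin (subtopology (zariski (restrict_quiver G V) d)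
      (Rep (restrict_quiver G V) (cpa_proj (restrict_quiver G V) ` J) d))
    {M \<in> Rep (restrict_quiver G V) (cpa_proj (restrict_quiver G V) ` J) d.
      ext_g_vector G (restrict_quiver G V) J d (M, v) k < c}"
proof -
  let ?Q = "restrict_quiver G V"
  let ?Rep = "Rep ?Q (cpa_proj ?Q ` J) d"
  let ?U = "{M \<in> ?Rep. ext_g_vector G ?Q J d (M, v) k < c}"
  have "\<exists>W. openin (subtopology (zariski ?Q d) ?Rep) W \<and> M0 \<in> W \<and> W \<subseteq> ?U" if M0: "M0 \<in> ?U" for M0
  proof -
    have Rep0: "M0 \<in> ?Rep" using M0 by blast
    obtain p where p: "p \<in> regular_funs ?Q d" "p M0 \<noteq> 0"
      and le: "\<And>M. M \<in> ?Rep \<Longrightarrow> p M \<noteq> 0 \<Longrightarrow>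
        ext_g_vector G ?Q J d (M, v) k \<le> ext_g_vector G ?Q J d (M0, v) k"
      using g_vector_entry_locally_bounded[OF G J J2 k Rep0, of v] by blast
    let ?W = "?Rep \<inter> {M \<in> mat_space ?Q d. p M \<noteq> 0}"
    have "openin (subtopology (zariski ?Q d) ?Rep) ?W"
      by (rule openin_subtopology_Int2[OF openin_zariski_nonvanishing[OF p(1)]])
    moreover have "M0 \<in> ?W" using Rep0 p(2) by (auto simp: Rep_def)
    moreover have "?W \<subseteq> ?U" using le M0 by force
    ultimately show ?thesis by blast
  qed
  then show ?thesis by (subst openin_subopen) blast
qed

theorem lemma5p9:
  fixes n m :: nat
    and Qt Q :: "(nat, 'a) pre_digraph"
    and Jt J :: "(nat \<times> 'a list \<Rightarrow> complex) set"
    and d v :: "nat \<Rightarrow> nat"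
    and k :: nat
  assumes "n \<ge> 1"
    and "fin_digraph Qt" and "verts Qt = {1..n+m}"
    and "Q = restrict_quiver Qt {1..n}"
    and "ideal Jt (cpa Qt)"
    and "Jt \<subseteq> ideal_pow (cpa Qt) (arrow_ideal Qt) 2"
    and "closedin (adic_topology (cpa Qt) (arrow_ideal Qt)) Jt"
    and "J = cpa_proj Q ` Jt"
    and "\<forall>i. i \<notin> {1..n} \<longrightarrow> d i = 0"
    and "\<forall>i. i \<notin> {1..n} \<longrightarrow> v i = 0"
    and "k \<in> verts Q"
  shows "upper_semicontinuous (decRep_topology Q J d v) (\<lambda>\<M>. ext_g_vector Qt Q Jt d \<M> k)"
  unfolding upper_semicontinuous_def
proof (rule allI)
  fix c :: int
  let ?U = "{M \<in> Rep Q J d. ext_g_vector Qt Q Jt d (M, v) k < c}"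
  have "openin (subtopology (zariski Q d) (Rep Q J d)) ?U"
    using openin_g_vector_sublevel[OF assms(2,5,6), of k "{1..n}"] assms(4,8,11) by simp
  then have "openin (decRep_topology Q J d v) (fst -` ?U \<inter> decRep Q J d v)"
    unfolding decRep_topology_def openin_pullback_topology by (intro exI[of _ ?U] conjI refl)
  moreover have "{\<M> \<in> topspace (decRep_topology Q J d v). ext_g_vector Qt Q Jt d \<M> k < c} =
      fst -` ?U \<inter> decRep Q J d v"
    by (auto simp: decRep_topology_def decRep_def topspace_pullback_topology topspace_zariski Rep_def)
  ultimately show "openin (decRep_topology Q J d v)
      {\<M> \<in> topspace (decRep_topology Q J d v). ext_g_vector Qt Q Jt d \<M> k < c}"
    by (simp only:)
qed

end
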